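(* Let $q\geqslant 4$ be a prime power, $A=\mathbb{F}_q[T]$, $F=\mathbb{F}_q(T)$, $\mathfrak{l}$ a nonzero prime ideal of $A$ and $\mathbb{F}_{\mathfrak{l}}=A/\mathfrak{l}$. Let $g_1,g_2\in A$ with $g_2\neq0$, and let $\phi^{(g_1,g_2)}$ be the rank-$2$ Drinfeld $A$-module over $F$ with $\phi^{(g_1,g_2)}_T=T+g_1\tau+g_2\tau^2$. Suppose $\mathrm{Im}\,\bar{\rho}_{\phi^{(g_1,g_2)},\mathfrak{l}}\supseteq\mathrm{SL}_2(\mathbb{F}_{\mathfrak{l}})$ and $g_2\notin\mathfrak{l}$. Then the image of the mod-$\mathfrak{l}^2$ Galois representation $\bar{\rho}_{\phi^{(g_1,g_2)},\mathfrak{l}^2}$ contains a non-scalar matrix which becomes the identity after reduction modulo $\mathfrak{l}$.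
   Context: $F\{\tau\}$ is the twisted polynomial ring with $\tau\alpha=\alpha^q\tau$; a Drinfeld $A$-module of rank $r$ over $F$ is a ring homomorphism $\phi:A\to F\{\tau\}$ with $\deg_\tau\phi_a=r\deg_T a$ and constant term of $\phi_a$ equal to $a$. For a nonzero ideal $\mathfrak{a}=(a)$, $\phi[\mathfrak{a}]$ is the set of roots of $\phi_a(x)$ in $F^{\mathrm{sep}}$, a free $A/\mathfrak{a}$-module of rank $r$ with an action of $G_F=\mathrm{Gal}(F^{\mathrm{sep}}/F)$; the mod-$\mathfrak{a}$ Galois representation is $\bar{\rho}_{\phi,\mathfrak{a}}:G_F\to\mathrm{Aut}(\phi[\mathfrak{a}])\cong\mathrm{GL}_r(A/\mathfrak{a})$ (image well defined up to conjugation). Reduction modulo $\mathfrak{l}$ refers to $\mathrm{GL}_2(A/\mathfrak{l}^2)\to\mathrm{GL}_2(A/\mathfrak{l})$, compatible with $\phi[\mathfrak{l}]\subset\phi[\mathfrak{l}^2]$. *)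

theory Defs
  imports
    "HOL-Algebra.Algebraic_Closure_Type"
    "HOL-Algebra.Ideal_Product"
    "HOL-Computational_Algebra.Polynomial_Factorial"
    "HOL-Analysis.Finite_Cartesian_Product"
begin

text \<open>
  The finite field \<open>\<bbbF>\<^sub>q\<close> is a type \<open>'k\<close> with \<open>q = CARD('k)\<close>, so that \<open>A = \<bbbF>\<^sub>q[T]\<close> is
  \<open>'k poly\<close>, \<open>F = \<bbbF>\<^sub>q(T)\<close> is \<open>'k poly fract\<close>, and the fixed algebraic closure of \<open>F\<close>
  is \<open>'k poly fract alg_closure\<close>.
\<close>

abbreviation A_ring :: "'k :: {field, finite} poly ring" where
  "A_ring \<equiv> ring_of_type_algebra"


subsection \<open>Separable closure and absolute Galois group\<close>

definition separable_elem :: "'f :: field alg_closure \<Rightarrow> bool" where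
  "separable_elem x \<longleftrightarrow>
     (\<exists>p. Factorial_Ring.irreducible p \<and> poly (map_poly to_ac p) x = 0 \<and>
          rsquarefree (map_poly to_ac p))"

definition sep_closure :: "'f :: field alg_closure ring" where
  "sep_closure = ring_of_type_algebra \<lparr>carrier := {x. separable_elem x}\<rparr>"

text \<open>
  Automorphisms of the separable closure are made extensional (value \<open>undefined\<close> outside of
  it), so that each of them is represented by exactly one HOL function.
\<close>

definition abs_galois :: "('f :: field alg_closure \<Rightarrow> 'f alg_closure) set" where
  "abs_galois =
     {\<sigma> \<in> ring_iso sep_closure sep_closure.
        \<sigma> \<in> extensional (carrier sep_closure) \<and> (\<forall>a. \<sigma> (to_ac a) = to_ac a)}"


subsection \<open>Twisted polynomials and Drinfeld modules\<close>

text \<open>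
  The element \<open>\<Sum>i. c\<^sub>i \<tau>\<^sup>i\<close> of \<open>F{\<tau>}\<close> is stored as the polynomial with coefficients \<open>c\<^sub>i\<close>.
  Only the additive structure is that of \<open>'k poly fract poly\<close>; multiplication is given by
  \<open>(a \<tau>\<^sup>i)(b \<tau>\<^sup>j) = a b\<^bsup>q^i\<^esup> \<tau>\<^bsup>i+j\<^esup>\<close>.
\<close>

definition twisted_mult ::
  "'k :: {field, finite} poly fract poly \<Rightarrow> 'k poly fract poly \<Rightarrow> 'k poly fract poly" where
  "twisted_mult f g =
     (\<Sum>i\<le>Polynomial.degree f. \<Sum>j\<le>Polynomial.degree g.
        Polynomial.monom (poly.coeff f i * poly.coeff g j ^ (CARD('k) ^ i)) (i + j))"

definition twisted_ring :: "'k :: {field, finite} poly fract poly ring" where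
  "twisted_ring = ring_of_type_algebra \<lparr>monoid.mult := twisted_mult\<rparr>"

definition drinfeld_module ::
  "nat \<Rightarrow> ('k :: {field, finite} poly \<Rightarrow> 'k poly fract poly) \<Rightarrow> bool" where
  "drinfeld_module r \<phi> \<longleftrightarrow>
     \<phi> \<in> Ring.ring_hom A_ring twisted_ring \<and>
     (\<forall>a. Polynomial.degree (\<phi> a) = r * Polynomial.degree a) \<and>
     (\<forall>a. poly.coeff (\<phi> a) 0 = to_fract a)"

text \<open>\<open>twisted_eval f\<close> is the \<open>\<bbbF>\<^sub>q\<close>-linear polynomial function \<open>x \<mapsto> \<Sum>i. c\<^sub>i x\<^bsup>q^i\<^esup>\<close>.\<close>

definition twisted_eval ::
  "'k :: {field, finite} poly fract poly \<Rightarrow> 'k poly fract alg_closure \<Rightarrow> 'k poly fract alg_closure"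
  where
  "twisted_eval f x = (\<Sum>i\<le>Polynomial.degree f. to_ac (poly.coeff f i) * x ^ (CARD('k) ^ i))"


subsection \<open>Torsion and Galois representations\<close>

definition torsion ::
  "('k :: {field, finite} poly \<Rightarrow> 'k poly fract poly) \<Rightarrow> 'k poly set \<Rightarrow>
   'k poly fract alg_closure set" where
  "torsion \<phi> \<aa> =
     {x \<in> carrier sep_closure. \<exists>a. \<aa> = PIdl\<^bsub>A_ring\<^esub> a \<and> twisted_eval (\<phi> a) x = 0}"

text \<open>
  The action of a residue class \<open>c \<in> A/\<aa>\<close> on \<open>\<phi>[\<aa>]\<close>; on \<open>\<phi>[\<aa>]\<close> it does not depend on the
  representative.
\<close>

definition residue_act ::
  "('k :: {field, finite} poly \<Rightarrow> 'k poly fract poly) \<Rightarrow> 'k poly set \<Rightarrow>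
   'k poly fract alg_closure \<Rightarrow> 'k poly fract alg_closure" where
  "residue_act \<phi> c x = twisted_eval (\<phi> (SOME b. b \<in> c)) x"

definition lin_comb ::
  "('k :: {field, finite} poly \<Rightarrow> 'k poly fract poly) \<Rightarrow> 'k poly set ^ 'r \<Rightarrow>
   'k poly fract alg_closure ^ 'r \<Rightarrow> 'k poly fract alg_closure" where
  "lin_comb \<phi> c e = (\<Sum>i\<in>UNIV. residue_act \<phi> (c $ i) (e $ i))"

text \<open>\<open>e\<close> is a basis of \<open>\<phi>[\<aa>]\<close> as an \<open>A/\<aa>\<close>-module.\<close>

definition torsion_basis ::
  "('k :: {field, finite} poly \<Rightarrow> 'k poly fract poly) \<Rightarrow> 'k poly set \<Rightarrow>
   'k poly fract alg_closure ^ 'r \<Rightarrow> bool" where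
  "torsion_basis \<phi> \<aa> e \<longleftrightarrow>
     (\<forall>i. e $ i \<in> torsion \<phi> \<aa>) \<and>
     bij_betw (\<lambda>c. lin_comb \<phi> c e) {c. \<forall>i. c $ i \<in> carrier (A_ring Quot \<aa>)} (torsion \<phi> \<aa>)"

text \<open>
  The matrix over \<open>A/\<aa>\<close> of the action of \<open>\<sigma>\<close> on \<open>\<phi>[\<aa>]\<close> in the basis \<open>e\<close>: its \<open>j\<close>-th column
  consists of the coordinates of \<open>\<sigma> (e $ j)\<close>.
\<close>

definition mod_rep ::
  "('k :: {field, finite} poly \<Rightarrow> 'k poly fract poly) \<Rightarrow> 'k poly set \<Rightarrow>
   'k poly fract alg_closure ^ 'r \<Rightarrow>
   ('k poly fract alg_closure \<Rightarrow> 'k poly fract alg_closure) \<Rightarrow> 'k poly set ^ 'r ^ 'r" where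
  "mod_rep \<phi> \<aa> e \<sigma> =
     (THE M. (\<forall>i j. M $ i $ j \<in> carrier (A_ring Quot \<aa>)) \<and>
             (\<forall>j. \<sigma> (e $ j) = lin_comb \<phi> (\<chi> i. M $ i $ j) e))"

definition mod_rep_image ::
  "('k :: {field, finite} poly \<Rightarrow> 'k poly fract poly) \<Rightarrow> 'k poly set \<Rightarrow>
   'k poly fract alg_closure ^ 'r \<Rightarrow> ('k poly set ^ 'r ^ 'r) set" where
  "mod_rep_image \<phi> \<aa> e = mod_rep \<phi> \<aa> e ` abs_galois"


subsection \<open>Matrices over a ring given by a record\<close>

definition SL2 :: "('c, 'm) ring_scheme \<Rightarrow> ('c ^ 2 ^ 2) set" where
  "SL2 R = {M. (\<forall>i j. M $ i $ j \<in> carrier R) \<and>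
     (M $ 1 $ 1 \<otimes>\<^bsub>R\<^esub> M $ 2 $ 2) \<ominus>\<^bsub>R\<^esub> (M $ 1 $ 2 \<otimes>\<^bsub>R\<^esub> M $ 2 $ 1) = \<one>\<^bsub>R\<^esub>}"

definition scalar_matrix :: "('c, 'm) ring_scheme \<Rightarrow> 'c \<Rightarrow> 'c ^ 'r ^ 'r" where
  "scalar_matrix R c = (\<chi> i j. if i = j then c else \<zero>\<^bsub>R\<^esub>)"

definition is_scalar :: "('c, 'm) ring_scheme \<Rightarrow> 'c ^ 'r ^ 'r \<Rightarrow> bool" where
  "is_scalar R M \<longleftrightarrow> (\<exists>c \<in> carrier R. M = scalar_matrix R c)"

text \<open>
  For \<open>\<aa> \<subseteq> \<bb>\<close>, the entrywise reduction \<open>A/\<aa> \<rightarrow> A/\<bb>\<close>: on cosets it is \<open>x + \<aa> \<mapsto> (x + \<aa>) + \<bb> = x + \<bb>\<close>.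
\<close>

definition reduce_matrix ::
  "'k :: {field, finite} poly set \<Rightarrow> 'k poly set ^ 'r ^ 'r \<Rightarrow> 'k poly set ^ 'r ^ 'r" where
  "reduce_matrix \<bb> M = (\<chi> i j. M $ i $ j <+>\<^bsub>A_ring\<^esub> \<bb>)"

end

theory Submission
  imports Defs "HOL-Analysis.Cartesian_Space"
begin

text \<open>
  The proof is local at \<open>\<ll> = (a)\<close>, where \<open>\<phi>\<close> has good reduction. Extend the \<open>a\<close>-adic absolute
  value to the algebraic closure. Let \<open>Q\<close> be the number of \<open>a\<close>-torsion points in the kernel of
  reduction. The Newton polygon shows that the \<open>Q (Q - 1)\<close> points of exact order \<open>a\<^sup>2\<close> in the
  kernel of reduction have valuation \<open>1 / (Q (Q - 1))\<close>. Elements fixed by inertia have integral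
  valuation, so inertia permutes these points transitively.

  Suppose every automorphism that is trivial on \<open>\<phi>[\<ll>]\<close> is scalar on \<open>\<phi>[\<ll>\<^sup>2]\<close>. If all of \<open>\<phi>[\<ll>]\<close>
  is in the kernel of reduction (supersingular case), the stabiliser in inertia of a point \<open>y \<noteq> 0\<close>
  of \<open>\<phi>[\<ll>]\<close> is trivial on \<open>\<phi>[\<ll>]\<close>, hence moves a point above \<open>y\<close> by multiples of \<open>y\<close> only,
  against transitivity. Otherwise inertia acts on \<open>\<phi>[\<ll>\<^sup>2]\<close> through matrices with rows \<open>(\<chi>, *)\<close>
  and \<open>(0, 1)\<close>. A scalar matrix of this kind is trivial, so \<open>\<chi> mod \<ll>\<^sup>2\<close> factors through \<open>\<phi>[\<ll>]\<close>,
  and a commutator with an element satisfying \<open>\<chi> \<noteq> 1 mod \<ll>\<close> forces \<open>\<chi> = 1\<close> on the wild part, again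
  against transitivity.
\<close>

section \<open>Homomorphisms on subfields and polynomials over them\<close>

text \<open>No completion is taken. The obstacle is then to show that an element fixed by inertia
  has the value of an element of F; this comes from a trace down to F, taken after multiplication by
  a high power of an element that is close to 1 at the chosen place and small at all others.
  Automorphisms are built on the whole algebraic closure and restricted to the separable closure
  only at the end. Their common fixed points may be purely inseparable over F, so separability is
  carried along wherever a trace or a symmetric function has to descend to F. Matrices stay out of
  the local argument: an automorphism that is trivial on the a-torsion acts as a scalar on the
  a^2-torsion exactly if it has the form x + m(a x) for some m in A, and this form is what gets
  refuted. The absolute value is normalised by \<open>w (of_A a) = 1/2\<close>, which explains the
  constant 1/2 and the powers of 2 throughout.\<close>

definition ring_set :: "'a::comm_ring_1 set \<Rightarrow> bool" where
  "ring_set R \<longleftrightarrow> 1 \<in> R \<and> (\<forall>x\<in>R. \<forall>y\<in>R. x - y \<in> R \<and> x * y \<in> R)"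

lemma ring_setD:
  assumes "ring_set R"
  shows "1 \<in> R" "0 \<in> R" "x \<in> R \<Longrightarrow> y \<in> R \<Longrightarrow> x - y \<in> R" "x \<in> R \<Longrightarrow> y \<in> R \<Longrightarrow> x * y \<in> R"
    "x \<in> R \<Longrightarrow> - x \<in> R" "x \<in> R \<Longrightarrow> y \<in> R \<Longrightarrow> x + y \<in> R" "x \<in> R \<Longrightarrow> x ^ n \<in> R"
proof -
  show 1: "1 \<in> R" and d: "\<And>x y. x \<in> R \<Longrightarrow> y \<in> R \<Longrightarrow> x - y \<in> R"
    and m: "\<And>x y. x \<in> R \<Longrightarrow> y \<in> R \<Longrightarrow> x * y \<in> R"
    using assms by (auto simp: ring_set_def)
  show 0: "0 \<in> R" using d[OF 1 1] by simp
  show n: "x \<in> R \<Longrightarrow> - x \<in> R" for x using d[OF 0] by fastforce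
  show "x \<in> R \<Longrightarrow> y \<in> R \<Longrightarrow> x + y \<in> R" using d[OF _ n] by fastforce
  show "x \<in> R \<Longrightarrow> x ^ n \<in> R" by (induction n) (auto simp: 1 m)
qed

lemma ring_set_sum: "ring_set R \<Longrightarrow> (\<And>i. i \<in> S \<Longrightarrow> f i \<in> R) \<Longrightarrow> sum f S \<in> R"
  by (induction S rule: infinite_finite_induct) (auto intro: ring_setD)

text \<open>Since \<open>inverse 0 = 0\<close>, closure under \<open>inverse\<close> needs no
  exception for zero.\<close>

definition field_set :: "'a::field set \<Rightarrow> bool" where
  "field_set k \<longleftrightarrow> 1 \<in> k \<and> (\<forall>x\<in>k. \<forall>y\<in>k. x - y \<in> k \<and> x * y \<in> k) \<and> (\<forall>x\<in>k. inverse x \<in> k)"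

lemma field_set_ring: "field_set k \<Longrightarrow> ring_set k"
  by (simp add: field_set_def ring_set_def)

lemma field_setD:
  assumes "field_set k"
  shows "1 \<in> k" "0 \<in> k" "x \<in> k \<Longrightarrow> y \<in> k \<Longrightarrow> x - y \<in> k" "x \<in> k \<Longrightarrow> y \<in> k \<Longrightarrow> x * y \<in> k"
    "x \<in> k \<Longrightarrow> inverse x \<in> k" "x \<in> k \<Longrightarrow> - x \<in> k" "x \<in> k \<Longrightarrow> y \<in> k \<Longrightarrow> x + y \<in> k"
    "x \<in> k \<Longrightarrow> y \<in> k \<Longrightarrow> x / y \<in> k" "x \<in> k \<Longrightarrow> x ^ n \<in> k"
  using ring_setD[OF field_set_ring[OF assms]] assms by (auto simp: field_set_def divide_inverse)

lemma field_set_sum: "field_set k \<Longrightarrow> (\<And>i. i \<in> S \<Longrightarrow> f i \<in> k) \<Longrightarrow> sum f S \<in> k"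
  by (rule ring_set_sum[OF field_set_ring])

lemma field_set_prod: "field_set k \<Longrightarrow> (\<And>i. i \<in> S \<Longrightarrow> f i \<in> k) \<Longrightarrow> prod f S \<in> k"
  by (induction S rule: infinite_finite_induct) (auto intro: field_setD)

text \<open>Polynomials over a subset stay polynomials over the ambient field, so evaluation, degree
  and roots need no change of type.\<close>

definition polys_over :: "'a::field set \<Rightarrow> 'a poly set" where
  "polys_over k = {p. \<forall>i. coeff p i \<in> k}"

lemma polys_overI: "(\<And>i. coeff p i \<in> k) \<Longrightarrow> p \<in> polys_over k"
  by (auto simp: polys_over_def)

lemma polys_overD: "p \<in> polys_over k \<Longrightarrow> coeff p i \<in> k"
  by (auto simp: polys_over_def)

context
  fixes k :: "'a::field set"
  assumes k: "ring_set k"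
begin

lemma polys_over_0: "0 \<in> polys_over k"
  and polys_over_diff: "p \<in> polys_over k \<Longrightarrow> q \<in> polys_over k \<Longrightarrow> p - q \<in> polys_over k"
  and polys_over_add: "p \<in> polys_over k \<Longrightarrow> q \<in> polys_over k \<Longrightarrow> p + q \<in> polys_over k"
  and polys_over_const: "c \<in> k \<Longrightarrow> [:c:] \<in> polys_over k"
  and polys_over_monom: "c \<in> k \<Longrightarrow> monom c n \<in> polys_over k"
  and polys_over_smult: "c \<in> k \<Longrightarrow> p \<in> polys_over k \<Longrightarrow> smult c p \<in> polys_over k"
  by (auto simp: polys_over_def coeff_pCons ring_setD[OF k] split: nat.splits)

lemma polys_over_mult: "p \<in> polys_over k \<Longrightarrow> q \<in> polys_over k \<Longrightarrow> p * q \<in> polys_over k"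
  by (auto simp: polys_over_def coeff_mult intro!: ring_set_sum[OF k] ring_setD[OF k])

lemma polys_over_linear: "c \<in> k \<Longrightarrow> [:- c, 1:] \<in> polys_over k"
  by (auto simp: polys_over_def coeff_pCons ring_setD[OF k] split: nat.splits)

lemma polys_over_prod: "(\<And>i. i \<in> S \<Longrightarrow> f i \<in> polys_over k) \<Longrightarrow> prod f S \<in> polys_over k"
  by (induction S rule: infinite_finite_induct)
     (use polys_over_const[of 1] in \<open>auto intro: polys_over_mult simp: ring_setD[OF k] pCons_one\<close>)

lemma polys_over_pderiv: "p \<in> polys_over k \<Longrightarrow> pderiv p \<in> polys_over k"
proof (rule polys_overI)
  fix i assume p: "p \<in> polys_over k"
  have "of_nat n \<in> k" for n by (induction n) (auto intro: ring_setD[OF k])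
  from this[of "Suc i"] show "coeff (pderiv p) i \<in> k"
    using p by (simp add: coeff_pderiv polys_overD ring_setD[OF k] del: of_nat_Suc)
qed

text \<open>A monic divisor requires no inverses, so cancelling leading terms keeps quotient and
  remainder over a mere ring.\<close>

lemma polys_over_division:
  assumes m: "m \<in> polys_over k" "lead_coeff m = 1" "degree m > 0"
    and g: "g \<in> polys_over k"
  shows "\<exists>q r. q \<in> polys_over k \<and> r \<in> polys_over k \<and> g = q * m + r \<and> degree r < degree m"
  using g
proof (induction "degree g" arbitrary: g rule: less_induct)
  case less
  show ?case
  proof (cases "degree g < degree m")
    case True
    then show ?thesis using less.prems polys_over_0 by (intro exI[of _ 0] exI[of _ g]) auto
  next
    case False
    let ?n = "degree g - degree m"
    define t where "t = monom (lead_coeff g) ?n"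
    define g' where "g' = g - t * m"
    have t: "t \<in> polys_over k" unfolding t_def by (intro polys_over_monom polys_overD less.prems)
    have g': "g' \<in> polys_over k" unfolding g'_def by (intro polys_over_diff polys_over_mult t m less.prems)
    have g0: "lead_coeff g \<noteq> 0" using False m(3) by auto
    have dt: "degree t = ?n" unfolding t_def using g0 by (rule Polynomial.degree_monom_eq)
    have "t \<noteq> 0" "m \<noteq> 0" using g0 m(2) by (auto simp: t_def)
    then have dtm: "degree (t * m) = degree g"
      using dt False by (simp add: degree_mult_eq)
    have "coeff (t * m) (degree (t * m)) = lead_coeff t * lead_coeff m"
      by (rule Polynomial.lead_coeff_mult)
    then have c: "coeff (t * m) (degree g) = lead_coeff g"
      using dtm dt m(2) by (simp add: t_def)
    have "degree g' < degree g"
    proof -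
      have "degree g' \<le> degree g" unfolding g'_def by (intro degree_diff_le) (auto simp: dtm)
      moreover have "coeff g' (degree g) = 0" by (simp add: g'_def c)
      moreover have "degree g > 0" using False m(3) by auto
      ultimately show ?thesis
        by (metis le_neq_implies_less leading_coeff_0_iff Polynomial.degree_0)
    qed
    from less.hyps[OF this g'] obtain q r where qr: "q \<in> polys_over k" "r \<in> polys_over k"
      "g' = q * m + r" "degree r < degree m" by blast
    then have "g = (q + t) * m + r" by (simp add: g'_def algebra_simps)
    with qr t show ?thesis by (intro exI[of _ "q + t"] exI[of _ r]) (auto intro: polys_over_add)
  qed
qed

end

text \<open>Minimality is imposed through the degree among all nonzero annihilating polynomials, the
  form that division with remainder turns into divisibility.\<close>

definition is_minpoly :: "'a::field set \<Rightarrow> 'a \<Rightarrow> 'a poly \<Rightarrow> bool" where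
  "is_minpoly k x m \<longleftrightarrow> m \<in> polys_over k \<and> lead_coeff m = 1 \<and> poly m x = 0 \<and>
     (\<forall>g\<in>polys_over k. g \<noteq> 0 \<longrightarrow> poly g x = 0 \<longrightarrow> degree m \<le> degree g)"

lemma minpoly_degree_pos: "is_minpoly k x m \<Longrightarrow> degree m > 0"
  by (rule ccontr) (auto simp: is_minpoly_def elim!: degree_eq_zeroE)

lemma minpoly_dvd:
  assumes k: "field_set k" and m: "is_minpoly k x m" and g: "g \<in> polys_over k" "poly g x = 0"
  shows "\<exists>q\<in>polys_over k. g = q * m"
proof -
  obtain q r where qr: "q \<in> polys_over k" "r \<in> polys_over k" "g = q * m + r"
    "degree r < degree m"
    using polys_over_division[OF field_set_ring[OF k], of m g] m g minpoly_degree_pos[OF m] by (auto simp: is_minpoly_def)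
  have "poly r x = 0" using g qr m by (simp add: is_minpoly_def)
  then have "r = 0" using qr m unfolding is_minpoly_def by (meson not_le)
  with qr show ?thesis by auto
qed

lemma minpoly_exists:
  assumes k: "field_set k" and p: "p \<in> polys_over k" "p \<noteq> 0" "poly p x = 0"
  shows "\<exists>m. is_minpoly k x m"
proof -
  define P where "P n \<longleftrightarrow> (\<exists>g\<in>polys_over k. g \<noteq> 0 \<and> poly g x = 0 \<and> degree g = n)" for n
  have "P (degree p)" using p by (auto simp: P_def)
  then have "P (Least P)" by (rule LeastI)
  then obtain g where g: "g \<in> polys_over k" "g \<noteq> 0" "poly g x = 0" "degree g = Least P"
    by (auto simp: P_def)
  define m where "m = smult (inverse (lead_coeff g)) g"
  have "is_minpoly k x m" unfolding is_minpoly_def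
  proof (intro conjI ballI impI)
    show "m \<in> polys_over k" unfolding m_def
      by (intro polys_over_smult[OF field_set_ring[OF k]] field_setD[OF k] polys_overD g)
    have "lead_coeff g \<noteq> 0" using g(2) by simp
    then show "lead_coeff m = 1" unfolding m_def lead_coeff_smult by simp
    show "poly m x = 0" using g by (simp add: m_def)
    fix h assume "h \<in> polys_over k" "h \<noteq> 0" "poly h x = 0"
    then have "P (degree h)" by (auto simp: P_def)
    then show "degree m \<le> degree h" using g by (simp add: m_def Least_le)
  qed
  then show ?thesis ..
qed

section \<open>Homomorphisms prescribed on a subfield\<close>

definition hom_on :: "'a::field set \<Rightarrow> ('a \<Rightarrow> 'b::field) \<Rightarrow> bool" where
  "hom_on k \<tau> \<longleftrightarrow> \<tau> 1 = 1 \<and> (\<forall>x\<in>k. \<forall>y\<in>k. \<tau> (x - y) = \<tau> x - \<tau> y \<and> \<tau> (x * y) = \<tau> x * \<tau> y)"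

context
  fixes k :: "'a::field set" and \<tau> :: "'a \<Rightarrow> 'b::field"
  assumes k: "field_set k" and hom: "hom_on k \<tau>"
begin

lemma hom_on_simps:
  "\<tau> 1 = 1" "\<tau> 0 = 0" "x \<in> k \<Longrightarrow> y \<in> k \<Longrightarrow> \<tau> (x - y) = \<tau> x - \<tau> y"
  "x \<in> k \<Longrightarrow> y \<in> k \<Longrightarrow> \<tau> (x * y) = \<tau> x * \<tau> y" "x \<in> k \<Longrightarrow> \<tau> (- x) = - \<tau> x"
  "x \<in> k \<Longrightarrow> y \<in> k \<Longrightarrow> \<tau> (x + y) = \<tau> x + \<tau> y"
  "x \<in> k \<Longrightarrow> \<tau> (inverse x) = inverse (\<tau> x)" "x \<in> k \<Longrightarrow> \<tau> x = 0 \<longleftrightarrow> x = 0"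
  "x \<in> k \<Longrightarrow> \<tau> (x ^ n) = \<tau> x ^ n"
proof -
  note K = field_setD[OF k]
  show 1: "\<tau> 1 = 1" and d: "\<And>x y. x \<in> k \<Longrightarrow> y \<in> k \<Longrightarrow> \<tau> (x - y) = \<tau> x - \<tau> y"
    and m: "\<And>x y. x \<in> k \<Longrightarrow> y \<in> k \<Longrightarrow> \<tau> (x * y) = \<tau> x * \<tau> y" using hom by (auto simp: hom_on_def)
  show 0: "\<tau> 0 = 0" using d[of 1 1] K by simp
  show n: "\<And>x. x \<in> k \<Longrightarrow> \<tau> (- x) = - \<tau> x" using d[of 0] K 0 by fastforce
  show "x \<in> k \<Longrightarrow> y \<in> k \<Longrightarrow> \<tau> (x + y) = \<tau> x + \<tau> y" using d[of x "- y"] n K by fastforce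
  have i: "\<tau> x * \<tau> (inverse x) = 1" if "x \<in> k" "x \<noteq> 0" for x
    using m[of x "inverse x"] that K 1 by simp
  show "x \<in> k \<Longrightarrow> \<tau> (inverse x) = inverse (\<tau> x)"
    using i[of x] 0 by (cases "x = 0") (auto simp: inverse_unique)
  show "x \<in> k \<Longrightarrow> \<tau> x = 0 \<longleftrightarrow> x = 0" using i[of x] 0 by (cases "x = 0") auto
  show "x \<in> k \<Longrightarrow> \<tau> (x ^ n) = \<tau> x ^ n" by (induction n) (auto simp: 1 m K)
qed

lemma hom_on_sum: "(\<And>i. i \<in> S \<Longrightarrow> f i \<in> k) \<Longrightarrow> \<tau> (sum f S) = (\<Sum>i\<in>S. \<tau> (f i))"
  by (induction S rule: infinite_finite_induct) (auto simp: hom_on_simps field_set_sum[OF k])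

lemma map_poly_hom_on:
  assumes p: "p \<in> polys_over k" and q: "q \<in> polys_over k"
  shows "map_poly \<tau> (p * q) = map_poly \<tau> p * map_poly \<tau> q"
    and "map_poly \<tau> (p + q) = map_poly \<tau> p + map_poly \<tau> q"
    and "map_poly \<tau> (p - q) = map_poly \<tau> p - map_poly \<tau> q"
proof -
  show "map_poly \<tau> (p * q) = map_poly \<tau> p * map_poly \<tau> q"
    using polys_overD[OF p] polys_overD[OF q]
    by (intro poly_eqI) (simp add: coeff_map_poly hom_on_simps coeff_mult hom_on_sum field_setD[OF k])
qed (use polys_overD[OF p] polys_overD[OF q] in
      \<open>auto intro!: poly_eqI simp: coeff_map_poly hom_on_simps\<close>)

lemma degree_map_poly_hom_on: "p \<in> polys_over k \<Longrightarrow> degree (map_poly \<tau> p) = degree p"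
  by (cases "p = 0") (auto intro!: map_poly_degree_eq simp: hom_on_simps polys_overD)

lemma poly_map_poly_hom_on:
  assumes "p \<in> polys_over k" "x \<in> k"
  shows "poly (map_poly \<tau> p) (\<tau> x) = \<tau> (poly p x)"
  unfolding poly_altdef degree_map_poly_hom_on[OF assms(1)]
  using assms polys_overD[OF assms(1)]
  by (subst hom_on_sum) (auto simp: coeff_map_poly hom_on_simps field_setD[OF k])

end


lemma polys_over_pCons:
  "pCons a p \<in> polys_over k \<longleftrightarrow> a \<in> k \<and> p \<in> polys_over k"
  by (auto simp: polys_over_def coeff_pCons split: nat.splits)

lemma polys_over_pcompose:
  assumes "ring_set k" "p \<in> polys_over k" "q \<in> polys_over k"
  shows "pcompose p q \<in> polys_over k"
  using assms(2)
  by (induction p)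
     (auto simp: polys_over_pCons pcompose_pCons polys_over_0 polys_over_add polys_over_const
        polys_over_mult assms)

section \<open>Simple algebraic extensions\<close>

definition simple_ext :: "'a::field set \<Rightarrow> 'a \<Rightarrow> 'a set" where
  "simple_ext k x = (\<lambda>g. poly g x) ` polys_over k"

lemma simple_extI: "g \<in> polys_over k \<Longrightarrow> z = poly g x \<Longrightarrow> z \<in> simple_ext k x"
  by (auto simp: simple_ext_def)

text \<open>If the constant term vanished, cancelling X would leave a nonzero polynomial of smaller
  degree that still kills \<open>z\<close>.\<close>

lemma minpoly_coeff_0:
  assumes k: "field_set k" and m: "is_minpoly k z m" and z: "z \<noteq> 0"
  shows "coeff m 0 \<noteq> 0"
proof
  assume c: "coeff m 0 = 0"
  obtain a m' where am: "m = pCons a m'" by (cases m)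
  with c have [simp]: "a = 0" by simp
  have "m' \<noteq> 0" "m' \<in> polys_over k" "poly m' z = 0"
    using m z by (auto simp: is_minpoly_def am polys_over_pCons)
  then have "degree m \<le> degree m'" using m by (auto simp: is_minpoly_def)
  then show False using \<open>m' \<noteq> 0\<close> by (simp add: am)
qed

text \<open>With the minimal polynomial of \<open>z\<close> written as a + X m', the inverse of
  \<open>z\<close> is - m'(z) / a, a polynomial in \<open>z\<close> and therefore in
  \<open>x\<close>. This is where algebraicity of every element over \<open>k\<close> is
  used.\<close>

lemma field_set_simple_ext:
  assumes k: "field_set k" and alg: "\<And>z. \<exists>m. is_minpoly k z m"
  shows "field_set (simple_ext k x)" "k \<subseteq> simple_ext k x" "x \<in> simple_ext k x"
proof -
  show "k \<subseteq> simple_ext k x" by (auto intro!: simple_extI[of "[:_:]"] polys_over_const field_set_ring[OF k])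
  then have 1: "1 \<in> simple_ext k x" using field_setD[OF k] by auto
  show "x \<in> simple_ext k x"
    by (rule simple_extI[of "[:0,1:]"]) (auto simp: polys_over_pCons polys_over_0 field_setD[OF k] field_set_ring[OF k])
  have inv: "inverse z \<in> simple_ext k x" if z: "z \<in> simple_ext k x" for z
  proof (cases "z = 0")
    case False
    obtain m where m: "is_minpoly k z m" using alg by blast
    obtain a m' where am: "m = pCons a m'" by (cases m)
    have a: "a \<noteq> 0" using minpoly_coeff_0[OF k m False] by (simp add: am)
    have o: "a \<in> k" "m' \<in> polys_over k" and "a + z * poly m' z = 0"
      using m by (auto simp: is_minpoly_def am polys_over_pCons)
    then have "inverse z = poly (smult (- inverse a) m') z"
      using False a by (simp add: field_simps add_eq_0_iff)
    moreover obtain g where g: "g \<in> polys_over k" "z = poly g x" using z by (auto simp: simple_ext_def)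
    ultimately have "inverse z = poly (pcompose (smult (- inverse a) m') g) x"
      by (simp add: poly_pcompose)
    then show ?thesis using o g
      by (intro simple_extI[of "pcompose (smult (- inverse a) m') g"])
         (auto simp del: smult_minus_left intro!: polys_over_pcompose polys_over_smult field_setD[OF k] field_set_ring[OF k])
  qed (use z in simp)
  show "field_set (simple_ext k x)" unfolding field_set_def
    by (auto simp: 1 inv)
       (auto simp: simple_ext_def simp flip: poly_diff poly_mult
         intro!: imageI polys_over_diff polys_over_mult field_set_ring[OF k])
qed

text \<open>The value at g(x) is put to be (\<tau> g)(s). Two choices of g differ by a multiple of
  \<open>m\<close>, and \<open>s\<close> kills \<tau> m, so the choice is immaterial.\<close>

lemma hom_on_simple_ext:
  fixes \<tau> :: "'a::field \<Rightarrow> 'b::field"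
  assumes k: "field_set k" and hom: "hom_on k \<tau>" and m: "is_minpoly k x m"
    and s: "poly (map_poly \<tau> m) s = 0"
  shows "\<exists>\<tau>'. hom_on (simple_ext k x) \<tau>' \<and> (\<forall>z\<in>k. \<tau>' z = \<tau> z) \<and> \<tau>' x = s"
proof -
  define \<tau>' where "\<tau>' z = poly (map_poly \<tau> (SOME g. g \<in> polys_over k \<and> z = poly g x)) s" for z
  have eq: "\<tau>' (poly g x) = poly (map_poly \<tau> g) s" if g: "g \<in> polys_over k" for g
  proof -
    define h where "h = (SOME h. h \<in> polys_over k \<and> poly g x = poly h x)"
    have h: "h \<in> polys_over k \<and> poly g x = poly h x"
      unfolding h_def by (rule someI[of _ g]) (use g in auto)
    obtain q where q: "q \<in> polys_over k" "h - g = q * m"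
      using minpoly_dvd[OF k m, of "h - g"] h g by (auto intro: polys_over_diff field_set_ring[OF k])
    have "map_poly \<tau> h - map_poly \<tau> g = map_poly \<tau> q * map_poly \<tau> m"
      using map_poly_hom_on[OF k hom] g h q m by (metis is_minpoly_def)
    then have "poly (map_poly \<tau> h) s - poly (map_poly \<tau> g) s = 0"
      using s by (metis mult_zero_right poly_diff poly_mult)
    then show ?thesis by (simp add: \<tau>'_def h_def)
  qed
  have const: "\<tau>' z = \<tau> z" if "z \<in> k" for z
    using eq[of "[:z:]"] that hom_on_simps[OF k hom]
    by (simp add: polys_over_const field_set_ring[OF k] map_poly_pCons)
  have "\<tau>' x = s"
    using eq[of "[:0,1:]"] hom_on_simps[OF k hom]
    by (simp add: polys_over_pCons polys_over_0 field_setD[OF k] field_set_ring[OF k] map_poly_pCons)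
  moreover have "hom_on (simple_ext k x) \<tau>'"
    unfolding hom_on_def
    by (auto simp: const field_setD[OF k] hom_on_simps[OF k hom])
       (auto simp: simple_ext_def eq polys_over_diff polys_over_mult field_set_ring[OF k] map_poly_hom_on[OF k hom]
           simp flip: poly_diff poly_mult)
  ultimately show ?thesis using const by blast
qed

section \<open>Polynomials with simple roots\<close>

lemma poly_pderiv_linear_mult:
  fixes q :: "'a::idom poly"
  shows "poly (pderiv ([:-x, 1:] * q)) y = poly q y + (y - x) * poly (pderiv q) y"
  unfolding pderiv_mult by (simp add: pderiv_pCons algebra_simps)

text \<open>The product runs over the set of roots and so forgets multiplicities. The derivative at
  a root x equals the cofactor q at x, which keeps x out of the roots of q in the induction.\<close>

lemma poly_simple_roots_factorization:
  fixes p :: "'a::alg_closed_field poly"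
  assumes "p \<noteq> 0" "\<And>x. poly p x = 0 \<Longrightarrow> poly (pderiv p) x \<noteq> 0"
  shows "p = smult (lead_coeff p) (\<Prod>x\<in>{x. poly p x = 0}. [:-x, 1:])"
  using assms
proof (induction "degree p" arbitrary: p rule: less_induct)
  case less
  show ?case
  proof (cases "degree p = 0")
    case True
    then show ?thesis using less.prems(1) by (auto elim!: degree_eq_zeroE)
  next
    case False
    then obtain x where x: "poly p x = 0" using alg_closed_imp_poly_has_root by blast
    then obtain q where q: "p = [:-x, 1:] * q" by (metis poly_eq_0_iff_dvd dvdE)
    have q0: "q \<noteq> 0" using less.prems q by auto
    have dp: "poly (pderiv p) y = poly q y + (y - x) * poly (pderiv q) y" for y
      unfolding q by (rule poly_pderiv_linear_mult)
    have qx: "poly q x \<noteq> 0" using less.prems(2)[OF x] by (simp add: dp)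
    have deg: "degree p = Suc (degree q)"
      unfolding q using q0 by (subst degree_mult_eq) auto
    have "poly (pderiv q) y \<noteq> 0" if "poly q y = 0" for y
      using less.prems(2)[of y] that unfolding dp by (auto simp: q)
    then have IH: "q = smult (lead_coeff q) (\<Prod>x\<in>{x. poly q x = 0}. [:-x, 1:])"
      using less.hyps[of q] q0 deg by auto
    have roots: "{y. poly p y = 0} = insert x {y. poly q y = 0}" by (auto simp: q)
    have lc: "lead_coeff p = lead_coeff q"
      unfolding q by (simp only: Polynomial.lead_coeff_mult) simp
    have fin: "finite {y. poly q y = 0}" using q0 by (rule poly_roots_finite)
    have "smult (lead_coeff p) (\<Prod>x\<in>{x. poly p x = 0}. [:-x, 1:]) =
      [:-x, 1:] * smult (lead_coeff q) (\<Prod>x\<in>{x. poly q x = 0}. [:-x, 1:])"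
      unfolding roots lc using qx fin by (subst prod.insert) auto
    also note IH[symmetric]
    also note q[symmetric]
    finally show ?thesis ..
  qed
qed

lemma degree_prod_linear: "finite S \<Longrightarrow> degree (\<Prod>x\<in>S. [:- f x, 1:]) = card S"
  for f :: "'b \<Rightarrow> 'a::idom"
  by (subst degree_prod_eq_sum_degree) auto

lemma card_simple_roots:
  fixes p :: "'a::alg_closed_field poly"
  assumes "p \<noteq> 0" "\<And>x. poly p x = 0 \<Longrightarrow> poly (pderiv p) x \<noteq> 0"
  shows "card {x. poly p x = 0} = degree p"
proof -
  have "degree p = degree (\<Prod>x\<in>{x. poly p x = 0}. [:-x, 1:])"
    by (subst poly_simple_roots_factorization[OF assms]) (use assms in auto)
  then show ?thesis
    using degree_prod_linear[of "{x. poly p x = 0}" "\<lambda>x. x"] poly_roots_finite[OF assms(1)] by simp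
qed

text \<open>\<open>separable_elem\<close> is phrased with \<open>rsquarefree\<close>; the derivative
  criterion is what computations use. It holds in every characteristic: if p = (X - x) q, then p'(x)
  = q(x).\<close>

lemma rsquarefree_iff_simple_roots:
  fixes p :: "'a::field poly"
  shows "rsquarefree p \<longleftrightarrow> p \<noteq> 0 \<and> (\<forall>x. poly p x = 0 \<longrightarrow> poly (pderiv p) x \<noteq> 0)"
proof (intro iffI conjI allI impI)
  fix x assume p: "rsquarefree p" and x: "poly p x = 0"
  then have p0: "p \<noteq> 0" and o: "Polynomial.order x p = 1"
    using rsquarefree_root_order by (auto simp: rsquarefree_def)
  obtain q where q: "p = [:-x, 1:] * q" using x by (metis poly_eq_0_iff_dvd dvdE)
  have "Polynomial.order x p = Polynomial.order x [:-x, 1:] + Polynomial.order x q"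
    using p0 unfolding q by (rule order_mult)
  also have "Polynomial.order x [:-x, 1:] = 1" using order_power_n_n[of x 1] by simp
  finally have "poly q x \<noteq> 0" using o p0 q by (auto simp: order_root)
  then show "poly (pderiv p) x \<noteq> 0" unfolding q poly_pderiv_linear_mult by simp
next
  assume p: "p \<noteq> 0 \<and> (\<forall>x. poly p x = 0 \<longrightarrow> poly (pderiv p) x \<noteq> 0)"
  show "rsquarefree p" unfolding rsquarefree_def
  proof (intro conjI allI)
    fix x show "Polynomial.order x p = 0 \<or> Polynomial.order x p = 1"
    proof (rule ccontr)
      assume "\<not> ?thesis"
      then have "2 \<le> Polynomial.order x p" by linarith
      then have "[:-x, 1:] ^ 2 dvd p" using order_divides p by blast
      then obtain q where q: "p = [:-x, 1:] * ([:-x, 1:] * q)"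
        by (metis power2_eq_square mult.assoc dvdE)
      have "poly (pderiv p) x = 0" unfolding q poly_pderiv_linear_mult by simp
      moreover have "poly p x = 0" unfolding q by simp
      ultimately show False using p by blast
    qed
  qed (use p in simp)
qed (auto simp: rsquarefree_def)

section \<open>Automorphisms and separable elements of an algebraic closure\<close>

definition base_field :: "'f::field alg_closure set \<Rightarrow> bool" where
  "base_field k \<longleftrightarrow> field_set k \<and> range to_ac \<subseteq> k"

lemma base_field_range_to_ac: "base_field (range to_ac)"
  unfolding base_field_def field_set_def
  by (auto simp flip: to_ac_1 to_ac_diff to_ac_mult to_ac_inverse)

lemma polys_over_range_to_ac: "p \<in> polys_over (range to_ac) \<longleftrightarrow> (\<exists>g. p = map_poly to_ac g)"
proof
  assume p: "p \<in> polys_over (range to_ac)"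
  then have "map_poly to_ac (map_poly of_ac p) = p"
    by (intro poly_eqI) (auto simp: coeff_map_poly dest!: polys_overD intro: to_ac_of_ac)
  then show "\<exists>g. p = map_poly to_ac g" by metis
qed (auto simp: polys_over_def coeff_map_poly)

lemma map_poly_to_ac_mem: "base_field k \<Longrightarrow> map_poly to_ac g \<in> polys_over k"
  by (auto simp: polys_over_def coeff_map_poly base_field_def)

lemma minpoly_exists_base:
  assumes "base_field k"
  shows "\<exists>m. is_minpoly k x m"
proof -
  obtain p where p: "p \<noteq> 0" "poly (map_poly to_ac p) x = 0" by (rule alg_closure_algebraic)
  then have "map_poly to_ac p \<noteq> 0" by (simp add: map_poly_eq_0_iff)
  with p assms show ?thesis
    by (intro minpoly_exists[of k "map_poly to_ac p"] map_poly_to_ac_mem) (auto simp: base_field_def)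
qed

section \<open>Extending homomorphisms to the algebraic closure\<close>

definition hom_graph :: "('a::field \<times> 'a) set \<Rightarrow> bool" where
  "hom_graph G \<longleftrightarrow> (1, 1) \<in> G \<and>
     (\<forall>x u y v. (x, u) \<in> G \<longrightarrow> (y, v) \<in> G \<longrightarrow> (x - y, u - v) \<in> G \<and> (x * y, u * v) \<in> G) \<and>
     (\<forall>x u. (x, u) \<in> G \<longrightarrow> (inverse x, inverse u) \<in> G) \<and>
     (\<forall>x u v. (x, u) \<in> G \<longrightarrow> (x, v) \<in> G \<longrightarrow> u = v)"

lemma hom_graphD:
  assumes "hom_graph G"
  shows "(1, 1) \<in> G" "(x, u) \<in> G \<Longrightarrow> (y, v) \<in> G \<Longrightarrow> (x - y, u - v) \<in> G"
    "(x, u) \<in> G \<Longrightarrow> (y, v) \<in> G \<Longrightarrow> (x * y, u * v) \<in> G"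
    "(x, u) \<in> G \<Longrightarrow> (inverse x, inverse u) \<in> G"
    "(x, u) \<in> G \<Longrightarrow> (x, v) \<in> G \<Longrightarrow> u = v"
  using assms unfolding hom_graph_def by blast+

lemma hom_graph_Union:
  assumes C: "subset.chain {G. hom_graph G \<and> G0 \<subseteq> G} C" "C \<noteq> {}"
  shows "hom_graph (\<Union>C) \<and> G0 \<subseteq> \<Union>C"
proof -
  have C1: "hom_graph G" "G0 \<subseteq> G" if "G \<in> C" for G using C that by (auto simp: subset_chain_def)
  have two: "\<exists>G\<in>C. p \<in> G \<and> q \<in> G" if "p \<in> \<Union>C" "q \<in> \<Union>C" for p q
  proof -
    obtain G H where GH: "G \<in> C" "H \<in> C" "p \<in> G" "q \<in> H" using \<open>p \<in> \<Union>C\<close> \<open>q \<in> \<Union>C\<close> by blast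
    then have "G \<subseteq> H \<or> H \<subseteq> G" using C by (simp add: subset_chain_def)
    then show ?thesis using GH by blast
  qed
  obtain G where "G \<in> C" using C(2) by blast
  then have "(1, 1) \<in> \<Union>C" "G0 \<subseteq> \<Union>C" using C1[of G] by (auto simp: hom_graph_def)
  moreover have "(x - y, u - v) \<in> \<Union>C \<and> (x * y, u * v) \<in> \<Union>C"
    if xy: "(x, u) \<in> \<Union>C" "(y, v) \<in> \<Union>C" for x u y v
  proof -
    obtain G where G: "G \<in> C" "(x, u) \<in> G" "(y, v) \<in> G" using two[OF xy] by blast
    then have "(x - y, u - v) \<in> G \<and> (x * y, u * v) \<in> G" using C1(1)[of G] by (simp add: hom_graph_def)
    with G(1) show ?thesis by blast
  qed
  moreover have "(inverse x, inverse u) \<in> \<Union>C" if xu: "(x, u) \<in> \<Union>C" for x u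
  proof -
    obtain G where G: "G \<in> C" "(x, u) \<in> G" using xu by blast
    then have "(inverse x, inverse u) \<in> G" using C1(1)[of G] by (simp add: hom_graph_def)
    with G(1) show ?thesis by blast
  qed
  moreover have "u = v" if xy: "(x, u) \<in> \<Union>C" "(x, v) \<in> \<Union>C" for x u v
  proof -
    obtain G where G: "G \<in> C" "(x, u) \<in> G" "(x, v) \<in> G" using two[OF xy] by blast
    moreover have "\<forall>x u v. (x, u) \<in> G \<longrightarrow> (x, v) \<in> G \<longrightarrow> u = v"
      using C1(1)[OF G(1)] unfolding hom_graph_def by blast
    ultimately show ?thesis by blast
  qed
  ultimately show ?thesis unfolding hom_graph_def by blast
qed

lemma hom_graph_of_hom_on:
  assumes "field_set k" "hom_on k \<tau>"
  shows "hom_graph ((\<lambda>z. (z, \<tau> z)) ` k)"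
  unfolding hom_graph_def
  by (auto simp: image_iff hom_on_simps[OF assms] field_setD[OF assms(1)])

text \<open>Partial homomorphisms are represented by their graphs, so that Zorn's lemma applies to
  inclusion. From a maximal graph with domain \<open>l\<close>, a new x could be sent to a root of
  the image of its minimal polynomial over \<open>l\<close>, since the closure is algebraically
  closed; hence nothing is left outside \<open>l\<close>.\<close>

lemma hom_extends:
  fixes \<tau> :: "'f::field alg_closure \<Rightarrow> 'f alg_closure"
  assumes k: "base_field k" and hom: "hom_on k \<tau>"
  shows "\<exists>\<sigma>. hom_on UNIV \<sigma> \<and> (\<forall>z\<in>k. \<sigma> z = \<tau> z)"
proof -
  define G0 where "G0 = (\<lambda>z. (z, \<tau> z)) ` k"
  have "hom_graph G0" unfolding G0_def using k hom by (intro hom_graph_of_hom_on) (auto simp: base_field_def)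
  then have ne: "{G. hom_graph G \<and> G0 \<subseteq> G} \<noteq> {}" by auto
  have "\<exists>G\<in>{G. hom_graph G \<and> G0 \<subseteq> G}. \<forall>H\<in>{G. hom_graph G \<and> G0 \<subseteq> G}. G \<subseteq> H \<longrightarrow> H = G"
    by (rule subset_Zorn_nonempty[OF ne]) (use hom_graph_Union in auto)
  then obtain G where G: "hom_graph G" "G0 \<subseteq> G"
    and max: "\<And>H. hom_graph H \<Longrightarrow> G0 \<subseteq> H \<Longrightarrow> G \<subseteq> H \<Longrightarrow> H = G"
    by auto
  note GD = hom_graphD[OF G(1)]
  define l where "l = Domain G"
  define \<sigma> where "\<sigma> x = (THE u. (x, u) \<in> G)" for x
  have \<sigma>_eq: "\<sigma> x = u" if "(x, u) \<in> G" for x u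
    unfolding \<sigma>_def using that GD(5) by (intro the_equality) auto
  have \<sigma>: "(x, \<sigma> x) \<in> G" if "x \<in> l" for x
    using that \<sigma>_eq by (auto simp: l_def)
  have G_eq: "G = (\<lambda>z. (z, \<sigma> z)) ` l"
  proof (intro equalityI subsetI)
    fix p assume "p \<in> G"
    then show "p \<in> (\<lambda>z. (z, \<sigma> z)) ` l" using \<sigma>_eq by (cases p) (auto simp: l_def image_iff)
  qed (use \<sigma> in auto)
  have l: "field_set l" unfolding field_set_def l_def
  proof (intro conjI ballI)
    show "1 \<in> Domain G" using GD(1) by blast
    fix x assume "x \<in> Domain G"
    then obtain u where u: "(x, u) \<in> G" by blast
    then show "inverse x \<in> Domain G" using GD(4) by blast
    fix y assume "y \<in> Domain G"
    then obtain v where "(y, v) \<in> G" by blast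
    with u show "x - y \<in> Domain G" "x * y \<in> Domain G" using GD(2,3) by blast+
  qed
  have "k \<subseteq> l" using G(2) by (auto simp: l_def G0_def)
  then have bl: "base_field l" using k l by (auto simp: base_field_def)
  have hom_l: "hom_on l \<sigma>" unfolding hom_on_def
    using GD \<sigma> by (intro conjI ballI \<sigma>_eq) auto
  have "x \<in> l" for x
  proof -
    obtain m where m: "is_minpoly l x m" using minpoly_exists_base[OF bl] by blast
    have "degree (map_poly \<sigma> m) > 0"
      using m minpoly_degree_pos[OF m] degree_map_poly_hom_on[OF l hom_l] by (simp add: is_minpoly_def)
    then obtain s where "poly (map_poly \<sigma> m) s = 0" using alg_closed_imp_poly_has_root by blast
    from hom_on_simple_ext[OF l hom_l m this] obtain \<tau>' where
      t: "hom_on (simple_ext l x) \<tau>'" "\<forall>z\<in>l. \<tau>' z = \<sigma> z" by blast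
    note se = field_set_simple_ext[OF l minpoly_exists_base[OF bl], of x]
    define H where "H = (\<lambda>z. (z, \<tau>' z)) ` simple_ext l x"
    have "hom_graph H" unfolding H_def by (intro hom_graph_of_hom_on se t)
    moreover have "G \<subseteq> H" unfolding G_eq H_def using t(2) se(2) by (auto simp: image_iff)
    ultimately have "H = G" using max G(2) by blast
    then show ?thesis using se(3) by (auto simp: H_def l_def)
  qed
  then have "l = UNIV" by auto
  moreover have "\<forall>z\<in>k. \<sigma> z = \<tau> z" using G(2) \<sigma>_eq by (auto simp: G0_def)
  ultimately show ?thesis using hom_l by blast
qed

section \<open>Automorphisms over the base field\<close>

definition ac_auts :: "('f::field alg_closure \<Rightarrow> 'f alg_closure) set" where
  "ac_auts = {\<sigma>. hom_on UNIV \<sigma> \<and> (\<forall>a. \<sigma> (to_ac a) = to_ac a)}"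

lemma field_set_UNIV: "field_set UNIV" by (auto simp: field_set_def)

lemma ac_auts_hom:
  assumes "\<sigma> \<in> ac_auts"
  shows "\<sigma> 0 = 0" "\<sigma> 1 = 1" "\<sigma> (x + y) = \<sigma> x + \<sigma> y" "\<sigma> (x - y) = \<sigma> x - \<sigma> y"
    "\<sigma> (x * y) = \<sigma> x * \<sigma> y" "\<sigma> (- x) = - \<sigma> x" "\<sigma> (inverse x) = inverse (\<sigma> x)"
    "\<sigma> (x / y) = \<sigma> x / \<sigma> y" "\<sigma> (x ^ n) = \<sigma> x ^ n" "\<sigma> (to_ac a) = to_ac a"
    "\<sigma> x = 0 \<longleftrightarrow> x = 0" "\<sigma> x = \<sigma> y \<longleftrightarrow> x = y"
proof -
  have h: "hom_on UNIV \<sigma>" using assms by (simp add: ac_auts_def)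
  note H = hom_on_simps[OF field_set_UNIV h]
  show "\<sigma> 0 = 0" "\<sigma> 1 = 1" "\<sigma> (x + y) = \<sigma> x + \<sigma> y" "\<sigma> (x - y) = \<sigma> x - \<sigma> y"
    "\<sigma> (x * y) = \<sigma> x * \<sigma> y" "\<sigma> (- x) = - \<sigma> x" "\<sigma> (inverse x) = inverse (\<sigma> x)"
    "\<sigma> (x ^ n) = \<sigma> x ^ n" "\<sigma> x = 0 \<longleftrightarrow> x = 0" using H by auto
  show "\<sigma> (x / y) = \<sigma> x / \<sigma> y" using H by (simp add: divide_inverse)
  show "\<sigma> (to_ac a) = to_ac a" using assms by (simp add: ac_auts_def)
  show "\<sigma> x = \<sigma> y \<longleftrightarrow> x = y" using H(3)[of x y] H(8)[of "x - y"] by auto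
qed

lemma ac_auts_sum: "\<sigma> \<in> ac_auts \<Longrightarrow> \<sigma> (sum f S) = (\<Sum>i\<in>S. \<sigma> (f i))"
  by (induction S rule: infinite_finite_induct) (auto simp: ac_auts_hom)

lemma ac_auts_prod: "\<sigma> \<in> ac_auts \<Longrightarrow> \<sigma> (prod f S) = (\<Prod>i\<in>S. \<sigma> (f i))"
  by (induction S rule: infinite_finite_induct) (auto simp: ac_auts_hom)

lemma ac_auts_id: "id \<in> ac_auts" "(\<lambda>x. x) \<in> ac_auts"
  by (auto simp: ac_auts_def hom_on_def)

lemma ac_auts_comp: "\<sigma> \<in> ac_auts \<Longrightarrow> \<tau> \<in> ac_auts \<Longrightarrow> (\<lambda>x. \<sigma> (\<tau> x)) \<in> ac_auts"
  by (auto simp: ac_auts_def hom_on_def)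

lemma ac_auts_poly: "\<sigma> \<in> ac_auts \<Longrightarrow> \<sigma> (poly p x) = poly (map_poly \<sigma> p) (\<sigma> x)"
  using poly_map_poly_hom_on[OF field_set_UNIV, of \<sigma> p x] by (auto simp: ac_auts_def polys_over_def)

lemma map_poly_ac_auts_over:
  assumes "\<sigma> \<in> ac_auts" "p \<in> polys_over k" "\<And>z. z \<in> k \<Longrightarrow> \<sigma> z = z"
  shows "map_poly \<sigma> p = p"
  using assms by (intro poly_eqI) (auto simp: coeff_map_poly ac_auts_hom polys_overD)

lemma ac_auts_root:
  assumes "\<sigma> \<in> ac_auts" "p \<in> polys_over k" "\<And>z. z \<in> k \<Longrightarrow> \<sigma> z = z"
  shows "poly p (\<sigma> x) = \<sigma> (poly p x)"
  using ac_auts_poly[OF assms(1), of p x] map_poly_ac_auts_over[OF assms] by simp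

lemma ac_auts_root_base: "\<sigma> \<in> ac_auts \<Longrightarrow> poly (map_poly to_ac g) (\<sigma> x) = \<sigma> (poly (map_poly to_ac g) x)"
  by (rule ac_auts_root[of _ _ "range to_ac"]) (auto simp: polys_over_range_to_ac ac_auts_hom)

lemma ac_orbit_finite: "finite ((\<lambda>\<sigma>. \<sigma> x) ` ac_auts)"
proof -
  obtain p where p: "p \<noteq> 0" "poly (map_poly to_ac p) x = 0" by (rule alg_closure_algebraic)
  then have "finite {y. poly (map_poly to_ac p) y = 0}"
    by (intro poly_roots_finite) (simp add: map_poly_eq_0_iff)
  then show ?thesis by (rule finite_subset[rotated]) (auto simp: ac_auts_root_base p ac_auts_hom)
qed

lemma ac_auts_inj: "\<sigma> \<in> ac_auts \<Longrightarrow> inj \<sigma>" by (auto simp: inj_def ac_auts_hom)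

text \<open>\<open>ac_auts\<close> demands no surjectivity. It comes from finiteness: an injective
  map of the finite orbit of y into itself is onto, and y lies in that orbit.\<close>

lemma ac_auts_surj:
  assumes s: "\<sigma> \<in> ac_auts" shows "surj \<sigma>"
proof -
  have "y \<in> range \<sigma>" for y
  proof -
    let ?Orb = "(\<lambda>\<sigma>. \<sigma> y) ` ac_auts"
    have "\<sigma> ` ?Orb \<subseteq> ?Orb" using ac_auts_comp[OF s] by (force simp: image_iff)
    then have "\<sigma> ` ?Orb = ?Orb"
      using ac_orbit_finite ac_auts_inj[OF s] by (metis endo_inj_surj inj_on_subset subset_UNIV)
    moreover have "y \<in> ?Orb" using ac_auts_id by force
    ultimately show ?thesis by blast
  qed
  then show ?thesis by auto
qed

lemma ac_auts_inv:
  assumes s: "\<sigma> \<in> ac_auts"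
  shows "inv_into UNIV \<sigma> \<in> ac_auts" "\<sigma> (inv_into UNIV \<sigma> x) = x" "inv_into UNIV \<sigma> (\<sigma> x) = x"
proof -
  show 1: "\<sigma> (inv_into UNIV \<sigma> x) = x" for x using ac_auts_surj[OF s] by (simp add: surj_f_inv_f)
  show 2: "inv_into UNIV \<sigma> (\<sigma> x) = x" for x using ac_auts_inj[OF s] by simp
  have "inv_into UNIV \<sigma> (x - y) = inv_into UNIV \<sigma> x - inv_into UNIV \<sigma> y" "inv_into UNIV \<sigma> (x * y) = inv_into UNIV \<sigma> x * inv_into UNIV \<sigma> y" for x y
    by (metis 1 2 ac_auts_hom(4)[OF s], metis 1 2 ac_auts_hom(5)[OF s])
  moreover have "inv_into UNIV \<sigma> 1 = 1" "inv_into UNIV \<sigma> (to_ac a) = to_ac a" for a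
    by (metis 2 ac_auts_hom(2)[OF s], metis 2 ac_auts_hom(10)[OF s])
  ultimately show "inv_into UNIV \<sigma> \<in> ac_auts" by (auto simp: ac_auts_def hom_on_def)
qed

lemma ac_auts_conj:
  assumes k: "base_field k" and m: "is_minpoly k x m" and s: "poly m s = 0"
  shows "\<exists>\<sigma>\<in>ac_auts. (\<forall>z\<in>k. \<sigma> z = z) \<and> \<sigma> x = s"
proof -
  have k': "field_set k" and r: "range to_ac \<subseteq> k" using k by (auto simp: base_field_def)
  have id: "hom_on k (\<lambda>z. z)" by (auto simp: hom_on_def)
  have "poly (map_poly (\<lambda>z. z) m) s = 0" using s by (simp add: map_poly_idI)
  from hom_on_simple_ext[OF k' id m this] obtain \<tau> where
    t: "hom_on (simple_ext k x) \<tau>" "\<forall>z\<in>k. \<tau> z = z" "\<tau> x = s" by blast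
  note se = field_set_simple_ext[OF k' minpoly_exists_base[OF k], of x]
  have "base_field (simple_ext k x)" using se r by (auto simp: base_field_def)
  from hom_extends[OF this t(1)] obtain \<sigma> where
    \<sigma>: "hom_on UNIV \<sigma>" "\<forall>z\<in>simple_ext k x. \<sigma> z = \<tau> z" by blast
  then have "\<forall>z\<in>k. \<sigma> z = z" "\<sigma> x = s" using se t by auto
  with \<sigma> r show ?thesis by (intro bexI[of _ \<sigma>]) (auto simp: ac_auts_def)
qed

text \<open>Write c = r(x) with deg r < deg m. Each root s of m is a conjugate of x over
  \<open>k\<close>, so r(s) = c. Separability makes these deg m distinct roots of r - c; hence r is
  the constant c, and its coefficients lie in \<open>k\<close>.\<close>

lemma fixed_in_simple_ext:
  assumes k: "base_field k" and g: "g \<in> polys_over k" "poly g x = 0" "poly (pderiv g) x \<noteq> 0"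
    and c: "c \<in> simple_ext k x" and fixed: "\<And>\<sigma>. \<sigma> \<in> ac_auts \<Longrightarrow> (\<forall>z\<in>k. \<sigma> z = z) \<Longrightarrow> \<sigma> c = c"
  shows "c \<in> k"
proof -
  have k': "field_set k" using k by (auto simp: base_field_def)
  obtain m where m: "is_minpoly k x m" using minpoly_exists_base[OF k] by blast
  have mk: "m \<in> polys_over k" "m \<noteq> 0" "poly m x = 0" using m by (auto simp: is_minpoly_def)
  obtain h where h: "h \<in> polys_over k" "c = poly h x" using c by (auto simp: simple_ext_def)
  obtain q r where qr: "r \<in> polys_over k" "h = q * m + r" "degree r < degree m"
    using polys_over_division[OF field_set_ring[OF k'], of m h] m h minpoly_degree_pos[OF m] by (auto simp: is_minpoly_def)
  have rx: "poly r x = c" using h qr mk by simp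
  have "poly (pderiv m) x \<noteq> 0"
  proof
    assume "poly (pderiv m) x = 0"
    moreover obtain q where "g = q * m" using minpoly_dvd[OF k' m g(1,2)] by blast
    ultimately show False using g(3) mk by (simp add: pderiv_mult)
  qed
  then have simple: "poly (pderiv m) s \<noteq> 0" and rs: "poly r s = c" if s: "poly m s = 0" for s
  proof -
    obtain \<sigma> where \<sigma>: "\<sigma> \<in> ac_auts" "\<forall>z\<in>k. \<sigma> z = z" "\<sigma> x = s"
      using ac_auts_conj[OF k m s] by blast
    have "poly p s = \<sigma> (poly p x)" if "p \<in> polys_over k" for p
      using ac_auts_root[OF \<sigma>(1) that] \<sigma> by auto
    from this[OF polys_over_pderiv[OF field_set_ring[OF k'] mk(1)]] this[OF qr(1)] rx \<sigma> fixed[OF \<sigma>(1,2)]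
    show "poly (pderiv m) s \<noteq> 0" "poly r s = c"
      using \<open>poly (pderiv m) x \<noteq> 0\<close> by (auto simp: ac_auts_hom)
  qed
  have "r - [:c:] = 0"
  proof (rule ccontr)
    assume n: "r - [:c:] \<noteq> 0"
    have "degree m = card {s. poly m s = 0}" using card_simple_roots[OF mk(2) simple] by simp
    also have "\<dots> \<le> card {s. poly (r - [:c:]) s = 0}"
      using n by (intro card_mono poly_roots_finite) (auto simp: rs)
    also have "\<dots> \<le> degree (r - [:c:])" using n by (rule card_poly_roots_bound)
    also have "\<dots> \<le> degree r" by (rule degree_diff_le) auto
    finally show False using qr(3) by simp
  qed
  then have "coeff r 0 = c" by simp
  then show "c \<in> k" using polys_overD[OF qr(1), of 0] by simp
qed

section \<open>Separable elements and descent to the base field\<close>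

lemma separable_elemD:
  assumes "separable_elem x"
  shows "\<exists>g. poly (map_poly to_ac g) x = 0 \<and> poly (pderiv (map_poly to_ac g)) x \<noteq> 0"
  using assms by (auto simp: separable_elem_def rsquarefree_iff_simple_roots)

text \<open>Descent is claimed only inside a field \<open>k\<close> obtained by adjoining separable
  elements one at a time, because fixed elements of the whole closure may be purely inseparable over
  the base.\<close>

lemma sep_tower:
  assumes "finite L" "\<And>x. x \<in> L \<Longrightarrow> separable_elem x"
  shows "\<exists>k. base_field k \<and> L \<subseteq> k \<and> (\<forall>c\<in>k. (\<forall>\<sigma>\<in>ac_auts. \<sigma> c = c) \<longrightarrow> c \<in> range to_ac)"
  using assms
proof (induction L rule: finite_induct)
  case empty
  then show ?case using base_field_range_to_ac by auto
next
  case (insert x L)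
  then obtain k where k: "base_field k" "L \<subseteq> k"
    "\<And>c. c \<in> k \<Longrightarrow> (\<forall>\<sigma>\<in>ac_auts. \<sigma> c = c) \<Longrightarrow> c \<in> range to_ac" by blast
  obtain g where g: "poly (map_poly to_ac g) x = 0" "poly (pderiv (map_poly to_ac g)) x \<noteq> 0"
    using separable_elemD insert.prems by blast
  have k': "field_set k" using k by (auto simp: base_field_def)
  note se = field_set_simple_ext[OF k' minpoly_exists_base[OF k(1)], of x]
  show ?case
  proof (intro exI[of _ "simple_ext k x"] conjI ballI impI)
    show "base_field (simple_ext k x)" using k se by (auto simp: base_field_def)
    show "insert x L \<subseteq> simple_ext k x" using k se by auto
    fix c assume c: "c \<in> simple_ext k x" "\<forall>\<sigma>\<in>ac_auts. \<sigma> c = c"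
    then have "c \<in> k"
      using fixed_in_simple_ext[OF k(1) map_poly_to_ac_mem[OF k(1)] g] by blast
    then show "c \<in> range to_ac" using k(3) c by blast
  qed
qed

lemma separable_elem_fixed:
  assumes "separable_elem x" "\<And>\<sigma>. \<sigma> \<in> ac_auts \<Longrightarrow> \<sigma> x = x"
  shows "x \<in> range to_ac"
  using sep_tower[of "{x}"] assms by auto

text \<open>\<open>separable_elem\<close> asks for an irreducible witness. The minimal polynomial of
  x divides the image of g, so a multiple root of it would be a multiple root there too.\<close>

lemma separable_elemI:
  assumes g: "poly (map_poly to_ac g) x = 0" "rsquarefree (map_poly to_ac g)"
  shows "separable_elem x"
proof -
  note b = base_field_range_to_ac
  have b': "field_set (range to_ac)" using b by (auto simp: base_field_def)
  obtain m where m: "is_minpoly (range to_ac) x m" using minpoly_exists_base[OF b] by blast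
  have mk: "m \<in> polys_over (range to_ac)" "m \<noteq> 0" "poly m x = 0" using m by (auto simp: is_minpoly_def)
  then obtain p where p: "m = map_poly to_ac p" by (auto simp: polys_over_range_to_ac)
  have mult: "map_poly to_ac (a * b) = map_poly to_ac a * map_poly to_ac b" for a b :: "'a poly"
    by (intro poly_eqI) (simp add: coeff_map_poly coeff_mult to_ac_sum)
  have deg: "degree (map_poly to_ac a) = degree a" for a :: "'a poly"
    by (rule degree_map_poly) auto
  obtain q where q: "map_poly to_ac g = q * m"
    using minpoly_dvd[OF b' m _ g(1)] by (auto simp: polys_over_range_to_ac)
  have "rsquarefree m" using g(2) unfolding rsquarefree_iff_simple_roots q
    by (auto simp: pderiv_mult)
  moreover have "irreducible p"
  proof (rule Factorial_Ring.irreducibleI)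
    show "p \<noteq> 0" using mk p by auto
    show "\<not> p dvd 1" using minpoly_degree_pos[OF m] unfolding p deg by (auto simp: is_unit_iff_degree \<open>p \<noteq> 0\<close>)
    fix a b assume ab: "p = a * b"
    then have ab0: "a \<noteq> 0" "b \<noteq> 0" using \<open>p \<noteq> 0\<close> by auto
    then have dp: "degree p = degree a + degree b" unfolding ab by (rule degree_mult_eq)
    have *: "degree p \<le> degree c" if "c \<noteq> 0" "poly (map_poly to_ac c) x = 0" for c
    proof -
      have "map_poly to_ac c \<in> polys_over (range to_ac)" "map_poly to_ac c \<noteq> 0"
        using that by (auto simp: polys_over_range_to_ac map_poly_eq_0_iff)
      then show ?thesis using m that unfolding is_minpoly_def p deg by (metis deg)
    qed
    have "poly (map_poly to_ac a) x = 0 \<or> poly (map_poly to_ac b) x = 0"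
      using mk(3) unfolding p ab mult by simp
    then show "a dvd 1 \<or> b dvd 1"
      using *[OF ab0(1)] *[OF ab0(2)] dp ab0 by (auto simp: is_unit_iff_degree)
  qed
  ultimately show ?thesis using mk(3) p by (auto simp: separable_elem_def)
qed

lemma prod_linear_ac_auts:
  assumes "\<sigma> \<in> ac_auts"
  shows "map_poly \<sigma> (\<Prod>i\<in>S. [:- f i, 1:]) = (\<Prod>i\<in>S. [:- \<sigma> (f i), 1:])"
proof -
  have h: "hom_on UNIV \<sigma>" using assms by (simp add: ac_auts_def)
  have *: "map_poly \<sigma> (p * q) = map_poly \<sigma> p * map_poly \<sigma> q" for p q
    by (rule map_poly_hom_on[OF field_set_UNIV h]) (auto simp: polys_over_def)
  show ?thesis
    by (induction S rule: infinite_finite_induct)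
       (simp_all only: prod.infinite prod.empty prod.insert * not_False_eq_True,
        simp_all only: map_poly_pCons map_poly_1' ac_auts_hom[OF assms] map_poly_0 simp_thms)
qed

text \<open>The orbit polynomial of z has distinct roots by construction; its coefficients are
  invariant and lie in the tower field, hence in the base. Quantifying over all \<open>k\<close>
  that contain \<open>L\<close> lets one hypothesis cover sums, products and inverses alike.\<close>

lemma separable_elem_in_tower:
  assumes L: "finite L" "\<And>x. x \<in> L \<Longrightarrow> separable_elem x"
    and z: "\<And>\<sigma> k. \<sigma> \<in> ac_auts \<Longrightarrow> base_field k \<Longrightarrow> L \<subseteq> k \<Longrightarrow> \<sigma> z \<in> k"
  shows "separable_elem z"
proof -
  obtain k where k: "base_field k" "L \<subseteq> k"
    "\<And>c. c \<in> k \<Longrightarrow> (\<forall>\<sigma>\<in>ac_auts. \<sigma> c = c) \<Longrightarrow> c \<in> range to_ac" using sep_tower[OF L] by blast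
  have k': "field_set k" using k by (auto simp: base_field_def)
  define Orb where "Orb = (\<lambda>\<sigma>. \<sigma> z) ` ac_auts"
  define f where "f = (\<Prod>y\<in>Orb. [:- y, 1:])"
  have fin: "finite Orb" unfolding Orb_def by (rule ac_orbit_finite)
  have "z \<in> Orb" unfolding Orb_def using ac_auts_id by force
  have fk: "f \<in> polys_over k" unfolding f_def
    by (intro polys_over_prod polys_over_linear field_set_ring k') (auto simp: Orb_def z k)
  have fixd: "map_poly \<sigma> f = f" if s: "\<sigma> \<in> ac_auts" for \<sigma>
  proof -
    have "\<sigma> ` Orb \<subseteq> Orb" using ac_auts_comp[OF s] by (force simp: Orb_def image_iff)
    then have b: "bij_betw \<sigma> Orb Orb"
      using fin ac_auts_inj[OF s] by (metis bij_betw_def endo_inj_surj inj_on_subset subset_UNIV)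
    show ?thesis unfolding f_def prod_linear_ac_auts[OF s] by (rule prod.reindex_bij_betw[OF b])
  qed
  have "f \<in> polys_over (range to_ac)"
  proof (rule polys_overI)
    fix i
    have "\<sigma> (coeff f i) = coeff f i" if "\<sigma> \<in> ac_auts" for \<sigma>
      using fixd[OF that] by (metis ac_auts_hom(1) coeff_map_poly that)
    then show "coeff f i \<in> range to_ac" using k(3) polys_overD[OF fk] by blast
  qed
  then obtain g where g: "f = map_poly to_ac g" by (auto simp: polys_over_range_to_ac)
  have root: "poly f y = 0 \<longleftrightarrow> y \<in> Orb" for y using fin by (auto simp: f_def poly_prod)
  have "poly (pderiv f) y \<noteq> 0" if "y \<in> Orb" for y
  proof -
    have "f = [:- y, 1:] * (\<Prod>y\<in>Orb - {y}. [:- y, 1:])"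
      unfolding f_def using fin that by (rule prod.remove)
    then have "poly (pderiv f) y = poly (\<Prod>y\<in>Orb - {y}. [:- y, 1:]) y"
      by (metis add.right_neutral diff_self mult_zero_left poly_pderiv_linear_mult)
    then show ?thesis using fin by (auto simp: poly_prod)
  qed
  moreover have "f \<noteq> 0" using fin by (simp add: f_def)
  ultimately have "rsquarefree f" by (auto simp: rsquarefree_iff_simple_roots root)
  then show ?thesis using separable_elemI root \<open>z \<in> Orb\<close> g by blast
qed

lemma separable_elem_ac_auts: "separable_elem x \<Longrightarrow> \<sigma> \<in> ac_auts \<Longrightarrow> separable_elem (\<sigma> x)"
  unfolding separable_elem_def by (auto simp: ac_auts_root_base ac_auts_hom)

lemma separable_elem_to_ac: "separable_elem (to_ac a)"
  by (rule separable_elem_in_tower[of "{}"]) (auto simp: ac_auts_hom base_field_def)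

lemma separable_elem_ops:
  assumes "separable_elem x" "separable_elem y"
  shows "separable_elem (x + y)" "separable_elem (x - y)" "separable_elem (x * y)" "separable_elem (inverse x)"
proof -
  \<comment> \<open>All conjugates are included, so that the conjugates of the sum, the product and
    the inverse lie in every subfield containing \<open>?L\<close>.\<close>
  let ?L = "(\<lambda>\<sigma>. \<sigma> x) ` ac_auts \<union> (\<lambda>\<sigma>. \<sigma> y) ` ac_auts"
  have L: "finite ?L" "\<And>z. z \<in> ?L \<Longrightarrow> separable_elem z"
    using assms by (auto simp: ac_orbit_finite separable_elem_ac_auts)
  show "separable_elem (x + y)" "separable_elem (x - y)" "separable_elem (x * y)" "separable_elem (inverse x)"
    by (rule separable_elem_in_tower[OF L], assumption,
        auto simp: ac_auts_hom base_field_def intro!: field_setD)+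
qed

lemma field_set_separable: "field_set {x. separable_elem x}"
  using separable_elem_to_ac[of 1] by (auto simp: field_set_def separable_elem_ops)

text \<open>Automorphisms of the closure enter the Galois group of the statement by restriction;
  that separable elements are mapped onto the separable elements is seen by applying the
  inverse.\<close>

lemma ac_auts_restrict_abs_galois:
  assumes s: "\<sigma> \<in> ac_auts"
  shows "restrict \<sigma> (carrier sep_closure) \<in> abs_galois"
proof -
  have c: "carrier sep_closure = {x. separable_elem x}"
    by (simp add: sep_closure_def)
  have "\<sigma> ` {x. separable_elem x} = {x. separable_elem x}"
  proof (intro equalityI subsetI)
    fix x :: "'a alg_closure" assume "x \<in> {x. separable_elem x}"
    then show "x \<in> \<sigma> ` {x. separable_elem x}"
      using ac_auts_inv[OF s] separable_elem_ac_auts by (intro image_eqI[of _ _ "inv_into UNIV \<sigma> x"]) auto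
  qed (auto simp: separable_elem_ac_auts s)
  then have "bij_betw (restrict \<sigma> {x. separable_elem x}) {x. separable_elem x} {x. separable_elem x}"
    using ac_auts_inj[OF s] by (auto simp: bij_betw_def inj_on_def inj_def)
  then show ?thesis
    unfolding abs_galois_def
    by (auto simp: c ring_iso_def ring_hom_def)
       (auto simp: sep_closure_def ring_of_type_algebra_def separable_elem_ops separable_elem_ac_auts s
           ac_auts_hom[OF s] separable_elem_to_ac separable_elem_to_ac[of 1, simplified])
qed

section \<open>Inertia\<close>

locale nonarch =
  fixes w :: "'a::field \<Rightarrow> real"
  assumes w_eq_0: "w x = 0 \<longleftrightarrow> x = 0"
    and w_nonneg: "w x \<ge> 0"
    and w_mult: "w (x * y) = w x * w y"
    and w_add: "w (x + y) \<le> max (w x) (w y)"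
begin

lemma w_0: "w 0 = 0" by (simp add: w_eq_0)

lemma w_1: "w 1 = 1"
  using w_mult[of 1 1] w_eq_0[of 1] by simp

lemma w_power: "w (x ^ n) = w x ^ n"
  by (induction n) (auto simp: w_1 w_mult)

lemma w_uminus: "w (- x) = w x"
proof -
  have "w (-1) * w (-1) = 1" by (simp add: w_1 flip: w_mult)
  then have "w (-1) = 1" using w_nonneg[of "-1"] by (simp add: square_eq_1_iff)
  then show ?thesis using w_mult[of "-1" x] by simp
qed

lemma w_diff: "w (x - y) \<le> max (w x) (w y)"
  using w_add[of x "- y"] by (simp add: w_uminus)

lemma w_diff_commute: "w (x - y) = w (y - x)"
  using w_uminus[of "x - y"] by simp

lemma w_inverse: "w (inverse x) = inverse (w x)"
proof (cases "x = 0")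
  case False
  then have "w x * w (inverse x) = 1" by (simp add: w_1 flip: w_mult)
  then show ?thesis by (simp add: inverse_unique)
qed (simp add: w_0)

lemma w_divide: "w (x / y) = w x / w y"
  by (simp add: divide_inverse w_mult w_inverse)

lemma w_pos: "x \<noteq> 0 \<Longrightarrow> w x > 0"
  using w_nonneg[of x] w_eq_0[of x] by linarith

lemma w_prod: "w (prod f S) = (\<Prod>i\<in>S. w (f i))"
  by (induction S rule: infinite_finite_induct) (auto simp: w_1 w_mult)

lemma w_add_eq: "w y < w x \<Longrightarrow> w (x + y) = w x"
  using w_add[of x y] w_diff[of "x + y" y] by (simp add: max_def split: if_splits)

lemma w_close: "w (x - y) < w x \<Longrightarrow> w y = w x"
  using w_add_eq[of "y - x" x] by (simp add: w_diff_commute)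

lemma w_sum_le: "0 \<le> B \<Longrightarrow> (\<And>i. i \<in> S \<Longrightarrow> w (f i) \<le> B) \<Longrightarrow> w (sum f S) \<le> B"
  by (induction S rule: infinite_finite_induct) (auto simp: w_0 intro: order_trans[OF w_add])

lemma w_sum_less: "0 < B \<Longrightarrow> (\<And>i. i \<in> S \<Longrightarrow> w (f i) < B) \<Longrightarrow> w (sum f S) < B"
  by (induction S rule: infinite_finite_induct) (auto simp: w_0 intro: le_less_trans[OF w_add])

lemma w_diff_less: "w x < B \<Longrightarrow> w y < B \<Longrightarrow> w (x - y) < B"
  using w_diff[of x y] by (simp add: max_def split: if_splits)

lemma w_add_less: "w x < B \<Longrightarrow> w y < B \<Longrightarrow> w (x + y) < B"
  using w_add[of x y] by (simp add: max_def split: if_splits)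

lemma w_mult_less: "w x \<le> 1 \<Longrightarrow> w y < B \<Longrightarrow> w (x * y) < B"
  using mult_right_mono[of "w x" 1 "w y"] w_nonneg[of y] by (auto simp: w_mult)

lemma w_prod_near_1:
  "(\<And>i. i \<in> S \<Longrightarrow> w (f i - 1) < 1) \<Longrightarrow> w (prod f S - 1) < 1"
proof (induction S rule: infinite_finite_induct)
  case (insert i S)
  have "w (prod f S - 1) < 1" using insert by auto
  moreover have "w (f i) = 1" using w_close[of 1 "f i"] insert.prems[of i] by (simp add: w_1 w_diff_commute)
  ultimately have "w (f i * (prod f S - 1)) < 1" by (simp add: w_mult)
  then have "w (f i * (prod f S - 1) + (f i - 1)) < 1" using insert.prems[of i] by (intro w_add_less) auto
  then show ?case using insert by (simp add: algebra_simps)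
qed (auto simp: w_0)

text \<open>Artin's independence of characters, modulo the elements with w < 1. Subtracting \<psi>
  s0 times a relation from the same relation at s0 * s removes \<psi> and multiplies the coefficient
  of \<xi> by \<xi> s0 - \<psi> s0. For a suitable s0 this factor has w at least 1, so smallness of
  the product is smallness of the coefficient.\<close>

lemma artin_independence_mod:
  assumes "finite S" "1 \<in> P" "\<And>s t. s \<in> P \<Longrightarrow> t \<in> P \<Longrightarrow> s * t \<in> P"
    and "\<And>\<xi>. \<xi> \<in> S \<Longrightarrow> \<xi> 1 = 1"
    and "\<And>\<xi> s t. \<xi> \<in> S \<Longrightarrow> s \<in> P \<Longrightarrow> t \<in> P \<Longrightarrow> \<xi> (s * t) = \<xi> s * \<xi> t"
    and "\<And>\<xi> s. \<xi> \<in> S \<Longrightarrow> s \<in> P \<Longrightarrow> w (\<xi> s) \<le> 1"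
    and "\<And>\<xi> \<psi>. \<xi> \<in> S \<Longrightarrow> \<psi> \<in> S \<Longrightarrow> \<xi> \<noteq> \<psi> \<Longrightarrow> \<exists>s\<in>P. w (\<xi> s - \<psi> s) \<ge> 1"
    and "\<And>s. s \<in> P \<Longrightarrow> w (\<Sum>\<xi>\<in>S. c \<xi> * \<xi> s) < 1"
    and "\<xi> \<in> S"
  shows "w (c \<xi>) < 1"
  using assms(1,4-)
proof (induction S arbitrary: c \<xi> rule: finite_induct)
  case (insert \<psi> S)
  have S: "w (c \<xi>) < 1" if \<xi>: "\<xi> \<in> S" for \<xi>
  proof -
    obtain s0 where s0: "s0 \<in> P" "w (\<xi> s0 - \<psi> s0) \<ge> 1"
      using insert.prems(4)[of \<xi> \<psi>] \<xi> insert.hyps by auto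
    have "w (c \<xi> * (\<xi> s0 - \<psi> s0)) < 1"
    proof (rule insert.IH[OF _ _ _ _ _ \<xi>])
      fix s assume s: "s \<in> P"
      have "w ((\<Sum>\<xi>\<in>insert \<psi> S. c \<xi> * \<xi> (s0 * s)) - \<psi> s0 * (\<Sum>\<xi>\<in>insert \<psi> S. c \<xi> * \<xi> s)) < 1"
        using s s0 assms(3) by (intro w_diff_less w_mult_less insert.prems(3,5)) auto
      also have "(\<Sum>\<xi>\<in>insert \<psi> S. c \<xi> * \<xi> (s0 * s)) - \<psi> s0 * (\<Sum>\<xi>\<in>insert \<psi> S. c \<xi> * \<xi> s) =
          (\<Sum>\<xi>\<in>insert \<psi> S. c \<xi> * (\<xi> s0 - \<psi> s0) * \<xi> s)"
        unfolding sum_distrib_left sum_subtractf[symmetric]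
        using insert.prems(2)[OF _ s0(1) s] by (intro sum.cong) (auto simp: algebra_simps)
      also have "\<dots> = (\<Sum>\<xi>\<in>S. c \<xi> * (\<xi> s0 - \<psi> s0) * \<xi> s)" using insert.hyps by simp
      finally show "w (\<Sum>\<xi>\<in>S. c \<xi> * (\<xi> s0 - \<psi> s0) * \<xi> s) < 1" .
    qed (use insert.prems in auto)
    then have "w (c \<xi>) * w (\<xi> s0 - \<psi> s0) < 1" by (simp add: w_mult)
    moreover have "w (c \<xi>) * 1 \<le> w (c \<xi>) * w (\<xi> s0 - \<psi> s0)"
      using s0 w_nonneg by (intro mult_left_mono) auto
    ultimately show ?thesis by simp
  qed
  have one: "(\<Sum>\<xi>\<in>T. c \<xi> * \<xi> 1) = sum c T" if "T \<subseteq> insert \<psi> S" for T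
    using insert.prems(1) that by (intro sum.cong) auto
  have "w ((\<Sum>\<xi>\<in>insert \<psi> S. c \<xi> * \<xi> 1) - (\<Sum>\<xi>\<in>S. c \<xi>)) < 1"
    using assms(2) S by (intro w_diff_less insert.prems(5) w_sum_less) auto
  also have "(\<Sum>\<xi>\<in>insert \<psi> S. c \<xi> * \<xi> 1) - (\<Sum>\<xi>\<in>S. c \<xi>) = c \<psi>"
    using insert.hyps by (simp add: one)
  finally show ?case using S insert.prems(6) by auto
qed simp

end

text \<open>\<open>Z\<close> generates the finite Galois extension under study, later that of the
  a^2-torsion. The element \<pi> of the base makes \<open>w\<close> nontrivial there, which is used
  to separate \<open>w\<close> from its conjugates.\<close>

locale galois_valued = nonarch w for w :: "'f::field alg_closure \<Rightarrow> real" +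
  fixes Z :: "'f alg_closure set" and \<pi> :: 'f
  assumes finite_Z: "finite Z" and separable_Z: "x \<in> Z \<Longrightarrow> separable_elem x"
    and stable_Z: "\<sigma> \<in> ac_auts \<Longrightarrow> x \<in> Z \<Longrightarrow> \<sigma> x \<in> Z"
    and \<pi>: "0 < w (to_ac \<pi>)" "w (to_ac \<pi>) < 1"
begin

text \<open>By Galois theory this is the field generated by \<open>Z\<close> over the base. The
  separability clause excludes purely inseparable elements, which every automorphism fixes.\<close>

definition M :: "'f alg_closure set" where
  "M = {x. separable_elem x \<and> (\<forall>\<sigma>\<in>ac_auts. (\<forall>z\<in>Z. \<sigma> z = z) \<longrightarrow> \<sigma> x = x)}"

text \<open>Only values on \<open>M\<close> are tested. So \<open>decomp\<close> and
  \<open>inertia\<close> consist of automorphisms of the closure and are the preimages of the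
  decomposition and inertia groups of \<open>M\<close> over the base.\<close>

definition decomp :: "('f alg_closure \<Rightarrow> 'f alg_closure) set" where
  "decomp = {\<sigma>\<in>ac_auts. \<forall>x\<in>M. w (\<sigma> x) = w x}"

definition inertia :: "('f alg_closure \<Rightarrow> 'f alg_closure) set" where
  "inertia = {\<sigma>\<in>decomp. \<forall>x\<in>M. w x \<le> 1 \<longrightarrow> w (\<sigma> x - x) < 1}"

definition MI :: "'f alg_closure set" where
  "MI = {x\<in>M. \<forall>\<sigma>\<in>inertia. \<sigma> x = x}"

lemma Z_subset_M: "Z \<subseteq> M" by (auto simp: M_def separable_Z)

lemma field_set_M: "field_set M"
  using field_setD[OF field_set_separable] by (auto simp: field_set_def M_def ac_auts_hom)

lemma to_ac_M: "to_ac a \<in> M" by (auto simp: M_def separable_elem_to_ac ac_auts_hom)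

lemma ac_auts_M:
  assumes s: "\<sigma> \<in> ac_auts" and x: "x \<in> M" shows "\<sigma> x \<in> M"
  unfolding M_def
proof (intro CollectI conjI ballI impI)
  show "separable_elem (\<sigma> x)" using x s by (auto simp: M_def separable_elem_ac_auts)
  fix \<tau> assume t: "\<tau> \<in> ac_auts" "\<forall>z\<in>Z. \<tau> z = z"
  let ?\<rho> = "\<lambda>x. inv_into UNIV \<sigma> (\<tau> (\<sigma> x))"
  have "?\<rho> \<in> ac_auts"
    by (rule ac_auts_comp[OF ac_auts_inv(1)[OF s] ac_auts_comp[OF t(1) s]])
  moreover have "\<forall>z\<in>Z. ?\<rho> z = z" using s t stable_Z by (auto simp: ac_auts_inv)
  ultimately have "?\<rho> x = x" using x by (auto simp: M_def)
  then show "\<tau> (\<sigma> x) = \<sigma> x" using ac_auts_inv(2)[OF s] by metis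
qed

lemma eq_on_M:
  assumes s: "\<sigma> \<in> ac_auts" "\<tau> \<in> ac_auts" and eq: "\<And>z. z \<in> Z \<Longrightarrow> \<sigma> z = \<tau> z" and x: "x \<in> M"
  shows "\<sigma> x = \<tau> x"
proof -
  let ?\<rho> = "\<lambda>x. inv_into UNIV \<tau> (\<sigma> x)"
  have "?\<rho> \<in> ac_auts" by (rule ac_auts_comp[OF ac_auts_inv(1)[OF s(2)] s(1)])
  moreover have "\<forall>z\<in>Z. ?\<rho> z = z" using s eq by (auto simp: ac_auts_inv)
  ultimately have "?\<rho> x = x" using x by (auto simp: M_def)
  then show ?thesis using ac_auts_inv(2)[OF s(2)] by metis
qed

text \<open>Sums and products over a Galois group are taken over these restrictions:
  \<open>S\<close> itself may be infinite, but on a subset of \<open>M\<close> its elements give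
  finitely many functions.\<close>

definition res :: "('f alg_closure \<Rightarrow> 'f alg_closure) set \<Rightarrow> 'f alg_closure set \<Rightarrow>
    ('f alg_closure \<Rightarrow> 'f alg_closure) set" where
  "res S T = (\<lambda>\<sigma>. restrict \<sigma> T) ` S"

text \<open>On \<open>M\<close> an automorphism is determined by the map that it induces on the
  finite set \<open>Z\<close>.\<close>

lemma finite_res:
  assumes S: "S \<subseteq> ac_auts" and T: "T \<subseteq> M"
  shows "finite (res S T)"
proof -
  define F where "F g = restrict (SOME \<sigma>. \<sigma> \<in> ac_auts \<and> restrict \<sigma> Z = g) T" for g
  have "res S T \<subseteq> F ` (Z \<rightarrow>\<^sub>E Z)"
  proof
    fix \<xi> assume "\<xi> \<in> res S T"
    then obtain \<sigma> where s: "\<sigma> \<in> ac_auts" "\<xi> = restrict \<sigma> T" using S by (auto simp: res_def)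
    define \<tau> where "\<tau> = (SOME \<tau>. \<tau> \<in> ac_auts \<and> restrict \<tau> Z = restrict \<sigma> Z)"
    have t: "\<tau> \<in> ac_auts \<and> restrict \<tau> Z = restrict \<sigma> Z"
      unfolding \<tau>_def by (rule someI[of _ \<sigma>]) (use s in auto)
    have "\<tau> z = \<sigma> z" if "z \<in> Z" for z using t that by (metis restrict_apply')
    then have "restrict \<tau> T = restrict \<sigma> T" using eq_on_M[of \<tau> \<sigma>] t s T by (intro restrict_ext) auto
    then have "\<xi> = F (restrict \<sigma> Z)" using s by (simp add: F_def \<tau>_def)
    moreover have "restrict \<sigma> Z \<in> Z \<rightarrow>\<^sub>E Z" using s stable_Z by auto
    ultimately show "\<xi> \<in> F ` (Z \<rightarrow>\<^sub>E Z)" by blast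
  qed
  then show ?thesis by (rule finite_subset) (use finite_Z in \<open>auto intro: finite_PiE\<close>)
qed

lemma res_reindex:
  assumes S: "S \<subseteq> ac_auts" and T: "T \<subseteq> M" and s: "\<sigma> \<in> ac_auts"
    and cl: "\<And>\<tau>. \<tau> \<in> S \<Longrightarrow> (\<lambda>x. \<sigma> (\<tau> x)) \<in> S"
  shows "bij_betw (\<lambda>\<xi>. \<lambda>x\<in>T. \<sigma> (\<xi> x)) (res S T) (res S T)"
proof -
  let ?F = "\<lambda>\<xi>. \<lambda>x\<in>T. \<sigma> (\<xi> x)"
  have "?F ` res S T \<subseteq> res S T"
    using cl by (force simp: res_def image_iff intro!: restrict_ext)
  moreover have "inj_on ?F (res S T)"
  proof (rule inj_onI)
    fix \<xi> \<psi> assume c: "\<xi> \<in> res S T" "\<psi> \<in> res S T" "?F \<xi> = ?F \<psi>"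
    have "\<sigma> (\<xi> x) = \<sigma> (\<psi> x)" if "x \<in> T" for x using fun_cong[OF c(3), of x] that by simp
    then have "\<xi> x = \<psi> x" if "x \<in> T" for x using that s by (auto simp: ac_auts_hom)
    then show "\<xi> = \<psi>" using c by (intro extensionalityI[of _ T]) (auto simp: res_def)
  qed
  ultimately show ?thesis
    unfolding bij_betw_def using finite_res[OF S T] by (simp add: endo_inj_surj)
qed

lemma res_sum_invariant:
  assumes "S \<subseteq> ac_auts" "T \<subseteq> M" "\<sigma> \<in> ac_auts" "\<And>\<tau>. \<tau> \<in> S \<Longrightarrow> (\<lambda>x. \<sigma> (\<tau> x)) \<in> S" "x \<in> T"
  shows "\<sigma> (\<Sum>\<xi>\<in>res S T. \<xi> x) = (\<Sum>\<xi>\<in>res S T. \<xi> x)"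
    and "\<sigma> (\<Prod>\<xi>\<in>res S T. \<xi> x) = (\<Prod>\<xi>\<in>res S T. \<xi> x)"
    and "map_poly \<sigma> (\<Prod>\<xi>\<in>res S T. [:- \<xi> x, 1:]) = (\<Prod>\<xi>\<in>res S T. [:- \<xi> x, 1:])"
proof -
  note b = res_reindex[OF assms(1-4)]
  show "\<sigma> (\<Sum>\<xi>\<in>res S T. \<xi> x) = (\<Sum>\<xi>\<in>res S T. \<xi> x)"
    using sum.reindex_bij_betw[OF b, of "\<lambda>\<xi>. \<xi> x"] assms(3,5) by (simp add: ac_auts_sum)
  show "\<sigma> (\<Prod>\<xi>\<in>res S T. \<xi> x) = (\<Prod>\<xi>\<in>res S T. \<xi> x)"
    using prod.reindex_bij_betw[OF b, of "\<lambda>\<xi>. \<xi> x"] assms(3,5) by (simp add: ac_auts_prod)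
  show "map_poly \<sigma> (\<Prod>\<xi>\<in>res S T. [:- \<xi> x, 1:]) = (\<Prod>\<xi>\<in>res S T. [:- \<xi> x, 1:])"
    using prod.reindex_bij_betw[OF b, of "\<lambda>\<xi>. [:- \<xi> x, 1:]"] assms(3,5) by (simp add: prod_linear_ac_auts)
qed

lemma decomp_ac: "\<sigma> \<in> decomp \<Longrightarrow> \<sigma> \<in> ac_auts" and inertia_decomp: "\<sigma> \<in> inertia \<Longrightarrow> \<sigma> \<in> decomp"
  by (auto simp: decomp_def inertia_def)

lemma inertia_ac: "\<sigma> \<in> inertia \<Longrightarrow> \<sigma> \<in> ac_auts"
  using decomp_ac inertia_decomp by blast

lemma decomp_w: "\<sigma> \<in> decomp \<Longrightarrow> x \<in> M \<Longrightarrow> w (\<sigma> x) = w x"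
  by (auto simp: decomp_def)

lemma inertia_w: "\<sigma> \<in> inertia \<Longrightarrow> x \<in> M \<Longrightarrow> w (\<sigma> x) = w x"
  by (simp add: decomp_w inertia_decomp)

lemma inertia_near: "\<sigma> \<in> inertia \<Longrightarrow> x \<in> M \<Longrightarrow> w x \<le> 1 \<Longrightarrow> w (\<sigma> x - x) < 1"
  by (auto simp: inertia_def)

lemma decomp_comp: "\<sigma> \<in> decomp \<Longrightarrow> \<tau> \<in> decomp \<Longrightarrow> (\<lambda>x. \<sigma> (\<tau> x)) \<in> decomp"
  using ac_auts_comp[of \<sigma> \<tau>] by (simp add: decomp_def ac_auts_M)

lemma decomp_inv: "\<sigma> \<in> decomp \<Longrightarrow> inv_into UNIV \<sigma> \<in> decomp"
  unfolding decomp_def by (auto simp: ac_auts_inv) (metis ac_auts_inv ac_auts_M)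

lemma inertia_id: "(\<lambda>x. x) \<in> inertia"
  by (auto simp: inertia_def decomp_def ac_auts_id w_0)

lemma inertia_comp:
  assumes "\<sigma> \<in> inertia" "\<tau> \<in> inertia" shows "(\<lambda>x. \<sigma> (\<tau> x)) \<in> inertia"
  unfolding inertia_def
proof (intro CollectI conjI ballI impI)
  show "(\<lambda>x. \<sigma> (\<tau> x)) \<in> decomp" using assms by (simp add: decomp_comp[of \<sigma> \<tau>] inertia_decomp)
  fix x assume x: "x \<in> M" "w x \<le> 1"
  then have "\<tau> x \<in> M" "w (\<tau> x) \<le> 1" using assms by (auto simp: ac_auts_M inertia_ac inertia_w)
  then have "w ((\<sigma> (\<tau> x) - \<tau> x) + (\<tau> x - x)) < 1" using assms x by (intro w_add_less inertia_near)
  then show "w (\<sigma> (\<tau> x) - x) < 1" by simp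
qed

lemma inertia_inv:
  assumes "\<sigma> \<in> inertia" shows "inv_into UNIV \<sigma> \<in> inertia"
  unfolding inertia_def
proof (intro CollectI conjI ballI impI)
  let ?\<tau> = "inv_into UNIV \<sigma>"
  have a: "\<sigma> \<in> ac_auts" using assms by (rule inertia_ac)
  show d: "?\<tau> \<in> decomp" using assms by (intro decomp_inv inertia_decomp)
  fix x assume x: "x \<in> M" "w x \<le> 1"
  then have m: "?\<tau> x \<in> M" "w (?\<tau> x) \<le> 1" using d by (auto simp: ac_auts_M decomp_ac decomp_w)
  have "w (\<sigma> (?\<tau> x) - ?\<tau> x) < 1" using inertia_near[OF assms m] .
  then show "w (?\<tau> x - x) < 1" by (simp add: ac_auts_inv[OF a] w_diff_commute)
qed

section \<open>Separating the place from its conjugates\<close>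

lemma MI_subset_M: "MI \<subseteq> M" by (auto simp: MI_def)

lemma field_set_MI: "field_set MI"
  using field_setD[OF field_set_M] by (auto simp: field_set_def MI_def ac_auts_hom inertia_ac)

text \<open>If w and its conjugate under \<sigma> differ on \<open>M\<close>, some x, possibly after
  inversion, has w x < w (\<sigma> x). As \<sigma> fixes \<pi>, a suitable x^n / \<pi>^m has 1
  strictly between its two values.\<close>

lemma separate_place:
  assumes s: "\<sigma> \<in> ac_auts" "\<sigma> \<notin> decomp"
  shows "\<exists>x\<in>M. w x < 1 \<and> 1 < w (\<sigma> x)"
proof -
  obtain y where y: "y \<in> M" "w (\<sigma> y) \<noteq> w y" using s by (auto simp: decomp_def)
  have y0: "y \<noteq> 0" using y s by (auto simp: ac_auts_hom w_0)
  obtain x where x: "x \<in> M" "w x < w (\<sigma> x)" "x \<noteq> 0"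
  proof (cases "w y < w (\<sigma> y)")
    case False
    with y have "w (\<sigma> y) < w y" by simp
    moreover have "w (\<sigma> y) > 0" using y0 s by (intro w_pos) (simp add: ac_auts_hom)
    ultimately have "w (inverse y) < w (\<sigma> (inverse y))" using s
      by (simp add: ac_auts_hom w_inverse)
    then show ?thesis using that[of "inverse y"] y y0 field_setD[OF field_set_M] by auto
  qed (use that y y0 in blast)
  define p where "p = w (to_ac \<pi>)"
  have p: "0 < p" "p < 1" using \<pi> by (auto simp: p_def)
  have wx: "0 < w x" using x by (intro w_pos)
  \<comment> \<open>This is the logarithm to the base \<open>p\<close> < 1, hence it reverses the
    order; a rational number m / n between the two logarithms supplies the exponents of
    \<open>z\<close>.\<close>
  define l where "l t = ln t / ln p" for t
  have lp: "ln p < 0" using p by simp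
  have "l (w (\<sigma> x)) < l (w x)" unfolding l_def using x wx lp by (simp add: divide_strict_right_mono_neg)
  then obtain r where r: "r \<in> \<rat>" "l (w (\<sigma> x)) < r" "r < l (w x)" using Rats_dense_in_real by blast
  obtain m :: int and n :: nat where mn: "n \<noteq> 0" "r = of_int m / of_nat n"
    using r(1) by (metis Rats_cases' gr_implies_not0 of_int_of_nat_eq zero_less_imp_eq_int)
  have np: "real n > 0" using mn by simp
  have 1: "real n * ln (w x) < of_int m * ln p" using r(3) np lp unfolding mn l_def by (simp add: field_simps)
  have 2: "of_int m * ln p < real n * ln (w (\<sigma> x))" using r(2) np lp unfolding mn l_def by (simp add: field_simps)
  define z where "z = x ^ n * (if m \<ge> 0 then inverse (to_ac \<pi> ^ nat m) else to_ac \<pi> ^ nat (- m))"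
  have wp: "w (if m \<ge> 0 then inverse (to_ac \<pi> ^ nat m) else to_ac \<pi> ^ nat (- m)) = exp (- of_int m * ln p)"
  proof (cases "m \<ge> 0")
    case True
    then have "exp (- of_int m * ln p) = inverse (exp (real (nat m) * ln p))"
      by (simp add: exp_minus)
    also have "\<dots> = inverse (p ^ nat m)" using p by (simp add: exp_of_nat_mult)
    finally show ?thesis using True by (simp add: w_inverse w_power p_def)
  next
    case False
    then have "exp (- of_int m * ln p) = exp (real (nat (- m)) * ln p)" by simp
    also have "\<dots> = p ^ nat (- m)" using p by (simp add: exp_of_nat_mult)
    finally show ?thesis using False by (simp add: w_power p_def)
  qed
  have e: "t ^ n = exp (real n * ln t)" if "t > 0" for t :: real using that by (simp add: exp_of_nat_mult)
  have "w z = exp (real n * ln (w x) - of_int m * ln p)"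
    unfolding z_def using wx by (simp add: w_mult w_power wp e exp_diff exp_minus field_simps)
  then have "w z < 1" using 1 by simp
  have "\<sigma> z = \<sigma> x ^ n * (if m \<ge> 0 then inverse (to_ac \<pi> ^ nat m) else to_ac \<pi> ^ nat (- m))"
    unfolding z_def using s by (simp add: ac_auts_hom)
  then have "w (\<sigma> z) = exp (real n * ln (w (\<sigma> x)) - of_int m * ln p)"
    using wx x by (simp add: w_mult w_power wp e exp_diff exp_minus field_simps)
  then have "1 < w (\<sigma> z)" using 2 by simp
  have "z \<in> M" unfolding z_def using x by (auto intro!: field_setD[OF field_set_M] to_ac_M)
  with \<open>w z < 1\<close> \<open>1 < w (\<sigma> z)\<close> show ?thesis by blast
qed

text \<open>The Artin--Whaples induction: if \<open>z\<close> is large at the places already treated and \<open>x\<close> is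
  large at the new one, then \<open>z\<^sup>n + x\<close> is large at all of them once \<open>n\<close> is big.\<close>

lemma separate_places:
  assumes "finite T" "T \<subseteq> res (ac_auts - decomp) M"
  shows "\<exists>z\<in>M. w z < 1 \<and> (\<forall>\<xi>\<in>T. 1 < w (\<xi> z))"
  using assms
proof (induction T rule: finite_induct)
  case empty
  then show ?case by (intro bexI[of _ 0]) (auto simp: w_0 field_setD[OF field_set_M])
next
  case (insert \<psi> T)
  then obtain z where z: "z \<in> M" "w z < 1" "\<And>\<xi>. \<xi> \<in> T \<Longrightarrow> 1 < w (\<xi> z)" by auto
  obtain \<sigma> where s: "\<sigma> \<in> ac_auts" "\<sigma> \<notin> decomp" "\<psi> = restrict \<sigma> M" using insert.prems by (auto simp: res_def)
  obtain x where x: "x \<in> M" "w x < 1" "1 < w (\<sigma> x)" using separate_place[OF s(1,2)] by blast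
  show ?case
  proof (cases "1 < w (\<psi> z)")
    case True
    then show ?thesis using z by blast
  next
    case False
    have "\<forall>\<^sub>F n in sequentially. w (\<xi> x) < w (\<xi> z) ^ n" if "\<xi> \<in> T" for \<xi>
      using z(3)[OF that] filterlim_realpow_sequentially_gt1[of "w (\<xi> z)"]
      by (simp add: filterlim_at_infinity_conv_norm_at_top filterlim_at_top_dense
            eventually_mono w_nonneg abs_of_nonneg)
    then have "\<forall>\<^sub>F n in sequentially. (\<forall>\<xi>\<in>T. w (\<xi> x) < w (\<xi> z) ^ n) \<and> n \<ge> 1"
      using insert.hyps(1) by (intro eventually_conj eventually_ball_finite eventually_ge_at_top) auto
    then obtain n where n: "\<And>\<xi>. \<xi> \<in> T \<Longrightarrow> w (\<xi> x) < w (\<xi> z) ^ n" "n \<ge> 1"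
      by (auto dest!: eventually_happens)
    have zn: "z ^ n + x \<in> M" using z x by (auto intro!: field_setD[OF field_set_M])
    have "w (z ^ n) < 1" using z(2) n(2) w_nonneg[of z] by (simp add: w_power power_less_one_iff)
    then have "w (z ^ n + x) < 1" using x by (intro w_add_less)
    moreover have "1 < w (\<xi> (z ^ n + x))" if c: "\<xi> \<in> insert \<psi> T" for \<xi>
    proof -
      obtain \<tau> where t: "\<tau> \<in> ac_auts" "\<xi> = restrict \<tau> M" using c insert.prems by (auto simp: res_def)
      have eq: "\<xi> (z ^ n + x) = \<tau> z ^ n + \<tau> x" using t zn by (simp add: ac_auts_hom)
      show ?thesis
      proof (cases "\<xi> = \<psi>")
        case True
        then have tx: "\<tau> z = \<sigma> z" "\<tau> x = \<sigma> x" using t s z x by (metis restrict_apply')+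
        have "w (\<sigma> z) \<le> 1" using False z(1) s by simp
        then have "w (\<sigma> z ^ n) \<le> 1" using w_nonneg by (simp add: w_power power_le_one)
        then have "w (\<sigma> x + \<sigma> z ^ n) = w (\<sigma> x)" using x by (intro w_add_eq) simp
        then show ?thesis using x eq tx by (simp add: add.commute)
      next
        case False
        then have T: "\<xi> \<in> T" using c by simp
        have "w (\<tau> x) < w (\<tau> z ^ n)" using n(1)[OF T] t z x by (simp add: w_power)
        then have "w (\<tau> z ^ n + \<tau> x) = w (\<tau> z) ^ n" by (simp add: w_add_eq w_power)
        also have "\<dots> > 1" using z(3)[OF T] t z(1) n(2) by (simp add: one_less_power)
        finally show ?thesis by (simp add: eq)
      qed
    qed
    ultimately show ?thesis using zn by blast
  qed
qed

lemma decomp_left_coset: "\<sigma> \<in> ac_auts - decomp \<Longrightarrow> \<tau> \<in> decomp \<Longrightarrow> (\<lambda>x. \<sigma> (\<tau> x)) \<in> ac_auts - decomp"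
proof safe
  assume s: "\<sigma> \<in> ac_auts" "\<sigma> \<notin> decomp" "\<tau> \<in> decomp" "(\<lambda>x. \<sigma> (\<tau> x)) \<in> decomp"
  have "(\<lambda>x. \<sigma> (\<tau> (inv_into UNIV \<tau> x))) \<in> decomp"
    using decomp_comp[OF s(4) decomp_inv[OF s(3)]] .
  then show False using s by (simp add: ac_auts_inv decomp_ac)
qed (use ac_auts_comp[of \<sigma> \<tau>] decomp_ac in auto)

text \<open>1 / (1 + z) is close to 1 where z is small and small where z is large. The product over
  inertia moves it into \<open>MI\<close> and spoils neither property, because \<open>decomp\<close>
  and its complement are stable under right multiplication by inertia.\<close>

lemma approximate_unit:
  "\<exists>e\<in>MI. (\<forall>\<delta>\<in>decomp. w (\<delta> e - 1) < 1) \<and> (\<forall>\<sigma>\<in>ac_auts - decomp. w (\<sigma> e) < 1)"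
proof -
  let ?N = "res (ac_auts - decomp) M"
  obtain z where z: "z \<in> M" "w z < 1" "\<And>\<xi>. \<xi> \<in> ?N \<Longrightarrow> 1 < w (\<xi> z)"
    using separate_places[of ?N] finite_res[of "ac_auts - decomp" M] by auto
  define e1 where "e1 = inverse (1 + z)"
  have e1M: "e1 \<in> M" unfolding e1_def using z by (auto intro!: field_setD[OF field_set_M])
  have w1z: "w (1 + z) = 1" using w_add_eq[of z 1] z by (simp add: w_1)
  then have z0: "1 + z \<noteq> 0" using w_0 by force
  have d1: "w (\<delta> e1 - 1) < 1" if "\<delta> \<in> decomp" for \<delta>
  proof -
    have "e1 - 1 = - z * e1" using z0 by (simp add: e1_def field_simps)
    then have "w (e1 - 1) < 1" using z w1z by (simp add: w_mult w_uminus e1_def w_inverse)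
    moreover have "\<delta> e1 - 1 = \<delta> (e1 - 1)" using that by (simp add: ac_auts_hom decomp_ac)
    ultimately show ?thesis using that e1M by (simp add: decomp_w field_setD[OF field_set_M])
  qed
  have n1: "w (\<sigma> e1) < 1" if s: "\<sigma> \<in> ac_auts - decomp" for \<sigma>
  proof -
    have "1 < w (\<sigma> z)" using z(3)[of "restrict \<sigma> M"] s z(1) by (auto simp: res_def)
    then have "w (1 + \<sigma> z) > 1" using w_add_eq[of 1 "\<sigma> z"] by (simp add: w_1 add.commute)
    moreover have "\<sigma> e1 = inverse (1 + \<sigma> z)" using s by (simp add: e1_def ac_auts_hom)
    ultimately show ?thesis by (simp add: w_inverse inverse_less_1_iff)
  qed
  define e where "e = (\<Prod>\<iota>\<in>res inertia M. \<iota> e1)"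
  have ac: "inertia \<subseteq> ac_auts" using inertia_ac by blast
  have "e \<in> M" unfolding e_def
    by (rule field_set_prod[OF field_set_M]) (auto simp: res_def e1M ac_auts_M inertia_ac)
  moreover have "\<sigma> e = e" if "\<sigma> \<in> inertia" for \<sigma>
    unfolding e_def
    by (rule res_sum_invariant(2)[OF ac order_refl inertia_ac[OF that] inertia_comp[OF that] e1M])
  ultimately have "e \<in> MI" by (auto simp: MI_def)
  moreover have "w (\<delta> e - 1) < 1" if d: "\<delta> \<in> decomp" for \<delta>
    unfolding e_def ac_auts_prod[OF decomp_ac[OF d]]
  proof (rule w_prod_near_1)
    fix \<iota> assume "\<iota> \<in> res inertia M"
    then obtain i where i: "i \<in> inertia" "\<iota> e1 = i e1" using e1M by (auto simp: res_def)
    show "w (\<delta> (\<iota> e1) - 1) < 1" unfolding i using d1[OF decomp_comp[OF d inertia_decomp[OF i(1)]]] .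
  qed
  moreover have "w (\<sigma> e) < 1" if s: "\<sigma> \<in> ac_auts - decomp" for \<sigma>
  proof -
    have fin: "finite (res inertia M)" using finite_res[OF ac] by simp
    \<comment> \<open>The factor of the identity shows that the product is not empty; an empty one
      would be 1.\<close>
    have ne: "restrict (\<lambda>x. x) M \<in> res inertia M" using inertia_id by (auto simp: res_def)
    have less: "w (\<sigma> (\<iota> e1)) < 1" if \<iota>: "\<iota> \<in> res inertia M" for \<iota>
    proof -
      obtain i where i: "i \<in> inertia" "\<iota> e1 = i e1" using \<iota> e1M by (auto simp: res_def)
      show ?thesis unfolding i using n1[OF decomp_left_coset[OF s inertia_decomp[OF i(1)]]] .
    qed
    have "w (\<sigma> e) = (\<Prod>\<iota>\<in>res inertia M. w (\<sigma> (\<iota> e1)))"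
      unfolding e_def using s by (simp add: ac_auts_prod w_prod)
    also have "\<dots> = w (\<sigma> (restrict (\<lambda>x. x) M e1)) * (\<Prod>\<iota>\<in>res inertia M - {restrict (\<lambda>x. x) M}. w (\<sigma> (\<iota> e1)))"
      using fin ne by (rule prod.remove)
    also have "\<dots> \<le> w (\<sigma> (restrict (\<lambda>x. x) M e1)) * 1"
      using less w_nonneg by (intro mult_left_mono prod_le_1) (auto simp: less_imp_le)
    also have "\<dots> < 1" using less[OF ne] by simp
    finally show ?thesis .
  qed
  ultimately show ?thesis by blast
qed

text \<open>If the residue characters agreed on \<open>MI\<close>, they would agree on the coefficients of
  \<open>\<Prod>\<iota>. (X - \<iota> t)\<close>, which reduces to a power of \<open>X - t\<close>; so they would agree at \<open>t\<close>.\<close>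

lemma decomp_chars_distinct:
  assumes d: "\<delta>1 \<in> decomp" "\<delta>2 \<in> decomp" and ne: "restrict \<delta>1 MI \<noteq> restrict \<delta>2 MI"
  shows "\<exists>s\<in>MI. w s \<le> 1 \<and> w (\<delta>1 s - \<delta>2 s) \<ge> 1"
proof (rule ccontr)
  assume "\<not> ?thesis"
  then have close: "w (\<delta>1 s - \<delta>2 s) < 1" if "s \<in> MI" "w s \<le> 1" for s using that by force
  have ac: "\<delta>1 \<in> ac_auts" "\<delta>2 \<in> ac_auts" using d by (auto simp: decomp_ac)
  obtain x where x: "x \<in> MI" "\<delta>1 x \<noteq> \<delta>2 x" using ne by (meson restrict_ext)
  \<comment> \<open>This quotient of \<delta>1 by \<delta>2 is in \<open>decomp\<close> but moves an
    element of \<open>MI\<close>, so it is not in inertia and shifts some integral t by an element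
    of value at least 1.\<close>
  define \<rho> where "\<rho> x = inv_into UNIV \<delta>2 (\<delta>1 x)" for x
  have \<rho>: "\<rho> \<in> decomp" unfolding \<rho>_def by (rule decomp_comp[OF decomp_inv[OF d(2)] d(1)])
  have "\<delta>2 (\<rho> x) = \<delta>1 x" for x using ac by (simp add: \<rho>_def ac_auts_inv)
  note \<rho>2 = this
  have "\<rho> x \<noteq> x" using x \<rho>2 by metis
  then have "\<rho> \<notin> inertia" using x by (auto simp: MI_def)
  then obtain t where t: "t \<in> M" "w t \<le> 1" "w (\<rho> t - t) \<ge> 1" using \<rho> by (auto simp: inertia_def not_less)
  have "w (\<delta>2 (\<rho> t - t)) = w (\<rho> t - t)"
    using d t \<rho> by (intro decomp_w field_setD[OF field_set_M]) (auto simp: ac_auts_M decomp_ac)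
  then have far: "w (\<delta>1 t - \<delta>2 t) \<ge> 1" using t ac \<rho>2 by (simp add: ac_auts_hom)
  define J where "J = res inertia M"
  have iac: "inertia \<subseteq> ac_auts" using inertia_ac by blast
  have finJ: "finite J" unfolding J_def using finite_res[OF iac] by simp
  define f where "f = (\<Prod>\<iota>\<in>J. [:- \<iota> t, 1:])"
  have J: "\<exists>i\<in>inertia. \<iota> t = i t" if "\<iota> \<in> J" for \<iota> using that t by (auto simp: J_def res_def)
  have fM: "f \<in> polys_over M" unfolding f_def
  proof (intro polys_over_prod polys_over_linear field_set_ring field_set_M)
    fix \<iota> assume "\<iota> \<in> J" then show "\<iota> t \<in> M" using J t by (metis ac_auts_M inertia_ac)
  qed
  have fix_f: "map_poly \<sigma> f = f" if "\<sigma> \<in> inertia" for \<sigma>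
    unfolding f_def J_def
    by (rule res_sum_invariant(3)[OF iac order_refl inertia_ac[OF that] inertia_comp[OF that] t(1)])
  have cMI: "coeff f i \<in> MI" for i
    unfolding MI_def
  proof (intro CollectI conjI ballI)
    show "coeff f i \<in> M" using polys_overD[OF fM] .
    fix \<sigma> assume s: "\<sigma> \<in> inertia"
    then show "\<sigma> (coeff f i) = coeff f i"
      using fix_f[OF s] by (metis ac_auts_hom(1) coeff_map_poly inertia_ac)
  qed
  have le1: "w (coeff (\<Prod>\<iota>\<in>S. [:- g \<iota>, 1:]) i) \<le> 1"
    if "\<And>\<iota>. \<iota> \<in> S \<Longrightarrow> w (g \<iota>) \<le> 1" for S :: "('f alg_closure \<Rightarrow> 'f alg_closure) set" and g i
    using that
  proof (induction S arbitrary: i rule: infinite_finite_induct)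
    case (insert \<iota> S)
    have "coeff (\<Prod>\<iota>\<in>insert \<iota> S. [:- g \<iota>, 1:]) i =
      (case i of 0 \<Rightarrow> 0 | Suc j \<Rightarrow> coeff (\<Prod>\<iota>\<in>S. [:- g \<iota>, 1:]) j) - g \<iota> * coeff (\<Prod>\<iota>\<in>S. [:- g \<iota>, 1:]) i"
      using insert by (simp add: coeff_pCons split: nat.splits)
    also have "w \<dots> \<le> max 1 1"
      using insert by (intro order_trans[OF w_diff] max.mono)
        (auto simp: w_mult w_0 mult_le_one w_nonneg split: nat.splits)
    finally show ?case by simp
  qed (auto simp: w_1 w_0)
  have c1: "w (coeff f i) \<le> 1" for i unfolding f_def
  proof (rule le1)
    fix \<iota> assume "\<iota> \<in> J" then show "w (\<iota> t) \<le> 1" using J t by (metis inertia_w)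
  qed
  have \<delta>1t: "w (\<delta>1 t) \<le> 1" using d t by (simp add: decomp_w)
  have p1: "poly (map_poly \<delta>1 f) (\<delta>1 t) = 0"
  proof -
    have "restrict (\<lambda>x. x) M \<in> J" using inertia_id by (auto simp: J_def res_def)
    then show ?thesis unfolding f_def prod_linear_ac_auts[OF ac(1)] poly_prod
      using finJ t by (intro prod_zero bexI[of _ "restrict (\<lambda>x. x) M"]) auto
  qed
  \<comment> \<open>At \<delta>1 t the polynomial \<delta>1 f vanishes, whereas every factor of
    \<delta>2 f is as large as \<delta>1 t - \<delta>2 t, since inertia moves t by less than 1. The
    coefficients of both differ by less than 1, which is the contradiction.\<close>
  have "poly (map_poly \<delta>2 f) (\<delta>1 t) = (\<Prod>\<iota>\<in>J. \<delta>1 t - \<delta>2 (\<iota> t))"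
    unfolding f_def prod_linear_ac_auts[OF ac(2)] by (simp add: poly_prod)
  then have "w (poly (map_poly \<delta>2 f) (\<delta>1 t)) = (\<Prod>\<iota>\<in>J. w (\<delta>1 t - \<delta>2 (\<iota> t)))" by (simp add: w_prod)
  also have "\<dots> \<ge> 1"
  proof (rule prod_ge_1)
    fix \<iota> assume "\<iota> \<in> J"
    then obtain i where i: "i \<in> inertia" "\<iota> t = i t" using J by blast
    have "w (\<delta>2 (i t - t)) = w (i t - t)"
      using d t i by (intro decomp_w field_setD[OF field_set_M]) (auto simp: ac_auts_M inertia_ac)
    also have "\<dots> < 1" using i t by (simp add: inertia_near)
    finally have "w (\<delta>2 (i t) - \<delta>2 t) < w (\<delta>1 t - \<delta>2 t)" using far ac by (simp add: ac_auts_hom)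
    then have "w ((\<delta>1 t - \<delta>2 t) + - (\<delta>2 (i t) - \<delta>2 t)) = w (\<delta>1 t - \<delta>2 t)"
      by (intro w_add_eq) (simp only: w_uminus)
    then show "1 \<le> w (\<delta>1 t - \<delta>2 (\<iota> t))" using far i by simp
  qed
  finally have p2: "1 \<le> w (poly (map_poly \<delta>2 f) (\<delta>1 t))" .
  have "poly (map_poly \<delta>1 f) (\<delta>1 t) - poly (map_poly \<delta>2 f) (\<delta>1 t) = poly (map_poly \<delta>1 f - map_poly \<delta>2 f) (\<delta>1 t)"
    by simp
  also have "w \<dots> < 1" unfolding poly_altdef
  proof (rule w_sum_less)
    fix i
    have "w (coeff (map_poly \<delta>1 f - map_poly \<delta>2 f) i) < 1"
      using close[OF cMI c1, of i] ac by (simp add: coeff_map_poly ac_auts_hom)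
    then have "w (\<delta>1 t ^ i * coeff (map_poly \<delta>1 f - map_poly \<delta>2 f) i) < 1"
      using \<delta>1t w_nonneg by (intro w_mult_less) (auto simp: w_power power_le_one)
    then show "w (coeff (map_poly \<delta>1 f - map_poly \<delta>2 f) i * \<delta>1 t ^ i) < 1" by (simp add: mult.commute)
  qed simp
  finally show False using p1 p2 by (simp add: w_uminus)
qed

text \<open>The trace of \<open>s * \<alpha> * e ^ n\<close> to the base field has the value of \<open>\<alpha>\<close>: independence of the
  residue characters gives an \<open>s\<close> for which the terms from the decomposition group do not
  cancel, and the factor \<open>e ^ n\<close> makes all other terms negligible.\<close>

theorem inertia_fixed_value:
  assumes \<alpha>: "\<alpha> \<in> M" "\<And>\<sigma>. \<sigma> \<in> inertia \<Longrightarrow> \<sigma> \<alpha> = \<alpha>" "\<alpha> \<noteq> 0"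
  shows "\<exists>\<beta>. w (to_ac \<beta>) = w \<alpha>"
proof -
  have \<alpha>I: "\<alpha> \<in> MI" using \<alpha> by (auto simp: MI_def)
  define \<Delta> where "\<Delta> = res decomp MI"
  define \<Xi> where "\<Xi> = res ac_auts MI"
  have dac: "decomp \<subseteq> ac_auts" using decomp_ac by blast
  have fin: "finite \<Delta>" "finite \<Xi>" unfolding \<Delta>_def \<Xi>_def using MI_subset_M dac by (auto intro: finite_res)
  have sub: "\<Delta> \<subseteq> \<Xi>" unfolding \<Delta>_def \<Xi>_def res_def using dac by blast
  note F = field_setD[OF field_set_MI]
  have \<Xi>D: "\<exists>\<sigma>\<in>ac_auts. \<forall>x\<in>MI. \<xi> x = \<sigma> x" if "\<xi> \<in> \<Xi>" for \<xi> using that by (auto simp: \<Xi>_def res_def)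
  have \<Delta>D: "\<exists>\<sigma>\<in>decomp. \<forall>x\<in>MI. \<xi> x = \<sigma> x" if "\<xi> \<in> \<Delta>" for \<xi> using that by (auto simp: \<Delta>_def res_def)
  have mult: "\<xi> (x * y) = \<xi> x * \<xi> y" if "\<xi> \<in> \<Xi>" "x \<in> MI" "y \<in> MI" for \<xi> x y
    using \<Xi>D[OF that(1)] that F by (auto simp: ac_auts_hom)
  have \<Delta>w: "w (\<xi> x) = w x" if "\<xi> \<in> \<Delta>" "x \<in> MI" for \<xi> x
    using \<Delta>D[OF that(1)] that MI_subset_M by (auto simp: decomp_w)
  \<comment> \<open>Dividing by \<alpha> makes the coefficient of the identity equal to 1, the very
    coefficient that independence would push below 1.\<close>
  have "\<exists>s\<in>MI. w s \<le> 1 \<and> w (\<Sum>\<xi>\<in>\<Delta>. \<xi> \<alpha> / \<alpha> * \<xi> s) \<ge> 1"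
  proof (rule ccontr)
    assume *: "\<not> ?thesis"
    let ?id = "restrict (\<lambda>x. x) MI"
    have id: "?id \<in> \<Delta>" using inertia_decomp[OF inertia_id] by (auto simp: \<Delta>_def res_def)
    have "w (?id \<alpha> / \<alpha>) < 1"
    proof (rule artin_independence_mod[where P = "{s\<in>MI. w s \<le> 1}" and c = "\<lambda>\<xi>. \<xi> \<alpha> / \<alpha>", OF fin(1) _ _ _ _ _ _ _ id])
      fix \<xi> assume c: "\<xi> \<in> \<Delta>"
      show "\<xi> 1 = 1" using \<Delta>D[OF c] F by (auto simp: ac_auts_hom decomp_ac)
      fix \<psi> assume "\<psi> \<in> \<Delta>" "\<xi> \<noteq> \<psi>"
      then obtain \<delta>1 \<delta>2 where d: "\<delta>1 \<in> decomp" "\<delta>2 \<in> decomp" "\<xi> = restrict \<delta>1 MI" "\<psi> = restrict \<delta>2 MI" "restrict \<delta>1 MI \<noteq> restrict \<delta>2 MI"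
        using c by (auto simp: \<Delta>_def res_def)
      from decomp_chars_distinct[OF d(1,2,5)] show "\<exists>s\<in>{s \<in> MI. w s \<le> 1}. 1 \<le> w (\<xi> s - \<psi> s)"
        unfolding d by auto
    qed (use * mult sub F \<Delta>w in \<open>auto simp: w_1 w_mult mult_le_one w_nonneg\<close>)
    then show False using \<alpha>I \<alpha>(3) by (simp add: w_1)
  qed
  then obtain s where s: "s \<in> MI" "w s \<le> 1" "w (\<Sum>\<xi>\<in>\<Delta>. \<xi> \<alpha> / \<alpha> * \<xi> s) \<ge> 1" by blast
  define y where "y = s * \<alpha>"
  have yI: "y \<in> MI" unfolding y_def using F s \<alpha>I by auto
  have w\<alpha>: "w \<alpha> > 0" using \<alpha> by (intro w_pos)
  have yle: "w y \<le> w \<alpha>" unfolding y_def using s w\<alpha> by (simp add: w_mult mult_left_le_one_le)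
  have "(\<Sum>\<xi>\<in>\<Delta>. \<xi> y) = \<alpha> * (\<Sum>\<xi>\<in>\<Delta>. \<xi> \<alpha> / \<alpha> * \<xi> s)"
    unfolding y_def sum_distrib_left using mult sub s \<alpha>I \<alpha>(3) by (intro sum.cong) (auto simp: mult.commute)
  then have "w (\<Sum>\<xi>\<in>\<Delta>. \<xi> y) \<ge> w \<alpha>" using s(3) w\<alpha> by (simp add: w_mult)
  moreover have "w (\<Sum>\<xi>\<in>\<Delta>. \<xi> y) \<le> w \<alpha>" using yle \<Delta>w yI w\<alpha> by (intro w_sum_le) auto
  ultimately have main: "w (\<Sum>\<xi>\<in>\<Delta>. \<xi> y) = w \<alpha>" by simp
  obtain e where e: "e \<in> MI" "\<And>\<delta>. \<delta> \<in> decomp \<Longrightarrow> w (\<delta> e - 1) < 1"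
    "\<And>\<sigma>. \<sigma> \<in> ac_auts - decomp \<Longrightarrow> w (\<sigma> e) < 1" using approximate_unit by blast
  have eN: "w (\<xi> e) < 1" if c: "\<xi> \<in> \<Xi> - \<Delta>" for \<xi>
  proof -
    obtain \<sigma> where "\<sigma> \<in> ac_auts" "\<xi> = restrict \<sigma> MI" using c by (auto simp: \<Xi>_def res_def)
    moreover from this have "\<sigma> \<notin> decomp" using c by (auto simp: \<Delta>_def res_def)
    ultimately show ?thesis using e by auto
  qed
  \<comment> \<open>The values of y at the other places are uncontrolled, so the exponent is chosen
    after y.\<close>
  have "\<forall>\<^sub>F n in sequentially. w (\<xi> y) * w (\<xi> e) ^ n < w \<alpha>" if "\<xi> \<in> \<Xi> - \<Delta>" for \<xi>
  proof -
    have "(\<lambda>n. w (\<xi> y) * w (\<xi> e) ^ n) \<longlonglongrightarrow> w (\<xi> y) * 0"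
      using eN[OF that] w_nonneg by (intro tendsto_mult tendsto_const LIMSEQ_realpow_zero)
    then show ?thesis using w\<alpha> by (intro order_tendstoD(2)) auto
  qed
  then have "\<forall>\<^sub>F n in sequentially. \<forall>\<xi>\<in>\<Xi> - \<Delta>. w (\<xi> y) * w (\<xi> e) ^ n < w \<alpha>"
    using fin by (intro eventually_ball_finite) auto
  then obtain n where n: "\<And>\<xi>. \<xi> \<in> \<Xi> - \<Delta> \<Longrightarrow> w (\<xi> y) * w (\<xi> e) ^ n < w \<alpha>"
    by (auto dest!: eventually_happens)
  define b where "b = (\<Sum>\<xi>\<in>\<Xi>. \<xi> (y * e ^ n))"
  have yeI: "y * e ^ n \<in> MI" using yI e F by auto
  have pw: "\<xi> (y * e ^ n) = \<xi> y * \<xi> e ^ n" if "\<xi> \<in> \<Xi>" for \<xi>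
    using \<Xi>D[OF that] yI e(1) yeI by (auto simp: ac_auts_hom)
  have "w (b - (\<Sum>\<xi>\<in>\<Delta>. \<xi> y)) < w \<alpha>"
  proof -
    have "b = (\<Sum>\<xi>\<in>\<Xi> - \<Delta>. \<xi> (y * e ^ n)) + (\<Sum>\<xi>\<in>\<Delta>. \<xi> (y * e ^ n))"
      unfolding b_def using sum.subset_diff[OF sub fin(2)] .
    then have eq: "b - (\<Sum>\<xi>\<in>\<Delta>. \<xi> y) = (\<Sum>\<xi>\<in>\<Xi> - \<Delta>. \<xi> (y * e ^ n)) + (\<Sum>\<xi>\<in>\<Delta>. \<xi> (y * e ^ n) - \<xi> y)"
      by (simp add: sum_subtractf)
    show ?thesis unfolding eq
    proof (intro w_add_less w_sum_less w\<alpha>)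
      fix \<xi> assume c: "\<xi> \<in> \<Xi> - \<Delta>"
      then show "w (\<xi> (y * e ^ n)) < w \<alpha>" using n[OF c] pw[of \<xi>] c by (simp add: w_mult w_power)
    next
      fix \<xi> assume c: "\<xi> \<in> \<Delta>"
      obtain \<delta> where d: "\<delta> \<in> decomp" "\<forall>x\<in>MI. \<xi> x = \<delta> x" using \<Delta>D[OF c] by blast
      have "w (\<xi> e - 1) < 1" using e d by auto
      then have "w ((\<Prod>i<n. \<xi> e) - 1) < 1" by (intro w_prod_near_1)
      then have "w (\<xi> e ^ n - 1) < 1" by simp
      moreover have "w (\<xi> y) \<le> w \<alpha>" using \<Delta>w[OF c yI] yle by simp
      ultimately have "w (\<xi> y) * w (\<xi> e ^ n - 1) < w \<alpha>"
        using mult_right_mono[of "w (\<xi> y)" "w \<alpha>" "w (\<xi> e ^ n - 1)"]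
          mult_strict_left_mono[of "w (\<xi> e ^ n - 1)" 1 "w \<alpha>"] w_nonneg[of "\<xi> e ^ n - 1"] w\<alpha> by linarith
      moreover have "\<xi> (y * e ^ n) - \<xi> y = \<xi> y * (\<xi> e ^ n - 1)"
        using pw[of \<xi>] sub c by (simp add: right_diff_distrib subset_iff)
      ultimately show "w (\<xi> (y * e ^ n) - \<xi> y) < w \<alpha>" by (simp only: w_mult)
    qed
  qed
  then have "w b = w \<alpha>" using w_close[of "\<Sum>\<xi>\<in>\<Delta>. \<xi> y" b] main by (simp add: w_diff_commute)
  have "b \<in> M" unfolding b_def
  proof (rule field_set_sum[OF field_set_M])
    fix \<xi> assume "\<xi> \<in> \<Xi>"
    from \<Xi>D[OF this] show "\<xi> (y * e ^ n) \<in> M" using yeI MI_subset_M by (auto simp: ac_auts_M)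
  qed
  \<comment> \<open>Separability is what turns invariance of the trace into membership in the base
    field.\<close>
  then have "separable_elem b" by (simp add: M_def)
  moreover have "\<sigma> b = b" if "\<sigma> \<in> ac_auts" for \<sigma>
    unfolding b_def \<Xi>_def
    by (rule res_sum_invariant(1)[OF order_refl MI_subset_M that ac_auts_comp[OF that] yeI])
  ultimately have "b \<in> range to_ac" by (rule separable_elem_fixed)
  then show ?thesis using \<open>w b = w \<alpha>\<close> by auto
qed

end

section \<open>Extending the adic absolute value\<close>

lemma poly_eq_sum_atMost:
  fixes q :: "'a::comm_ring_1 poly"
  assumes "degree q \<le> m"
  shows "poly q x = (\<Sum>i\<le>m. coeff q i * x ^ i)"
  unfolding poly_altdef using assms by (intro sum.mono_neutral_left) (auto simp: coeff_eq_0)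

text \<open>Chevalley's construction: a subring that is maximal among those omitting 1 / \<alpha>
  turns out to be a valuation ring in which \<alpha> is not invertible.\<close>

locale maximal_avoiding =
  fixes R :: "'a::field set" and \<alpha> :: 'a
  assumes R: "ring_set R" and \<alpha>: "\<alpha> \<in> R" "\<alpha> \<noteq> 0" and avoid: "inverse \<alpha> \<notin> R"
    and maximal: "ring_set S \<Longrightarrow> R \<subseteq> S \<Longrightarrow> inverse \<alpha> \<notin> S \<Longrightarrow> S = R"
begin

text \<open>With u = 1 - \<alpha> b, every power of u is again 1 minus a multiple of \<alpha>. If
  the localisation of \<open>R\<close> at u contained 1 / \<alpha>, clearing denominators would put
  1 / \<alpha> into \<open>R\<close>; so by maximality the localisation is \<open>R\<close>.\<close>

lemma one_minus_unit:
  assumes b: "b \<in> R"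
  shows "inverse (1 - \<alpha> * b) \<in> R" "1 - \<alpha> * b \<noteq> 0"
proof -
  let ?u = "1 - \<alpha> * b"
  note D = ring_setD[OF R]
  have uR: "?u \<in> R" using b \<alpha> D by auto
  show u0: "?u \<noteq> 0"
  proof
    assume "?u = 0" then have "inverse \<alpha> = b" using \<alpha> by (simp add: inverse_unique)
    then show False using avoid b by simp
  qed
  have up: "\<exists>c\<in>R. ?u ^ n = 1 - \<alpha> * c" for n
  proof (induction n)
    case 0 then show ?case using D by (intro bexI[of _ 0]) auto
  next
    case (Suc n)
    then obtain c where c: "c \<in> R" "?u ^ n = 1 - \<alpha> * c" by blast
    have "?u ^ Suc n = 1 - \<alpha> * (c + b - \<alpha> * b * c)" unfolding power_Suc c(2) by (simp add: algebra_simps)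
    moreover have "c + b - \<alpha> * b * c \<in> R" using b c \<alpha> D by auto
    ultimately show ?case by blast
  qed
  define S where "S = {r * inverse ?u ^ n | r n. r \<in> R}"
  have "ring_set S" unfolding ring_set_def
  proof (intro conjI ballI)
    show "1 \<in> S" unfolding S_def using D by (force intro: exI[of _ 1] exI[of _ 0])
    fix x y assume "x \<in> S" "y \<in> S"
    then obtain r s n m where x: "x = r * inverse ?u ^ n" "r \<in> R" and y: "y = s * inverse ?u ^ m" "s \<in> R"
      by (auto simp: S_def)
    have uk: "?u ^ k * inverse ?u ^ k = 1" for k using u0 by (metis power_mult_distrib power_one right_inverse)
    have "(r * ?u ^ m - s * ?u ^ n) * inverse ?u ^ (n + m) =
        r * inverse ?u ^ n * (?u ^ m * inverse ?u ^ m) - s * inverse ?u ^ m * (?u ^ n * inverse ?u ^ n)"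
      unfolding power_add left_diff_distrib by (simp only: mult_ac)
    then have "x - y = (r * ?u ^ m - s * ?u ^ n) * inverse ?u ^ (n + m)"
      unfolding uk x y by simp
    moreover have "r * ?u ^ m - s * ?u ^ n \<in> R" using x y uR D by auto
    ultimately show "x - y \<in> S" unfolding S_def by blast
    have "x * y = (r * s) * inverse ?u ^ (n + m)" using x y by (simp add: power_add)
    moreover have "r * s \<in> R" using x y D by auto
    ultimately show "x * y \<in> S" unfolding S_def by blast
  qed
  moreover have "R \<subseteq> S"
  proof
    fix r assume "r \<in> R" then show "r \<in> S" unfolding S_def by (intro CollectI exI[of _ r] exI[of _ 0]) auto
  qed
  moreover have "inverse \<alpha> \<notin> S"
  proof
    assume "inverse \<alpha> \<in> S"
    then obtain r n where r: "inverse \<alpha> = r * inverse ?u ^ n" "r \<in> R" by (auto simp: S_def)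
    obtain c where c: "c \<in> R" "?u ^ n = 1 - \<alpha> * c" using up by blast
    have "?u ^ n = \<alpha> * r" using r(1) u0 \<alpha> by (simp add: field_simps power_inverse)
    then have "\<alpha> * (r + c) = 1" using c by (simp add: algebra_simps)
    then have "inverse \<alpha> = r + c" by (rule inverse_unique)
    then show False using avoid r c D by auto
  qed
  ultimately have "S = R" by (rule maximal)
  moreover have "inverse ?u \<in> S" unfolding S_def using D(1) by (intro CollectI exI[of _ 1] exI[of _ 1]) auto
  ultimately show "inverse ?u \<in> R" by simp
qed

text \<open>\<open>inverse \<alpha> \<in> R[x]\<close>, witnessed in degree at most \<open>n\<close>. If both \<open>x\<close> and \<open>inverse x\<close> were
  outside \<open>R\<close>, the two minimal degrees could be played against each other.\<close>

definition reaches :: "'a \<Rightarrow> nat \<Rightarrow> bool" where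
  "reaches x n \<longleftrightarrow> (\<exists>p\<in>polys_over R. degree p \<le> n \<and> \<alpha> * poly p x = 1)"

lemma not_reaches_0: "\<not> reaches x 0"
proof
  assume "reaches x 0"
  then obtain p where p: "p \<in> polys_over R" "degree p = 0" "\<alpha> * poly p x = 1" by (auto simp: reaches_def)
  then obtain c where "p = [:c:]" using degree_eq_zeroE by blast
  then have "c \<in> R" "\<alpha> * c = 1" using p polys_overD[OF p(1), of 0] by auto
  then show False using avoid inverse_unique by metis
qed

text \<open>Multiplying the relation for 1 / x by x^m and inverting 1 - \<alpha> c_0 expresses x^m
  through lower powers of x. Substituting this in the top term x^n of the other relation lowers its
  degree.\<close>

lemma reaches_reduce:
  assumes n: "reaches x n" and m: "reaches (inverse x) m" and le: "m \<le> n" and x: "x \<noteq> 0"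
  shows "reaches x (n - 1)"
proof -
  note D = ring_setD[OF R]
  note P = polys_over_diff[OF R] polys_over_add[OF R] polys_over_mult[OF R] polys_over_monom[OF R]
    polys_over_const[OF R]
  have m0: "m \<noteq> 0" using m not_reaches_0 by metis
  obtain p where p: "p \<in> polys_over R" "degree p \<le> n" "\<alpha> * poly p x = 1" using n by (auto simp: reaches_def)
  obtain q where q: "q \<in> polys_over R" "degree q \<le> m" "\<alpha> * poly q (inverse x) = 1"
    using m by (auto simp: reaches_def)
  define c where "c = coeff q"
  have cR: "c i \<in> R" for i unfolding c_def using polys_overD[OF q(1)] .
  let ?u = "1 - \<alpha> * c 0"
  have u: "inverse ?u \<in> R" "?u \<noteq> 0" using one_minus_unit cR by auto
  have "poly q (inverse x) = (\<Sum>i\<le>m. c i * inverse x ^ i)"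
    unfolding c_def using q(2) by (rule poly_eq_sum_atMost)
  moreover have "x ^ m = \<alpha> * poly q (inverse x) * x ^ m" using q(3) by simp
  ultimately have "x ^ m = \<alpha> * (\<Sum>i\<le>m. c i * (inverse x ^ i * x ^ m))"
    by (simp add: sum_distrib_right mult.assoc)
  also have "(\<Sum>i\<le>m. c i * (inverse x ^ i * x ^ m)) = (\<Sum>i\<le>m. c i * x ^ (m - i))"
    using x by (intro sum.cong refl) (simp add: power_diff field_simps power_inverse)
  also have "\<dots> = c 0 * x ^ m + (\<Sum>i=1..m. c i * x ^ (m - i))"
    by (simp add: atMost_atLeast0 sum.atLeast_Suc_atMost)
  finally have "?u * x ^ m = \<alpha> * (\<Sum>i=1..m. c i * x ^ (m - i))" by (simp add: algebra_simps)
  then have xm: "x ^ m = inverse ?u * \<alpha> * (\<Sum>i=1..m. c i * x ^ (m - i))"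
    using u(2) by (simp add: field_simps)
  define g where "g = (\<Sum>i=1..m. monom (inverse ?u * \<alpha> * c i) (m - i))"
  have gx: "poly g x = x ^ m" unfolding xm g_def by (simp add: poly_sum poly_monom sum_distrib_left mult.assoc)
  have gR: "g \<in> polys_over R" unfolding g_def
  proof (rule polys_overI)
    fix j show "coeff (\<Sum>i=1..m. monom (inverse ?u * \<alpha> * c i) (m - i)) j \<in> R"
      unfolding coeff_sum using u cR \<alpha> D by (intro ring_set_sum[OF R]) (auto simp: coeff_monom)
  qed
  have gd: "degree g < m"
    unfolding g_def using m0 by (intro degree_sum_less) (auto intro: le_less_trans[OF Polynomial.degree_monom_le])
  define p' where "p' = p - monom (coeff p n) n + monom (coeff p n) (n - m) * g"
  have "poly p' x = poly p x"
    using le by (simp add: p'_def poly_monom gx mult.assoc flip: power_add)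
  moreover have "p' \<in> polys_over R" unfolding p'_def using p q gR polys_overD[OF p(1)] by (intro P) auto
  moreover have "degree p' \<le> n - 1"
    unfolding p'_def
  proof (rule degree_add_le)
    show "degree (p - monom (coeff p n) n) \<le> n - 1"
    proof (rule degree_le, intro allI impI)
      fix i assume "n - 1 < i"
      then show "coeff (p - monom (coeff p n) n) i = 0"
        using p(2) m0 le by (cases "i = n") (auto simp: coeff_monom intro: coeff_eq_0)
    qed
    have "degree (monom (coeff p n) (n - m) * g) \<le> (n - m) + degree g"
      by (intro order_trans[OF degree_mult_le] add_right_mono Polynomial.degree_monom_le)
    then show "degree (monom (coeff p n) (n - m) * g) \<le> n - 1" using gd le by linarith
  qed
  ultimately show ?thesis using p(3) by (auto simp: reaches_def)
qed

text \<open>R[x] is strictly larger than \<open>R\<close>, so maximality forces 1 / \<alpha> into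
  it.\<close>

lemma not_mem_reaches:
  assumes "x \<notin> R" shows "\<exists>n. reaches x n"
proof -
  note D = ring_setD[OF R]
  note P = polys_over_diff[OF R] polys_over_add[OF R] polys_over_mult[OF R] polys_over_monom[OF R]
    polys_over_const[OF R]
  define S where "S = (\<lambda>p. poly p x) ` polys_over R"
  have "ring_set S" unfolding ring_set_def S_def
    using P D(1) by (auto simp flip: poly_diff poly_mult intro!: image_eqI[of 1 _ "[:1:]"])
  moreover have "R \<subseteq> S" unfolding S_def using P(5) by (auto intro!: image_eqI[of _ _ "[:_:]"])
  moreover have "x \<in> S" unfolding S_def using D by (intro image_eqI[of _ _ "[:0,1:]"]) (auto simp: polys_over_def coeff_pCons split: nat.splits)
  ultimately have "inverse \<alpha> \<in> S" using maximal assms by blast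
  then obtain p where "p \<in> polys_over R" "inverse \<alpha> = poly p x" by (auto simp: S_def)
  moreover from this have "\<alpha> * poly p x = 1" using \<alpha> by (metis right_inverse)
  ultimately show ?thesis unfolding reaches_def by blast
qed

lemma valuation_ring: "x \<in> R \<or> inverse x \<in> R"
proof (rule ccontr)
  assume n: "\<not> ?thesis"
  then have x: "x \<noteq> 0" using ring_setD[OF R] by auto
  define a where "a = (LEAST n. reaches x n)"
  define b where "b = (LEAST n. reaches (inverse x) n)"
  have a: "reaches x a" unfolding a_def using not_mem_reaches n by (metis LeastI_ex)
  have b: "reaches (inverse x) b" unfolding b_def using not_mem_reaches n by (metis LeastI_ex)
  have ab: "a \<noteq> 0" "b \<noteq> 0" using a b not_reaches_0 by metis+
  show False
  proof (cases "b \<le> a")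
    case True
    then have "a \<le> a - 1" unfolding a_def using reaches_reduce[OF a b _ x] by (metis Least_le a_def)
    then show False using ab by simp
  next
    case False
    then have "b \<le> b - 1" unfolding b_def
      using reaches_reduce[of "inverse x" b a] a b x by (metis Least_le b_def inverse_inverse_eq inverse_zero_imp_zero nat_le_linear)
    then show False using ab by simp
  qed
qed

section \<open>From the valuation ring to an absolute value\<close>

definition is_unit_in :: "'a \<Rightarrow> bool" where
  "is_unit_in u \<longleftrightarrow> u \<noteq> 0 \<and> u \<in> R \<and> inverse u \<in> R"

lemma is_unit_in_mult: "is_unit_in u \<Longrightarrow> is_unit_in v \<Longrightarrow> is_unit_in (u * v)"
  and is_unit_in_inverse: "is_unit_in u \<Longrightarrow> is_unit_in (inverse u)"
  and is_unit_in_1: "is_unit_in 1"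
  using ring_setD[OF R] by (auto simp: is_unit_in_def)

lemma is_unit_in_power: "is_unit_in u \<Longrightarrow> is_unit_in (u ^ n)"
  by (induction n) (auto simp: is_unit_in_mult is_unit_in_1)

text \<open>One of x / y and y / x is in \<open>R\<close>, say x / y. If x + y were a unit, then 1 /
  y = (x / y + 1) / (x + y) would lie in \<open>R\<close>, and y would be a unit.\<close>

lemma nonunit_sum:
  assumes "finite S" "\<And>i. i \<in> S \<Longrightarrow> f i \<in> R \<and> \<not> is_unit_in (f i)"
  shows "sum f S \<in> R \<and> \<not> is_unit_in (sum f S)"
  using assms
proof (induction S rule: finite_induct)
  case empty then show ?case using ring_setD[OF R] by (auto simp: is_unit_in_def)
next
  case (insert i S)
  have *: "\<not> is_unit_in (x + y)"
    if x: "x \<in> R" "\<not> is_unit_in x" and y: "y \<in> R" "y \<noteq> 0" and xy: "x / y \<in> R" "\<not> is_unit_in y" for x y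
  proof
    assume u: "is_unit_in (x + y)"
    have "(x / y + 1) * inverse (x + y) \<in> R" using u xy ring_setD[OF R] by (auto simp: is_unit_in_def)
    moreover have "(x / y + 1) * inverse (x + y) = inverse y"
      using u y by (simp add: is_unit_in_def field_simps)
    ultimately show False using xy y by (simp add: is_unit_in_def)
  qed
  let ?x = "f i" and ?y = "sum f S"
  have xy: "?x \<in> R" "\<not> is_unit_in ?x" "?y \<in> R" "\<not> is_unit_in ?y" using insert by auto
  have "\<not> is_unit_in (?x + ?y)"
  proof (cases "?x = 0 \<or> ?y = 0")
    case False
    have "?x / ?y \<in> R \<or> ?y / ?x \<in> R" using valuation_ring[of "?x / ?y"] by (simp add: inverse_eq_divide)
    then show ?thesis using *[of ?x ?y] *[of ?y ?x] xy False by (auto simp: add.commute)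
  qed (use xy in auto)
  then show ?case using xy insert.hyps ring_setD[OF R] by auto
qed

text \<open>Where terms cancel, the largest cannot be alone: after division by it, the others would
  be nonunits with sum -1. Applied to the terms of a polynomial equation, this yields the value of
  its root.\<close>

lemma equal_terms:
  assumes fin: "finite S" and ne: "\<exists>i\<in>S. t i \<noteq> 0" and sum0: "sum t S = 0"
  shows "\<exists>i\<in>S. \<exists>j\<in>S. i \<noteq> j \<and> t i \<noteq> 0 \<and> t j \<noteq> 0 \<and> is_unit_in (t i / t j)"
proof (rule ccontr)
  assume n: "\<not> ?thesis"
  have "\<exists>k\<in>S'. \<forall>i\<in>S'. t i / t k \<in> R" if "finite S'" "S' \<noteq> {}" "\<forall>i\<in>S'. t i \<noteq> 0" for S'
    using that
  proof (induction S' rule: finite_ne_induct)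
    case (insert j S')
    then obtain k where k: "k \<in> S'" "\<forall>i\<in>S'. t i / t k \<in> R" by auto
    show ?case
    proof (cases "t j / t k \<in> R")
      case False
      then have kj: "t k / t j \<in> R" using valuation_ring[of "t j / t k"] by (simp add: inverse_eq_divide)
      have "t i / t j \<in> R" if "i \<in> S'" for i
      proof -
        have eq: "t i / t j = (t i / t k) * (t k / t j)" using insert.prems k(1) by simp
        show ?thesis unfolding eq using k that kj ring_setD(4)[OF R] by blast
      qed
      then show ?thesis using insert.prems ring_setD(1)[OF R] by (intro bexI[of _ j]) auto
    qed (use k in auto)
  qed (use ring_setD[OF R] in auto)
  note max = this
  have "\<exists>k\<in>{i\<in>S. t i \<noteq> 0}. \<forall>i\<in>{i\<in>S. t i \<noteq> 0}. t i / t k \<in> R"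
    by (rule max) (use fin ne in auto)
  then obtain k where k: "k \<in> S" "t k \<noteq> 0" "\<And>i. i \<in> S \<Longrightarrow> t i \<noteq> 0 \<Longrightarrow> t i / t k \<in> R"
    by blast
  have "(\<Sum>i\<in>S - {k}. t i / t k) \<in> R \<and> \<not> is_unit_in (\<Sum>i\<in>S - {k}. t i / t k)"
  proof (rule nonunit_sum)
    fix i assume i: "i \<in> S - {k}"
    show "t i / t k \<in> R \<and> \<not> is_unit_in (t i / t k)"
    proof (cases "t i = 0")
      case True then show ?thesis using ring_setD[OF R] by (simp add: is_unit_in_def)
    next
      case False then show ?thesis using i k(1,2) k(3)[of i] n by blast
    qed
  qed (use fin in auto)
  moreover have "(\<Sum>i\<in>S - {k}. t i / t k) = - 1"
  proof -
    have "t k + sum t (S - {k}) = 0" using sum0 fin k(1) by (simp add: sum.remove)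
    then have "sum t (S - {k}) = - t k" by (simp add: eq_neg_iff_add_eq_0 add.commute)
    then show ?thesis using k(2) by (simp flip: sum_divide_distrib)
  qed
  ultimately show False using ring_setD[OF R] by (auto simp: is_unit_in_def)
qed

text \<open>The valuation of x is m / n when that of \<alpha> is 1, said without real numbers: x^n
  and \<alpha>^m differ by a unit.\<close>

definition has_value :: "'a \<Rightarrow> nat \<Rightarrow> int \<Rightarrow> bool" where
  "has_value x n m \<longleftrightarrow> n > 0 \<and> is_unit_in (x ^ n * \<alpha> powi (- m))"

lemma has_value_mult:
  assumes "has_value x n m" "has_value y n' m'"
  shows "has_value (x * y) (n * n') (m * n' + m' * n)"
proof -
  have "is_unit_in ((x ^ n * \<alpha> powi (- m)) ^ n' * (y ^ n' * \<alpha> powi (- m')) ^ n)"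
    using assms by (intro is_unit_in_mult[OF is_unit_in_power is_unit_in_power]) (auto simp: has_value_def)
  also have "(x ^ n * \<alpha> powi (- m)) ^ n' * (y ^ n' * \<alpha> powi (- m')) ^ n =
     (x * y) ^ (n * n') * (\<alpha> powi (- m * int n') * \<alpha> powi (- m' * int n))"
    by (simp only: power_mult_distrib power_int_mult power_int_of_nat power_mult[symmetric] mult_ac)
  also have "\<alpha> powi (- m * int n') * \<alpha> powi (- m' * int n) = \<alpha> powi (- (m * n' + m' * n))"
    using \<alpha> by (simp flip: power_int_add)
  finally show ?thesis using assms by (simp add: has_value_def)
qed

lemma has_value_nonneg:
  assumes "has_value x n m"
  shows "m \<ge> 0 \<longleftrightarrow> x \<in> R"
proof -
  note D = ring_setD[OF R]
  let ?u = "x ^ n * \<alpha> powi (- m)"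
  have u: "is_unit_in ?u" and n: "n > 0" using assms by (auto simp: has_value_def)
  have x0: "x \<noteq> 0" using u n by (auto simp: is_unit_in_def)
  have xn: "x ^ n = ?u * \<alpha> powi m" using \<alpha> by (simp add: power_int_minus)
  show ?thesis
  proof
    assume "m \<ge> 0"
    then have "\<alpha> powi m \<in> R" using \<alpha> D by (simp add: power_int_def)
    moreover have "?u \<in> R" using u by (simp add: is_unit_in_def)
    ultimately have xnR: "x ^ n \<in> R" by (subst xn) (rule D(4))
    show "x \<in> R"
    proof (rule ccontr)
      assume "x \<notin> R"
      then have "inverse x ^ (n - 1) * x ^ n \<in> R" using valuation_ring[of x] xnR D by auto
      also have "inverse x ^ (n - 1) * x ^ n = x" using x0 n by (cases n) (auto simp: field_simps)
      finally show False using \<open>x \<notin> R\<close> by simp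
    qed
  next
    assume x: "x \<in> R"
    show "m \<ge> 0"
    proof (rule ccontr)
      assume "\<not> m \<ge> 0"
      then have "- m - 1 \<ge> 0" by simp
      then have "\<alpha> powi (- m - 1) \<in> R" using \<alpha> D by (simp add: power_int_def)
      then have "inverse ?u * x ^ n * \<alpha> powi (- m - 1) \<in> R" using x u D by (auto simp: is_unit_in_def)
      also have "inverse ?u * x ^ n * \<alpha> powi (- m - 1) = inverse \<alpha>"
        using x0 \<alpha> by (simp add: power_int_diff field_simps)
      finally show False using avoid by simp
    qed
  qed
qed

lemma has_value_inverse: "has_value x n m \<Longrightarrow> has_value (inverse x) n (- m)"
  using is_unit_in_inverse[of "x ^ n * \<alpha> powi (- m)"]
  by (simp add: has_value_def power_inverse power_int_minus)

lemma has_value_unique: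
  assumes "has_value x n m" "has_value x n' m'"
  shows "m * int n' = m' * int n"
proof -
  have x0: "x \<noteq> 0" using assms by (auto simp: has_value_def is_unit_in_def)
  have *: "a * int d \<le> b * int c" if "has_value x c a" "has_value x d b" for a b c d
    using has_value_nonneg[OF has_value_mult[OF has_value_inverse[OF that(1)] that(2)]] x0 ring_setD[OF R]
    by (simp add: algebra_simps)
  show ?thesis using *[OF assms] *[OF assms(2,1)] by simp
qed

text \<open>This is 2 to the power of minus the valuation; the base 2 is a normalisation that gives
  \<alpha> the value 1/2.\<close>

definition w :: "'a \<Rightarrow> real" where
  "w x = (if x = 0 then 0 else
     (let (n, m) = SOME (n, m). has_value x n m in 2 powr (- real_of_int m / real n)))"

lemma w_eqI:
  assumes "has_value x n m" shows "w x = 2 powr (- real_of_int m / real n)"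
proof -
  define p where "p = (SOME (n, m). has_value x n m)"
  have p: "case p of (n, m) \<Rightarrow> has_value x n m" unfolding p_def by (rule someI[of _ "(n, m)"]) (use assms in simp)
  obtain n' m' where nm: "p = (n', m')" by (cases p)
  then have h: "has_value x n' m'" using p by simp
  have "m * int n' = m' * int n" using has_value_unique[OF assms h] .
  then have "real_of_int m * real n' = real_of_int m' * real n" by (metis of_int_mult of_int_of_nat_eq)
  then have "real_of_int m / real n = real_of_int m' / real n'"
    using assms h by (simp add: has_value_def field_simps)
  moreover have "x \<noteq> 0" using assms by (auto simp: has_value_def is_unit_in_def)
  ultimately show ?thesis unfolding w_def p_def[symmetric] nm by simp
qed

text \<open>The hypothesis \<open>total\<close> says that the valuation takes rational values, so it
  embeds into the reals. The ultrametric inequality follows after division by the larger argument,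
  because w x \<le> 1 describes \<open>R\<close>.\<close>

lemma nonarch_w:
  assumes total: "\<And>x. x \<noteq> 0 \<Longrightarrow> \<exists>n m. has_value x n m"
  shows "nonarch w"
proof -
  have pos: "w x > 0" if "x \<noteq> 0" for x using total[OF that] w_eqI[of x] by auto
  have mult: "w (x * y) = w x * w y" for x y
  proof (cases "x = 0 \<or> y = 0")
    case False
    then obtain n m n' m' where h: "has_value x n m" "has_value y n' m'" using total by metis
    then have n: "n > 0" "n' > 0" by (auto simp: has_value_def)
    have "- real_of_int (m * n' + m' * n) / real (n * n') = - real_of_int m / n + - real_of_int m' / n'"
      using n by (simp add: field_simps)
    then show ?thesis unfolding w_eqI[OF h(1)] w_eqI[OF h(2)] w_eqI[OF has_value_mult[OF h]]
      by (simp only: powr_add)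
  qed (auto simp: w_def)
  have le1: "w x \<le> 1 \<longleftrightarrow> x \<in> R" for x
  proof (cases "x = 0")
    case False
    then obtain n m where h: "has_value x n m" using total by metis
    then have "n > 0" by (auto simp: has_value_def)
    then have "w x \<le> 1 \<longleftrightarrow> m \<ge> 0" unfolding w_eqI[OF h]
      using powr_le_cancel_iff[of 2 "- real_of_int m / real n" 0] by (simp add: zero_le_divide_iff)
    then show ?thesis using has_value_nonneg[OF h] by simp
  qed (use ring_setD[OF R] in \<open>auto simp: w_def\<close>)
  have add: "w (x + y) \<le> w y" if "w x \<le> w y" for x y
  proof (cases "y = 0")
    case True
    then have "x = 0" using that pos[of x] by (auto simp: w_def[of 0] not_less)
    then show ?thesis using True by simp
  next
    case False
    have "w (x / y) * w y = w x" using False by (simp flip: mult)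
    then have "w (x / y) * w y \<le> 1 * w y" using that by simp
    then have "w (x / y) \<le> 1" using pos[OF False] by (rule mult_right_le_imp_le)
    then have "w (x / y + 1) \<le> 1" using le1 ring_setD[OF R] by auto
    then have "w y * w (x / y + 1) \<le> w y" using pos[OF False] by simp
    also have "w y * w (x / y + 1) = w (y * (x / y + 1))" by (rule mult[symmetric])
    also have "y * (x / y + 1) = x + y" using False by (simp add: distrib_left)
    finally show ?thesis .
  qed
  show ?thesis
  proof
    show "w x = 0 \<longleftrightarrow> x = 0" "w x \<ge> 0" for x using pos[of x] by (cases "x = 0"; simp add: w_def[of 0])+
    show "w (x * y) = w x * w y" for x y by (rule mult)
    show "w (x + y) \<le> max (w x) (w y)" for x y
      using add[of x y] add[of y x] by (cases "w x \<le> w y") (auto simp: add.commute)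
  qed
qed

end

lemma maximal_avoiding_exists:
  fixes \<alpha> :: "'a::field"
  assumes A: "ring_set A" "\<alpha> \<in> A" "\<alpha> \<noteq> 0" "inverse \<alpha> \<notin> A"
  shows "\<exists>R. maximal_avoiding R \<alpha> \<and> A \<subseteq> R"
proof -
  define F where "F = {R. ring_set R \<and> A \<subseteq> R \<and> inverse \<alpha> \<notin> R}"
  have "\<exists>R\<in>F. \<forall>S\<in>F. R \<subseteq> S \<longrightarrow> S = R"
  proof (rule subset_Zorn_nonempty)
    show "F \<noteq> {}" using A by (auto simp: F_def)
    fix C assume C: "C \<noteq> {}" "subset.chain F C"
    have C1: "ring_set R" "A \<subseteq> R" "inverse \<alpha> \<notin> R" if "R \<in> C" for R
      using C that by (auto simp: subset_chain_def F_def)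
    have two: "\<exists>R\<in>C. x \<in> R \<and> y \<in> R" if xy: "x \<in> \<Union>C" "y \<in> \<Union>C" for x y
    proof -
      obtain R S where RS: "R \<in> C" "S \<in> C" "x \<in> R" "y \<in> S" using xy by blast
      then have "R \<subseteq> S \<or> S \<subseteq> R" using C by (simp add: subset_chain_def)
      then show ?thesis using RS by blast
    qed
    have "ring_set (\<Union>C)" unfolding ring_set_def
    proof (intro conjI ballI)
      show "1 \<in> \<Union>C" using C C1 ring_setD(1) by blast
      fix x y assume xy: "x \<in> \<Union>C" "y \<in> \<Union>C"
      obtain R where R: "R \<in> C" "x \<in> R" "y \<in> R" using two[OF xy] by blast
      then show "x - y \<in> \<Union>C" "x * y \<in> \<Union>C" using ring_setD(3,4)[OF C1(1)[OF R(1)]] by blast+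
    qed
    then show "\<Union>C \<in> F" unfolding F_def using C C1 by blast
  qed
  then obtain R where R: "R \<in> F" "\<And>S. S \<in> F \<Longrightarrow> R \<subseteq> S \<Longrightarrow> S = R" by blast
  have "maximal_avoiding R \<alpha>"
  proof
    fix S assume "ring_set S" "R \<subseteq> S" "inverse \<alpha> \<notin> S"
    then show "S = R" using R by (auto simp: F_def)
  qed (use R A in \<open>auto simp: F_def\<close>)
  then show ?thesis using R by (auto simp: F_def)
qed

section \<open>The adic absolute value of an irreducible polynomial\<close>

lemma poly_bezout_irreducible:
  fixes a b :: "'k::field poly"
  assumes a: "irreducible a" and b: "\<not> a dvd b"
  shows "\<exists>s t. s * b + t * a = 1"
proof -
  define P where "P n \<longleftrightarrow> (\<exists>s t. s * b + t * a \<noteq> 0 \<and> degree (s * b + t * a) = n)" for n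
  have "a \<noteq> 0" using a by auto
  then have "P (degree a)" unfolding P_def by (intro exI[of _ 0] exI[of _ 1]) auto
  then have "P (Least P)" by (rule LeastI)
  then obtain s t where st: "s * b + t * a \<noteq> 0" "degree (s * b + t * a) = Least P" by (auto simp: P_def)
  define d where "d = s * b + t * a"
  have dvd: "d dvd x * b + y * a" for x y
  proof (rule ccontr)
    assume n: "\<not> d dvd x * b + y * a"
    let ?r = "(x * b + y * a) mod d"
    have "?r \<noteq> 0" using n by (simp add: dvd_eq_mod_eq_0)
    have "?r = x * b + y * a - (x * b + y * a) div d * d" by (simp add: minus_div_mult_eq_mod)
    also have "\<dots> = (x - (x * b + y * a) div d * s) * b + (y - (x * b + y * a) div d * t) * a"
      by (simp add: d_def algebra_simps)
    finally have "P (degree ?r)" unfolding P_def using \<open>?r \<noteq> 0\<close> by metis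
    then have "Least P \<le> degree ?r" by (rule Least_le)
    moreover have "degree ?r < degree d"
      using degree_mod_less[of d "x * b + y * a"] st \<open>?r \<noteq> 0\<close> by (auto simp: d_def)
    ultimately show False using st by (simp add: d_def)
  qed
  have "d dvd a" "d dvd b" using dvd[of 0 1] dvd[of 1 0] by simp_all
  then have "d dvd 1" using a b by (metis dvd_trans irreducibleD')
  then obtain c where "1 = d * c" by (rule dvdE)
  then have "(c * s) * b + (c * t) * a = 1" by (simp add: d_def algebra_simps)
  then show ?thesis by blast
qed

lemma poly_factor_out:
  fixes a b :: "'k::field poly"
  assumes a: "irreducible a" and b: "b \<noteq> 0"
  shows "\<exists>j c. b = a ^ j * c \<and> \<not> a dvd c"
  using b
proof (induction "degree b" arbitrary: b rule: less_induct)
  case less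
  show ?case
  proof (cases "a dvd b")
    case False
    then show ?thesis by (intro exI[of _ 0] exI[of _ b]) auto
  next
    case True
    then obtain c where c: "b = a * c" by (rule dvdE)
    then have "c \<noteq> 0" "a \<noteq> 0" using less.prems by auto
    moreover have "degree a > 0" using a \<open>a \<noteq> 0\<close> by (auto simp: irreducible_def is_unit_iff_degree)
    ultimately have "degree c < degree b" by (simp add: c degree_mult_eq)
    from less.hyps[OF this \<open>c \<noteq> 0\<close>] obtain j c' where "c = a ^ j * c'" "\<not> a dvd c'" by blast
    then show ?thesis using c by (intro exI[of _ "Suc j"] exI[of _ c']) auto
  qed
qed

abbreviation of_A :: "'k::field poly \<Rightarrow> 'k poly fract alg_closure" where
  "of_A b \<equiv> to_ac (to_fract b)"

text \<open>The valuation ring is chosen to contain A. Algebraic elements have rational values: two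
  terms of a polynomial equation for x have equal size, so a positive power of x differs by a unit
  from a quotient of coefficients, which has an integral value.\<close>

theorem adic_extension:
  fixes a :: "'k::field poly"
  assumes a: "irreducible a"
  shows "\<exists>w. nonarch w \<and> w (of_A a) = 1/2 \<and> (\<forall>b. w (of_A b) \<le> 1) \<and> (\<forall>b. \<not> a dvd b \<longrightarrow> w (of_A b) = 1)"
proof -
  define \<alpha> where "\<alpha> = of_A a"
  have a0: "a \<noteq> 0" and nu: "\<not> a dvd 1" using a by (auto simp: irreducible_def)
  have \<alpha>0: "\<alpha> \<noteq> 0" using a0 by (simp add: \<alpha>_def)
  have "\<exists>R. maximal_avoiding R \<alpha> \<and> range of_A \<subseteq> R"
  proof (rule maximal_avoiding_exists)
    show "ring_set (range (of_A :: 'k poly \<Rightarrow> _))"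
      unfolding ring_set_def by (auto simp flip: to_ac_diff to_ac_mult to_fract_diff to_fract_mult to_fract_1 to_ac_1)
    show "inverse \<alpha> \<notin> range of_A"
    proof
      assume "inverse \<alpha> \<in> range of_A"
      then obtain b where "inverse \<alpha> = of_A b" by auto
      then have "of_A a * of_A b = 1" using right_inverse[OF \<alpha>0] by (simp add: \<alpha>_def)
      then have "of_A (a * b) = of_A 1" by simp
      then have "a * b = 1" by (simp only: to_ac_eq_iff to_fract_eq_iff)
      then show False using nu by (metis dvd_triv_left)
    qed
  qed (auto simp: \<alpha>_def a0)
  then obtain R where "maximal_avoiding R \<alpha>" and A: "range of_A \<subseteq> R" by blast
  then interpret maximal_avoiding R \<alpha> by simp
  \<comment> \<open>From s b + t a = 1, the product s b is 1 minus a multiple of \<alpha>, hence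
    invertible in \<open>R\<close>.\<close>
  have unit: "is_unit_in (of_A b)" if b: "\<not> a dvd b" for b
  proof -
    obtain s t where st: "s * b + t * a = 1" using poly_bezout_irreducible[OF a b] by blast
    then have eq: "of_A s * of_A b = 1 - \<alpha> * of_A t"
      unfolding \<alpha>_def by (simp add: algebra_simps flip: to_ac_diff to_ac_mult to_fract_diff to_fract_mult to_fract_1 to_ac_1)
    have "of_A t \<in> R" "of_A s \<in> R" "of_A b \<in> R" using A by auto
    then have "of_A s * inverse (1 - \<alpha> * of_A t) \<in> R" using one_minus_unit ring_setD[OF R] by auto
    moreover have "of_A b * (of_A s * inverse (1 - \<alpha> * of_A t)) = 1"
      using one_minus_unit(2)[OF \<open>of_A t \<in> R\<close>] eq by (metis mult.commute mult.assoc right_inverse)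
    ultimately have "inverse (of_A b) \<in> R" by (metis inverse_unique)
    then show ?thesis using \<open>of_A b \<in> R\<close> b by (auto simp: is_unit_in_def)
  qed
  have F_value: "\<exists>m::int. is_unit_in (to_ac f * \<alpha> powi (- m))" if "f \<noteq> 0" for f :: "'k poly fract"
  proof -
    obtain b c where f: "f = to_fract b / to_fract c" "c \<noteq> 0"
      by (metis Fract_conv_to_fract Fract_cases)
    then have "b \<noteq> 0" using that by auto
    obtain j b' where b': "b = a ^ j * b'" "\<not> a dvd b'" using poly_factor_out[OF a \<open>b \<noteq> 0\<close>] by blast
    obtain i c' where c': "c = a ^ i * c'" "\<not> a dvd c'" using poly_factor_out[OF a f(2)] by blast
    have pw: "of_A (a ^ n) = \<alpha> ^ n" for n
      by (induction n) (auto simp: \<alpha>_def)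
    have "to_ac f = (\<alpha> ^ j / \<alpha> ^ i) * (of_A b' * inverse (of_A c'))"
      unfolding f b' c' by (simp add: pw divide_inverse)
    also have "\<alpha> ^ j / \<alpha> ^ i = \<alpha> powi (int j - int i)" using \<alpha>0 by (simp add: power_int_diff)
    finally have "to_ac f * \<alpha> powi (- (int j - int i)) = of_A b' * inverse (of_A c')"
      using \<alpha>0 power_int_add[of \<alpha> "int j - int i" "- (int j - int i)"] by (simp only:) simp
    then show ?thesis using unit b' c' is_unit_in_mult is_unit_in_inverse by metis
  qed
  have total: "\<exists>n m. has_value x n m" if x: "x \<noteq> 0" for x
  proof -
    obtain p where p: "p \<noteq> 0" "poly (map_poly to_ac p) x = 0" by (rule alg_closure_algebraic)
    define t where "t i = to_ac (coeff p i) * x ^ i" for i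
    have "sum t {..Polynomial.degree p} = 0"
      using p(2) by (simp add: t_def poly_altdef degree_map_poly coeff_map_poly)
    moreover have "\<exists>i\<in>{..Polynomial.degree p}. t i \<noteq> 0"
      using p x by (intro bexI[of _ "degree p"]) (auto simp: t_def)
    ultimately obtain i j where ij: "i \<noteq> j" "t i \<noteq> 0" "t j \<noteq> 0" "is_unit_in (t i / t j)"
      using equal_terms[of "{..Polynomial.degree p}" t] by auto
    have *: "\<exists>n m. has_value x n m" if "i < j" "t i \<noteq> 0" "t j \<noteq> 0" "is_unit_in (t j / t i)" for i j
    proof -
      define f where "f = coeff p j / coeff p i"
      have "f \<noteq> 0" using that by (auto simp: f_def t_def)
      then obtain m where m: "is_unit_in (to_ac f * \<alpha> powi (- m))" using F_value by blast
      have "t j / t i = to_ac f * x ^ (j - i)"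
        using that x by (simp add: t_def f_def power_diff)
      then have "is_unit_in ((to_ac f * x ^ (j - i)) * inverse (to_ac f * \<alpha> powi (- m)))"
        using is_unit_in_mult[OF that(4) is_unit_in_inverse[OF m]] by simp
      also have "(to_ac f * x ^ (j - i)) * inverse (to_ac f * \<alpha> powi (- m)) = x ^ (j - i) * \<alpha> powi (- (- m))"
        using \<open>f \<noteq> 0\<close> \<alpha>0 by (simp add: power_int_minus field_simps)
      finally show ?thesis using that(1) by (intro exI[of _ "j - i"] exI[of _ "- m"]) (simp add: has_value_def)
    qed
    show ?thesis
    proof (cases "i < j")
      case True
      then show ?thesis using * ij is_unit_in_inverse[OF ij(4)] by (simp add: inverse_eq_divide)
    next
      case False
      then show ?thesis using *[of j i] ij by simp
    qed
  qed
  interpret na: nonarch w by (rule nonarch_w[OF total])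
  have "has_value \<alpha> 1 1" using \<alpha>0 is_unit_in_1 by (simp add: has_value_def power_int_minus)
  from w_eqI[OF this] have w\<alpha>: "w \<alpha> = 1/2" by (simp add: powr_minus_divide)
  have w1: "w (of_A b) = 1" if "\<not> a dvd b" for b
    using w_eqI[of "of_A b" 1 0] unit[OF that] by (simp add: has_value_def)
  have "w (of_A b) \<le> 1" for b
  proof (cases "b = 0")
    case False
    then obtain j c where jc: "b = a ^ j * c" "\<not> a dvd c" using poly_factor_out[OF a] by blast
    have "of_A b = \<alpha> ^ j * of_A c" unfolding jc \<alpha>_def by (induction j) auto
    then have "w (of_A b) = (1/2) ^ j" by (simp add: na.w_mult na.w_power w\<alpha> w1[OF jc(2)])
    then show ?thesis by (simp add: power_le_one)
  qed (simp add: na.w_0)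
  then show ?thesis using na.nonarch_axioms w\<alpha> w1 by (intro exI[of _ w]) (auto simp: \<alpha>_def)
qed

lemma adic_value_group:
  fixes a :: "'k::field poly"
  assumes a: "irreducible a" and w: "nonarch w" "w (of_A a) = 1/2" "\<And>b. \<not> a dvd b \<Longrightarrow> w (of_A b) = 1"
    and f: "f \<noteq> 0"
  shows "\<exists>m::int. w (to_ac f) = 2 powr (of_int m)"
proof -
  interpret nonarch w by fact
  obtain b c where bc: "f = to_fract b / to_fract c" "c \<noteq> 0"
    by (metis Fract_conv_to_fract Fract_cases)
  then have "b \<noteq> 0" using f by auto
  obtain j b' where b': "b = a ^ j * b'" "\<not> a dvd b'" using poly_factor_out[OF a \<open>b \<noteq> 0\<close>] by blast
  obtain i c' where c': "c = a ^ i * c'" "\<not> a dvd c'" using poly_factor_out[OF a bc(2)] by blast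
  have pw: "of_A (a ^ n) = of_A a ^ n" for n by (induction n) auto
  have "w (to_ac f) = (1/2) ^ j / (1/2) ^ i"
    unfolding bc b' c' by (simp add: w_divide w_mult pw w_power w(2) w(3)[OF b'(2)] w(3)[OF c'(2)])
  also have "\<dots> = 2 powr (of_int (int i - int j))" by (simp add: powr_diff powr_realpow power_divide)
  finally show ?thesis by blast
qed

section \<open>Twisted polynomials\<close>

lemma power_card_field:
  fixes c :: "'k::{field,finite}"
  shows "c ^ CARD('k) = c"
proof (cases "c = 0")
  case False
  let ?U = "UNIV - {0 :: 'k}"
  have "(\<Prod>x\<in>?U. c * x) = (\<Prod>x\<in>?U. x)"
    by (rule prod.reindex_bij_witness[of _ "\<lambda>x. x / c" "\<lambda>x. c * x"]) (use False in auto)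
  then have "c ^ card ?U * \<Prod>?U = 1 * \<Prod>?U" by (simp add: prod.distrib)
  then have "c ^ card ?U = 1" by (simp del: mult_1)
  moreover have card: "CARD('k) = Suc (card ?U)"
    using card.remove[of "UNIV :: 'k set" 0] by simp
  ultimately show ?thesis unfolding card power_Suc by (simp only: mult_1_right)
qed simp

lemma card_field_gt_1: "CARD('k::{field,finite}) > 1"
proof -
  have "card {0, 1 :: 'k} \<le> CARD('k)" by (rule card_mono) auto
  then show ?thesis by simp
qed

text \<open>Comparing \<open>(X + 1)\<^sup>q\<close> with \<open>X\<^sup>q + 1\<close>: they have equal values on \<open>\<bbbF>\<^sub>q\<close>, hence are equal.\<close>

lemma of_nat_binomial_card:
  assumes i: "0 < i" "i < CARD('k::{field,finite})"
  shows "of_nat (CARD('k) choose i) = (0 :: 'k)"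
proof -
  let ?q = "CARD('k)"
  define D where "D = (\<Sum>i\<in>{1..<?q}. monom (of_nat (?q choose i) :: 'k) i)"
  have split: "{..?q} = insert 0 (insert ?q {1..<?q})" using card_field_gt_1[where 'k='k] by auto
  have "poly D c = 0" for c
  proof -
    have "(c + 1) ^ ?q = (\<Sum>i\<le>?q. of_nat (?q choose i) * c ^ i)" by (simp add: binomial_ring)
    also have "\<dots> = 1 + c ^ ?q + poly D c" unfolding split using card_field_gt_1[where 'k='k]
      by (subst sum.insert) (auto simp: D_def poly_sum poly_monom)
    finally show ?thesis by (simp only: power_card_field) simp
  qed
  moreover have "degree D < ?q" unfolding D_def using card_field_gt_1[where 'k='k]
    by (intro degree_sum_less) (auto intro: le_less_trans[OF Polynomial.degree_monom_le])
  ultimately have "D = 0" using card_poly_roots_bound[of D] by force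
  moreover have "coeff D i = of_nat (?q choose i)"
    unfolding D_def coeff_sum using i by (simp add: coeff_monom)
  ultimately show ?thesis by simp
qed

lemma of_A_of_nat: "of_A (of_nat n) = of_nat n" by (induction n) auto

lemma of_nat_binomial_card_closure:
  assumes "0 < i" "i < CARD('k::{field,finite})"
  shows "of_nat (CARD('k) choose i) = (0 :: 'k poly fract alg_closure)"
proof -
  have "(of_nat (CARD('k) choose i) :: 'k poly) = 0"
    unfolding of_nat_poly of_nat_binomial_card[OF assms] by simp
  then show ?thesis by (metis of_A_of_nat to_ac_0 to_fract_0)
qed

lemma of_nat_card_closure: "of_nat CARD('k::{field,finite}) = (0 :: 'k poly fract alg_closure)"
  using of_nat_binomial_card_closure[of 1, where 'k='k] card_field_gt_1[where 'k='k] by simp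

lemma frobenius_add:
  fixes x y :: "'k::{field,finite} poly fract alg_closure"
  shows "(x + y) ^ CARD('k) = x ^ CARD('k) + y ^ CARD('k)"
proof -
  let ?q = "CARD('k)"
  have split: "{..?q} = insert 0 (insert ?q {1..<?q})" using card_field_gt_1[where 'k='k] by auto
  have "(x + y) ^ ?q = (\<Sum>i\<le>?q. of_nat (?q choose i) * x ^ i * y ^ (?q - i))" by (rule binomial_ring)
  also have "\<dots> = x ^ ?q + y ^ ?q" unfolding split using card_field_gt_1[where 'k='k]
    by (subst sum.insert) (auto simp: of_nat_binomial_card_closure)
  finally show ?thesis .
qed

lemma frobenius_power_add:
  fixes x y :: "'k::{field,finite} poly fract alg_closure"
  shows "(x + y) ^ (CARD('k) ^ n) = x ^ (CARD('k) ^ n) + y ^ (CARD('k) ^ n)"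
  by (induction n) (simp_all add: frobenius_add power_mult mult.commute[of "CARD('k)"])

lemma frobenius_power_sum:
  fixes f :: "'i \<Rightarrow> 'k::{field,finite} poly fract alg_closure"
  shows "sum f S ^ (CARD('k) ^ n) = (\<Sum>i\<in>S. f i ^ (CARD('k) ^ n))"
  by (induction S rule: infinite_finite_induct) (auto simp: frobenius_power_add power_0_left)

section \<open>Twisted polynomials as additive polynomials\<close>

lemma twisted_eval_altdef:
  fixes f :: "'k::{field,finite} poly fract poly"
  assumes "degree f \<le> n"
  shows "twisted_eval f x = (\<Sum>i\<le>n. to_ac (coeff f i) * x ^ (CARD('k) ^ i))"
  unfolding twisted_eval_def using assms by (intro sum.mono_neutral_left) (auto simp: coeff_eq_0)

lemma twisted_eval_add: "twisted_eval (f + g) x = twisted_eval f x + twisted_eval g x"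
proof -
  let ?n = "max (degree f) (degree g)"
  have "degree (f + g) \<le> ?n" by (rule degree_add_le) auto
  then show ?thesis
    by (simp add: twisted_eval_altdef[of _ ?n] sum.distrib distrib_right)
qed

lemma twisted_eval_0: "twisted_eval 0 x = 0" by (simp add: twisted_eval_def)

lemma twisted_eval_sum: "twisted_eval (sum f S) x = (\<Sum>i\<in>S. twisted_eval (f i) x)"
  by (induction S rule: infinite_finite_induct) (auto simp: twisted_eval_add twisted_eval_0)

lemma twisted_eval_monom:
  fixes c :: "'k::{field,finite} poly fract"
  shows "twisted_eval (monom c n) x = to_ac c * x ^ (CARD('k) ^ n)"
proof -
  have "twisted_eval (monom c n) x = (\<Sum>i\<le>n. to_ac (if n = i then c else 0) * x ^ (CARD('k) ^ i))"
    by (subst twisted_eval_altdef[OF Polynomial.degree_monom_le]) (simp add: coeff_monom)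
  also have "\<dots> = (\<Sum>i\<in>{n}. to_ac c * x ^ (CARD('k) ^ i))"
    by (rule sum.mono_neutral_cong_right) auto
  finally show ?thesis by simp
qed

lemma twisted_eval_mult: "twisted_eval (twisted_mult f g) x = twisted_eval f (twisted_eval g x)"
  unfolding twisted_mult_def twisted_eval_sum twisted_eval_monom
  unfolding twisted_eval_def[of f] twisted_eval_def[of g] frobenius_power_sum
  by (simp add: power_mult_distrib sum_distrib_left power_add power_mult mult.assoc)
     (simp add: mult.commute flip: power_mult)

lemma twisted_eval_linear:
  "twisted_eval f (x + y) = twisted_eval f x + twisted_eval f y"
  by (simp add: twisted_eval_def frobenius_power_add distrib_left sum.distrib)

lemma twisted_eval_ac_auts:
  "\<sigma> \<in> ac_auts \<Longrightarrow> \<sigma> (twisted_eval f x) = twisted_eval f (\<sigma> x)"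
  by (simp add: twisted_eval_def ac_auts_sum ac_auts_hom)

text \<open>The ordinary polynomial behind \<open>twisted_eval f\<close>. As q vanishes in the
  field, its derivative is the constant \<open>coeff f 0\<close>; if this is nonzero, all fibres
  consist of simple roots.\<close>

definition twisted_poly :: "'k::{field,finite} poly fract poly \<Rightarrow> 'k poly fract poly" where
  "twisted_poly f = (\<Sum>i\<le>degree f. monom (coeff f i) (CARD('k) ^ i))"

lemma map_poly_to_ac_sum: "map_poly to_ac (sum f S) = (\<Sum>i\<in>S. map_poly to_ac (f i))"
  by (intro poly_eqI) (simp add: coeff_map_poly coeff_sum to_ac_sum)

lemma poly_twisted_poly: "poly (map_poly to_ac (twisted_poly f)) x = twisted_eval f x"
  by (simp add: twisted_poly_def map_poly_to_ac_sum map_poly_monom poly_sum poly_monom twisted_eval_def)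

lemma pderiv_sum: "pderiv (sum f S) = (\<Sum>i\<in>S. pderiv (f i))"
  by (induction S rule: infinite_finite_induct) (auto simp: pderiv_add)

lemma pderiv_twisted_poly:
  "pderiv (map_poly to_ac (twisted_poly f)) = [:to_ac (coeff f 0):]"
proof -
  have "pderiv (monom (to_ac (coeff f i)) (CARD('a) ^ i)) =
      (if i = 0 then [:to_ac (coeff f 0):] else 0)" for i
    by (cases i) (auto simp: pderiv_monom monom_0 of_nat_card_closure)
  then show ?thesis
    by (simp add: twisted_poly_def map_poly_to_ac_sum map_poly_monom pderiv_sum)
qed

lemma twisted_poly_degree:
  fixes f :: "'k::{field,finite} poly fract poly"
  assumes "f \<noteq> 0"
  shows "degree (twisted_poly f) = CARD('k) ^ degree f"
    "lead_coeff (twisted_poly f) = lead_coeff f"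
proof -
  let ?n = "degree f" and ?q = "CARD('k)"
  have q: "?q > 1" by (rule card_field_gt_1)
  have c: "coeff (twisted_poly f) (?q ^ ?n) = lead_coeff f"
  proof -
    have "coeff (twisted_poly f) (?q ^ ?n) = (\<Sum>i\<le>?n. if i = ?n then coeff f i else 0)"
      unfolding twisted_poly_def coeff_sum using q by (intro sum.cong) (auto simp: coeff_monom)
    then show ?thesis by simp
  qed
  moreover have "degree (twisted_poly f) \<le> ?q ^ ?n" unfolding twisted_poly_def
    using q by (intro degree_sum_le) (auto intro!: order_trans[OF Polynomial.degree_monom_le] power_increasing)
  moreover have "lead_coeff f \<noteq> 0" using assms by simp
  ultimately show "degree (twisted_poly f) = ?q ^ ?n"
    using le_degree[of "twisted_poly f" "?q ^ ?n"] by (metis le_antisym)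
  then show "lead_coeff (twisted_poly f) = lead_coeff f" using c by simp
qed

lemma twisted_roots_separable:
  assumes "coeff f 0 \<noteq> 0" "twisted_eval f x = 0"
  shows "separable_elem x"
proof (rule separable_elemI)
  show "poly (map_poly to_ac (twisted_poly f)) x = 0" using assms by (simp add: poly_twisted_poly)
  show "rsquarefree (map_poly to_ac (twisted_poly f))"
    unfolding rsquarefree_iff_simple_roots pderiv_twisted_poly using assms pderiv_twisted_poly[of f]
    by auto
qed

text \<open>All roots are simple, so the shifted polynomial is a product over the fibre.
  Differentiating at a root y leaves the product of its differences to the other roots; at y = 0
  this gives the product of all nonzero torsion points, up to sign and leading coefficient.\<close>

lemma twisted_fibre:
  fixes f :: "'k::{field,finite} poly fract poly"
  assumes "coeff f 0 \<noteq> 0"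
  shows "finite {x. twisted_eval f x = y}"
    "poly (map_poly to_ac (twisted_poly f) - [:y:]) z =
       to_ac (lead_coeff f) * (\<Prod>x\<in>{x. twisted_eval f x = y}. z - x)"
    "twisted_eval f y = 0 \<Longrightarrow> to_ac (coeff f 0) =
       to_ac (lead_coeff f) * (\<Prod>x\<in>{x. twisted_eval f x = 0} - {y}. y - x)"
proof -
  have prod: "finite {x. twisted_eval f x = y} \<and>
     map_poly to_ac (twisted_poly f) - [:y:] =
       smult (to_ac (lead_coeff f)) (\<Prod>x\<in>{x. twisted_eval f x = y}. [:-x, 1:])" for y
  proof -
    let ?p = "map_poly to_ac (twisted_poly f) - [:y:]"
    have f0: "f \<noteq> 0" using assms by auto
    have dt: "degree (map_poly to_ac (twisted_poly f)) = CARD('k) ^ degree f"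
      using twisted_poly_degree(1)[OF f0] by (subst degree_map_poly) auto
    have q: "CARD('k) ^ degree f > 0" by simp
    have dp: "pderiv ?p = [:to_ac (coeff f 0):]" by (simp add: pderiv_diff pderiv_twisted_poly pderiv_pCons)
    then have p0: "?p \<noteq> 0" using assms by auto
    have dd: "degree ?p = degree (map_poly to_ac (twisted_poly f))"
      using dt q by (metis degree_add_eq_left degree_pCons_0 diff_conv_add_uminus minus_pCons minus_zero)
    have lc: "lead_coeff ?p = to_ac (lead_coeff f)"
    proof -
      have "coeff [:y:] (CARD('k) ^ degree f) = 0" by (simp add: coeff_pCons split: nat.splits)
      then show ?thesis unfolding dd dt
        using twisted_poly_degree[OF f0] by (simp add: coeff_map_poly)
    qed
    have roots: "{x. poly ?p x = 0} = {x. twisted_eval f x = y}" by (auto simp: poly_twisted_poly)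
    have "?p = smult (lead_coeff ?p) (\<Prod>x\<in>{x. poly ?p x = 0}. [:-x, 1:])"
      by (rule poly_simple_roots_factorization[OF p0]) (use dp assms in simp)
    then show ?thesis using poly_roots_finite[OF p0] unfolding roots lc by simp
  qed
  show "finite {x. twisted_eval f x = y}" using prod by blast
  show "poly (map_poly to_ac (twisted_poly f) - [:y:]) z =
       to_ac (lead_coeff f) * (\<Prod>x\<in>{x. twisted_eval f x = y}. z - x)"
    using prod[of y] by (simp add: poly_prod)
  assume y: "twisted_eval f y = 0"
  let ?Z = "{x. twisted_eval f x = 0}"
  have fin: "finite ?Z" and eq: "map_poly to_ac (twisted_poly f) =
      smult (to_ac (lead_coeff f)) (\<Prod>x\<in>?Z. [:-x, 1:])" using prod[of 0] by auto
  have "(\<Prod>x\<in>?Z. [:-x, 1:]) = [:-y, 1:] * (\<Prod>x\<in>?Z - {y}. [:-x, 1:])"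
    using fin y by (intro prod.remove) auto
  then have "poly (pderiv (\<Prod>x\<in>?Z. [:-x, 1:])) y = (\<Prod>x\<in>?Z - {y}. y - x)"
    by (simp only: poly_pderiv_linear_mult) (simp add: poly_prod)
  moreover have "poly (pderiv (map_poly to_ac (twisted_poly f))) y = to_ac (coeff f 0)"
    by (simp add: pderiv_twisted_poly)
  ultimately show "to_ac (coeff f 0) = to_ac (lead_coeff f) * (\<Prod>x\<in>?Z - {y}. y - x)"
    unfolding eq by (simp add: pderiv_smult)
qed

lemma drinfeld_moduleD:
  fixes \<phi> :: "'k::{field,finite} poly \<Rightarrow> 'k poly fract poly"
  assumes "drinfeld_module r \<phi>"
  shows "\<phi> (b + c) = \<phi> b + \<phi> c" "\<phi> (b * c) = twisted_mult (\<phi> b) (\<phi> c)"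
    "degree (\<phi> b) = r * degree b" "coeff (\<phi> b) 0 = to_fract b"
  using assms unfolding drinfeld_module_def ring_hom_def
  by (auto simp: ring_of_type_algebra_def twisted_ring_def)

lemma lead_coeff_twisted_mult:
  fixes f g :: "'k::{field,finite} poly fract poly"
  shows "coeff (twisted_mult f g) (degree f + degree g) =
    lead_coeff f * lead_coeff g ^ (CARD('k) ^ degree f)"
proof -
  let ?m = "degree f" and ?n = "degree g"
  have "coeff (twisted_mult f g) (?m + ?n) =
     (\<Sum>i\<le>?m. \<Sum>j\<le>?n. if i = ?m \<and> j = ?n then coeff f i * coeff g j ^ (CARD('k) ^ i) else 0)"
    unfolding twisted_mult_def coeff_sum by (intro sum.cong) (auto simp: coeff_monom)
  also have "\<dots> = (\<Sum>i\<le>?m. if i = ?m then coeff f i * lead_coeff g ^ (CARD('k) ^ i) else 0)"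
    by (intro sum.cong refl) (auto simp: if_distrib cong: if_cong)
  finally show ?thesis by simp
qed

section \<open>Torsion points at a place of good reduction\<close>

lemma twisted_eval_surj:
  fixes f :: "'k::{field,finite} poly fract poly"
  assumes "f \<noteq> 0"
  shows "\<exists>x. twisted_eval f x = y"
proof -
  let ?p = "map_poly to_ac (twisted_poly f)"
  have "degree ?p = CARD('k) ^ degree f"
    using twisted_poly_degree(1)[OF assms] by (subst degree_map_poly) auto
  then have d: "degree ?p > 0" by simp
  then have "degree (?p + [:- y:]) = degree ?p" by (intro degree_add_eq_left) simp
  then have "degree (?p + [:- y:]) > 0" using d by simp
  then obtain x where "poly (?p + [:- y:]) x = 0" using alg_closed_imp_poly_has_root by blast
  then show ?thesis by (intro exI[of _ x]) (simp add: poly_twisted_poly)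
qed

locale drinfeld =
  fixes r :: nat and \<phi> :: "'k::{field,finite} poly \<Rightarrow> 'k poly fract poly"
  assumes dm: "drinfeld_module r \<phi>"
begin

abbreviation act :: "'k poly \<Rightarrow> 'k poly fract alg_closure \<Rightarrow> 'k poly fract alg_closure" where
  "act b x \<equiv> twisted_eval (\<phi> b) x"

lemma act_add: "act (b + c) x = act b x + act c x"
  by (simp add: drinfeld_moduleD(1)[OF dm] twisted_eval_add)

lemma act_mult: "act (b * c) x = act b (act c x)"
  by (simp add: drinfeld_moduleD(2)[OF dm] twisted_eval_mult)

lemma act_commute: "act b (act c x) = act c (act b x)"
  by (simp add: mult.commute flip: act_mult)

lemma act_linear: "act b (x + y) = act b x + act b y" by (rule twisted_eval_linear)

lemma act_0: "act b 0 = 0" using act_linear[of b 0 0] by (metis add_0 add_left_cancel add.right_neutral)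

lemma act_diff: "act b (x - y) = act b x - act b y"
  using act_linear[of b "x - y" y] by simp

lemma act_0_left: "act 0 x = 0" using act_add[of 0 0 x] by (metis add_0 add_left_cancel add.right_neutral)

lemma act_diff_left: "act (b - c) x = act b x - act c x"
  using act_add[of "b - c" c x] by simp

lemma act_const: "act [:c:] x = of_A [:c:] * x"
  using drinfeld_moduleD(3,4)[OF dm, of "[:c:]"] by (simp add: twisted_eval_def)

lemma act_1: "act 1 x = x" using act_const[of 1 x] by (simp add: pCons_one)

lemma act_auts: "\<sigma> \<in> ac_auts \<Longrightarrow> \<sigma> (act b x) = act b (\<sigma> x)"
  by (rule twisted_eval_ac_auts)

lemma coeff_0_nz: "coeff (\<phi> b) 0 \<noteq> 0" if "b \<noteq> 0"
  using that by (simp add: drinfeld_moduleD(4)[OF dm])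

end

text \<open>Good reduction at the place of \<open>a\<close>: integral coefficients throughout and a
  unit as leading coefficient of \<open>\<phi> a\<close>. The clause \<open>discrete\<close> makes
  \<open>a\<close> a uniformiser: its value 1/2 generates the group of values of the base
  field.\<close>

locale good_place = nonarch w + drinfeld r \<phi>
  for w :: "'k::{field,finite} poly fract alg_closure \<Rightarrow> real" and r :: nat
    and \<phi> :: "'k poly \<Rightarrow> 'k poly fract poly" +
  fixes q :: nat and a :: "'k poly"
  assumes q_eq: "q = CARD('k)" and irr: "irreducible a"
    and w_a: "w (of_A a) = 1/2"
    and integral: "w (to_ac (coeff (\<phi> b) i)) \<le> 1"
    and good: "w (to_ac (lead_coeff (\<phi> a))) = 1"
    and discrete: "f \<noteq> 0 \<Longrightarrow> \<exists>m::int. w (to_ac f) = 2 powr (of_int m)"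
begin

lemma q_gt_1: "q > 1" unfolding q_eq by (rule card_field_gt_1)

lemma w_power_q_le: "w x \<le> 1 \<Longrightarrow> w x ^ (q ^ i) \<le> w x"
  using power_decreasing[of 1 "q ^ i" "w x"] w_nonneg[of x] q_gt_1 by simp

lemma w_act_le: "w x \<le> 1 \<Longrightarrow> w (act b x) \<le> w x"
  unfolding twisted_eval_def q_eq[symmetric]
  by (intro w_sum_le) (auto simp: w_mult w_power w_nonneg intro!: order_trans[OF mult_left_le_one_le] integral w_power_q_le)

text \<open>\<open>h\<close> is the height of the reduction, \<open>V0\<close> the kernel of reduction on the \<open>a\<close>-torsion, and
  \<open>W0\<close> consists of the points of exact order \<open>a\<^sup>2\<close> in the kernel of reduction.\<close>

definition n :: nat where "n = degree (\<phi> a)"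
definition c :: "nat \<Rightarrow> 'k poly fract alg_closure" where "c i = to_ac (coeff (\<phi> a) i)"
definition h :: nat where "h = (LEAST i. w (c i) = 1)"
definition Q :: nat where "Q = q ^ h"
definition Z1 :: "'k poly fract alg_closure set" where "Z1 = {x. act a x = 0}"
definition Z2 :: "'k poly fract alg_closure set" where "Z2 = {x. act a (act a x) = 0}"
definition V0 :: "'k poly fract alg_closure set" where "V0 = {x\<in>Z1. w x < 1}"
definition W0 :: "'k poly fract alg_closure set" where "W0 = {x\<in>Z2. w x < 1 \<and> act a x \<noteq> 0}"

lemma act_a: "act a x = (\<Sum>i\<le>n. c i * x ^ (q ^ i))"
  by (simp add: twisted_eval_def n_def c_def q_eq)

lemma c_0: "c 0 = of_A a" by (simp add: c_def drinfeld_moduleD(4)[OF dm])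

lemma w_c_le: "w (c i) \<le> 1" by (simp add: c_def integral)

lemma w_c_n: "w (c n) = 1" using good by (simp add: c_def n_def)

lemma w_c_h: "w (c h) = 1" and h_le_n: "h \<le> n"
  unfolding h_def using w_c_n by (rule LeastI, rule Least_le)

lemma h_pos: "h > 0"
  using w_c_h c_0 w_a by (cases "h = 0") auto

text \<open>Discreteness improves \<open>< 1\<close> to \<open>\<le> 1/2\<close>, the value of the
  linear coefficient; so below index \<open>h\<close> the linear term dominates at points with w <
  1.\<close>

lemma w_c_low: assumes "i < h" shows "w (c i) \<le> 1/2"
proof (cases "coeff (\<phi> a) i = 0")
  case False
  have "w (c i) \<noteq> 1" using assms not_less_Least unfolding h_def by blast
  moreover obtain m :: int where m: "w (c i) = 2 powr (of_int m)" using discrete[OF False] by (auto simp: c_def)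
  moreover have "(2::real) powr (of_int m) \<le> 2 powr 0" using w_c_le[of i] m by simp
  then have "m \<le> 0" by (simp only: powr_le_cancel_iff)
  ultimately have "m \<le> - 1" by (cases "m = 0") auto
  then have "(2::real) powr (of_int m) \<le> 2 powr (- 1)" by (intro powr_mono) auto
  then show ?thesis using m by (simp add: powr_minus_divide)
qed (simp add: c_def w_0)

section \<open>Values of torsion points\<close>

lemma Q_ge_q: "q \<le> Q"
  unfolding Q_def using power_increasing[of 1 h q] h_pos q_gt_1 by simp

lemma Q_gt_1: "Q > 1" using Q_ge_q q_gt_1 by linarith

text \<open>The split replaces the Newton polygon of \<open>\<phi> a\<close>: for w x < 1 the part
  below index \<open>h\<close> has the size of its linear term a x, the rest that of x^Q.\<close>

definition low :: "'k poly fract alg_closure \<Rightarrow> 'k poly fract alg_closure" where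
  "low x = (\<Sum>i<h. c i * x ^ (q ^ i))"
definition high :: "'k poly fract alg_closure \<Rightarrow> 'k poly fract alg_closure" where
  "high x = (\<Sum>i\<in>{h..n}. c i * x ^ (q ^ i))"

lemma act_a_split: "act a x = low x + high x"
proof -
  have "{..n} = {..<h} \<union> {h..n}" using h_le_n by auto
  then show ?thesis unfolding act_a low_def high_def by (simp add: sum.union_disjoint ivl_disj_int)
qed

lemma w_power_q_less:
  assumes "0 < w x" "w x < 1" "i < j"
  shows "w x ^ (q ^ j) < w x ^ (q ^ i)"
  using assms q_gt_1 by (intro power_strict_decreasing power_strict_increasing) auto

lemma w_high:
  assumes "x \<noteq> 0" "w x < 1"
  shows "w (high x) = w x ^ Q"
proof -
  have "{h..n} = insert h {h<..n}" using h_le_n by auto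
  then have "high x = c h * x ^ Q + (\<Sum>i\<in>{h<..n}. c i * x ^ (q ^ i))"
    by (simp add: high_def Q_def)
  moreover have "w (\<Sum>i\<in>{h<..n}. c i * x ^ (q ^ i)) < w x ^ Q"
  proof (rule w_sum_less)
    show "0 < w x ^ Q" using w_pos[OF assms(1)] by simp
    fix i assume "i \<in> {h<..n}"
    then have "w x ^ (q ^ i) < w x ^ Q" unfolding Q_def using assms by (intro w_power_q_less w_pos) auto
    then show "w (c i * x ^ (q ^ i)) < w x ^ Q" using w_c_le by (intro w_mult_less) (auto simp: w_power)
  qed
  ultimately show ?thesis using w_add_eq[of "\<Sum>i\<in>{h<..n}. c i * x ^ (q ^ i)" "c h * x ^ Q"]
    by (simp add: w_mult w_power w_c_h)
qed

lemma w_low: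
  assumes "x \<noteq> 0" "w x < 1"
  shows "w (low x) = w x / 2"
proof -
  have "{..<h} = insert 0 {0<..<h}" using h_pos by auto
  then have "low x = c 0 * x + (\<Sum>i\<in>{0<..<h}. c i * x ^ (q ^ i))"
    by (simp add: low_def)
  moreover have "w (\<Sum>i\<in>{0<..<h}. c i * x ^ (q ^ i)) < w x / 2"
  proof (rule w_sum_less)
    show "0 < w x / 2" using w_pos[OF assms(1)] by simp
    fix i assume i: "i \<in> {0<..<h}"
    then have "w x ^ (q ^ i) < w x ^ (q ^ 0)" using assms by (intro w_power_q_less w_pos) auto
    then have "w x ^ (q ^ i) < w x" by simp
    moreover have "w (c i) * w x ^ (q ^ i) \<le> (1/2) * w x ^ (q ^ i)"
      using i w_nonneg by (intro mult_right_mono w_c_low) auto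
    ultimately show "w (c i * x ^ (q ^ i)) < w x / 2" by (simp add: w_mult w_power)
  qed
  ultimately show ?thesis using w_add_eq[of "\<Sum>i\<in>{0<..<h}. c i * x ^ (q ^ i)" "c 0 * x"] c_0 w_a
    by (simp add: w_mult)
qed

text \<open>At a torsion point \<open>low\<close> and \<open>high\<close> cancel, so w^Q = w /
  2.\<close>

lemma w_V0:
  assumes "y \<in> V0" "y \<noteq> 0"
  shows "w y ^ (Q - 1) = 1/2" "1/2 \<le> w y"
proof -
  have y: "act a y = 0" "w y < 1" using assms by (auto simp: V0_def Z1_def)
  have p: "w y > 0" using assms by (intro w_pos)
  have "high y = - low y" using y act_a_split[of y] by (simp add: eq_neg_iff_add_eq_0 add.commute)
  then have "w y ^ Q = w y / 2" using w_high[OF assms(2) y(2)] w_low[OF assms(2) y(2)] by (simp add: w_uminus)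
  moreover have "w y ^ Q = w y * w y ^ (Q - 1)" using Q_gt_1 by (cases Q) auto
  ultimately show 1: "w y ^ (Q - 1) = 1/2" using p by simp
  have "w y ^ (Q - 1) \<le> w y ^ 1" using Q_gt_1 y p by (intro power_decreasing) auto
  then show "1/2 \<le> w y" using 1 by simp
qed

text \<open>\<open>act a x\<close> has value at least 1/2, so \<open>low x\<close>, of value w x /
  2, is too small to matter, and \<open>high x\<close> alone carries the value.\<close>

lemma w_over_V0:
  assumes "w x < 1" "act a x \<in> V0" "act a x \<noteq> 0"
  shows "w x ^ Q = w (act a x)"
proof -
  have x: "x \<noteq> 0" using assms act_0 by auto
  have "w (- low x) < w (act a x)"
    using w_low[OF x assms(1)] assms(1) w_V0(2)[OF assms(2,3)] by (simp add: w_uminus)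
  then have "w (act a x + - low x) = w (act a x)" by (rule w_add_eq)
  moreover have "act a x + - low x = high x" by (simp add: act_a_split)
  ultimately show ?thesis using w_high[OF x assms(1)] by simp
qed

text \<open>For w x > 1 the top term would dominate, as its coefficient is a unit, and
  \<open>act a x\<close> would not be integral.\<close>

lemma integral_point:
  assumes "w (act a x) \<le> 1" shows "w x \<le> 1"
proof (rule ccontr)
  assume "\<not> ?thesis"
  then have x: "w x > 1" by simp
  have "{..n} = insert n {..<n}" by auto
  then have "act a x = c n * x ^ (q ^ n) + (\<Sum>i<n. c i * x ^ (q ^ i))" by (simp add: act_a)
  moreover have "w (\<Sum>i<n. c i * x ^ (q ^ i)) < w x ^ (q ^ n)"
  proof (rule w_sum_less)
    show "0 < w x ^ (q ^ n)" using x by simp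
    fix i assume "i \<in> {..<n}"
    then have "w x ^ (q ^ i) < w x ^ (q ^ n)" using x q_gt_1 by (intro power_strict_increasing) auto
    then show "w (c i * x ^ (q ^ i)) < w x ^ (q ^ n)" using w_c_le by (intro w_mult_less) (auto simp: w_power)
  qed
  ultimately have "w (act a x) = w x ^ (q ^ n)"
    using w_add_eq[of "\<Sum>i<n. c i * x ^ (q ^ i)" "c n * x ^ (q ^ n)"] by (simp add: w_mult w_power w_c_n)
  moreover have "0 < q ^ n" using q_gt_1 by simp
  moreover from x this have "1 < w x ^ (q ^ n)" by (rule one_less_power)
  ultimately show False using assms by simp
qed

lemma Z1_integral: "x \<in> Z1 \<Longrightarrow> w x \<le> 1"
  using integral_point[of x] by (simp add: Z1_def w_0)

lemma Z2_integral: "x \<in> Z2 \<Longrightarrow> w x \<le> 1"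
  using integral_point[of x] integral_point[of "act a x"] by (simp add: Z2_def w_0)

section \<open>Counting points in the kernel of reduction\<close>

lemma a_nz: "a \<noteq> 0" using irr by auto

lemma finite_Z1: "finite Z1" unfolding Z1_def by (rule twisted_fibre(1)) (rule coeff_0_nz[OF a_nz])

lemma Z2_eq: "Z2 = {x. twisted_eval (\<phi> (a * a)) x = 0}"
  by (simp add: Z2_def act_mult)

lemma finite_Z2: "finite Z2" unfolding Z2_eq by (rule twisted_fibre(1)) (rule coeff_0_nz, use a_nz in simp)

lemma Z1_subset_Z2: "Z1 \<subseteq> Z2" by (auto simp: Z1_def Z2_def act_0)

lemma Z1_cl: "x \<in> Z1 \<Longrightarrow> y \<in> Z1 \<Longrightarrow> x + y \<in> Z1" "x \<in> Z1 \<Longrightarrow> y \<in> Z1 \<Longrightarrow> x - y \<in> Z1"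
   "x \<in> Z1 \<Longrightarrow> act b x \<in> Z1" "0 \<in> Z1" "x \<in> Z2 \<Longrightarrow> act a x \<in> Z1"
  by (auto simp: Z1_def Z2_def act_linear act_diff act_0 act_commute[of a b])

lemma V0_cl: "x \<in> V0 \<Longrightarrow> y \<in> V0 \<Longrightarrow> x + y \<in> V0" "x \<in> V0 \<Longrightarrow> y \<in> V0 \<Longrightarrow> x - y \<in> V0"
   "x \<in> V0 \<Longrightarrow> act b x \<in> V0" "0 \<in> V0"
  using w_act_le[of x b] by (auto simp: V0_def Z1_cl w_add_less w_diff_less w_0)

text \<open>The product of the nonzero torsion points has the value of \<open>a\<close>, namely 1/2.
  Only points of \<open>V0\<close> contribute, and the (Q - 1)-th power of each contribution is 1/2;
  comparing exponents counts them.\<close>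

lemma card_V0: "card V0 = Q"
proof -
  have fin: "finite Z1" by (rule finite_Z1)
  have "of_A a = to_ac (lead_coeff (\<phi> a)) * (\<Prod>x\<in>Z1 - {0}. 0 - x)"
    using twisted_fibre(3)[of "\<phi> a" 0] coeff_0_nz[OF a_nz] act_0
    unfolding Z1_def drinfeld_moduleD(4)[OF dm] by simp
  then have "w (of_A a) = (\<Prod>x\<in>Z1 - {0}. w x)" using good by (simp add: w_mult w_prod w_uminus)
  also have "\<dots> = (\<Prod>x\<in>V0 - {0}. w x)"
    using fin Z1_integral by (intro prod.mono_neutral_right) (force simp: V0_def)+
  finally have "(1/2) ^ (Q - 1) = (\<Prod>x\<in>V0 - {0}. w x) ^ (Q - 1)" unfolding w_a by (rule arg_cong)
  also have "\<dots> = (\<Prod>x\<in>V0 - {0}. w x ^ (Q - 1))" by (rule prod_power_distrib)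
  also have "\<dots> = (\<Prod>x\<in>V0 - {0}. 1/2)" by (intro prod.cong refl w_V0(1)) auto
  also have "\<dots> = (1/2) ^ card (V0 - {0})" by simp
  finally have "Q - 1 = card (V0 - {0})" using power_inject_exp'[of "1/2::real" "Q - 1" "card (V0 - {0})"] by simp
  then show ?thesis using Q_gt_1 V0_cl(4) fin card.remove[of V0 0] by (simp add: V0_def)
qed

lemma W0_value: assumes "x \<in> W0" shows "w x ^ (Q * (Q - 1)) = 1/2"
proof -
  have x: "w x < 1" "act a x \<noteq> 0" "act a x \<in> V0"
    using assms w_act_le[of x a] by (auto simp: W0_def V0_def Z1_def Z2_def)
  show ?thesis unfolding power_mult w_over_V0[OF x(1,3,2)] by (rule w_V0(1)[OF x(3,2)])
qed

text \<open>The product of all points above y has the value of y, which is below 1, so one of them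
  is in the kernel of reduction.\<close>

lemma W0_lift:
  assumes "y \<in> V0" "y \<noteq> 0" shows "\<exists>x\<in>W0. act a x = y"
proof -
  let ?S = "{x. act a x = y}"
  have fin: "finite ?S" by (rule twisted_fibre(1)) (rule coeff_0_nz[OF a_nz])
  have "- y = to_ac (lead_coeff (\<phi> a)) * (\<Prod>x\<in>?S. 0 - x)"
    using twisted_fibre(2)[of "\<phi> a" y 0] coeff_0_nz[OF a_nz] act_0[of a] by (simp add: poly_twisted_poly)
  then have "w (- y) = (\<Prod>x\<in>?S. w x)" using good by (simp add: w_mult w_prod w_uminus)
  then have prod: "w y = (\<Prod>x\<in>?S. w x)" by (simp only: w_uminus)
  have "w y < 1" using assms by (simp add: V0_def)
  have "\<exists>x\<in>?S. w x < 1"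
  proof (rule ccontr)
    assume "\<not> ?thesis"
    then have "1 \<le> (\<Prod>x\<in>?S. w x)" by (intro prod_ge_1) (auto simp: not_less)
    then show False using \<open>w y < 1\<close> prod by simp
  qed
  then show ?thesis using assms by (auto simp: W0_def V0_def Z1_def Z2_def)
qed

text \<open>A fibre over y is contained in a coset of \<open>V0\<close>, and y ranges over
  \<open>V0 - {0}\<close>. The matching lower bound comes from the divisibility of orbit lengths
  under inertia.\<close>

lemma card_W0_le: "card W0 \<le> Q * (Q - 1)" and finite_W0: "finite W0"
proof -
  show finite_W0: "finite W0" using finite_Z2 by (rule finite_subset[rotated]) (auto simp: W0_def)
  have finV: "finite V0" using finite_Z1 by (rule finite_subset[rotated]) (auto simp: V0_def)
  let ?F = "\<lambda>y. {x\<in>W0. act a x = y}"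
  have sub: "W0 \<subseteq> (\<Union>y\<in>V0 - {0}. ?F y)"
  proof
    fix x assume "x \<in> W0"
    moreover from this have "act a x \<in> V0 - {0}" using w_act_le[of x a] by (auto simp: W0_def V0_def Z1_def Z2_def)
    ultimately show "x \<in> (\<Union>y\<in>V0 - {0}. ?F y)" by blast
  qed
  have "card (?F y) \<le> Q" for y
  proof (cases "?F y = {}")
    case False
    then obtain x where x: "x \<in> W0" "act a x = y" by blast
    have "?F y \<subseteq> (\<lambda>v. x + v) ` V0"
    proof
      fix z assume "z \<in> ?F y"
      then have "z - x \<in> V0" using x by (auto simp: V0_def Z1_def act_diff W0_def w_diff_less)
      then show "z \<in> (\<lambda>v. x + v) ` V0" by (intro image_eqI[of _ _ "z - x"]) auto
    qed
    then have "card (?F y) \<le> card V0" using finV by (meson card_image_le card_mono finite_imageI le_trans)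
    then show ?thesis by (simp add: card_V0)
  next
    case True
    then show ?thesis by (simp only: card.empty)
  qed
  then have "card (\<Union>y\<in>V0 - {0}. ?F y) \<le> (\<Sum>y\<in>V0 - {0}. Q)"
    using finV by (intro order_trans[OF card_UN_le] sum_mono) auto
  also have "\<dots> = Q * (Q - 1)" using V0_cl(4) finV by (simp add: card_V0)
  finally have le: "card (\<Union>y\<in>V0 - {0}. ?F y) \<le> Q * (Q - 1)" .
  have "finite (\<Union>y\<in>V0 - {0}. ?F y)" using finite_W0 by (rule finite_subset[rotated]) blast
  from card_mono[OF this sub] le show "card W0 \<le> Q * (Q - 1)" by (rule le_trans)
qed

section \<open>Inertia on the torsion points\<close>

sublocale galois_valued w Z2 "to_fract a"
proof
  show "finite Z2" by (rule finite_Z2)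
  fix x assume "x \<in> Z2"
  then show "separable_elem x"
    unfolding Z2_eq by (intro twisted_roots_separable[of "\<phi> (a * a)"] coeff_0_nz) (use a_nz in auto)
next
  fix \<sigma> :: "'k poly fract alg_closure \<Rightarrow> 'k poly fract alg_closure" and x
  assume s: "\<sigma> \<in> ac_auts" "x \<in> Z2"
  then show "\<sigma> x \<in> Z2" by (simp add: Z2_def act_auts[symmetric] ac_auts_hom)
qed (simp_all add: w_a)

text \<open>The product over an orbit is fixed by inertia, so its value is an integral power of 2,
  while the Q(Q - 1)-th power of each factor has value 1/2. Hence Q(Q - 1) divides the length of the
  orbit, and \<open>W0\<close> has no room for a second one.\<close>

lemma inertia_transitive:
  assumes x0: "x0 \<in> W0" and x: "x \<in> W0"
  shows "\<exists>\<sigma>\<in>inertia. \<sigma> x0 = x"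
proof -
  define Orb where "Orb = (\<lambda>\<sigma>. \<sigma> x0) ` inertia"
  have M: "W0 \<subseteq> M" using Z_subset_M by (auto simp: W0_def)
  have stab: "\<sigma> y \<in> W0" if "\<sigma> \<in> inertia" "y \<in> W0" for \<sigma> y
  proof -
    have "w (\<sigma> y) = w y" using that M by (auto intro: inertia_w)
    then show ?thesis using that stable_Z[of \<sigma> y]
      by (auto simp: W0_def inertia_ac act_auts[symmetric] ac_auts_hom)
  qed
  then have sub: "Orb \<subseteq> W0" using x0 by (auto simp: Orb_def)
  have fin: "finite Orb" using sub finite_W0 by (rule finite_subset)
  define \<alpha> where "\<alpha> = \<Prod>Orb"
  have nz: "y \<noteq> 0" if "y \<in> W0" for y using that act_0 by (auto simp: W0_def)
  have "\<alpha> \<noteq> 0" unfolding \<alpha>_def using fin sub nz by auto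
  moreover have "\<alpha> \<in> M" unfolding \<alpha>_def using sub M by (intro field_set_prod[OF field_set_M]) auto
  moreover have "\<sigma> \<alpha> = \<alpha>" if s: "\<sigma> \<in> inertia" for \<sigma>
  proof -
    have "\<sigma> ` Orb \<subseteq> Orb" using inertia_comp[OF s] by (force simp: Orb_def image_iff)
    then have "bij_betw \<sigma> Orb Orb" using fin ac_auts_inj[OF inertia_ac[OF s]]
      by (metis bij_betw_def endo_inj_surj inj_on_subset subset_UNIV)
    then have "(\<Prod>y\<in>Orb. \<sigma> y) = \<Prod>Orb" using prod.reindex_bij_betw[of \<sigma> Orb Orb "\<lambda>y. y"] by simp
    then show ?thesis unfolding \<alpha>_def using s by (simp add: ac_auts_prod inertia_ac)
  qed
  ultimately obtain \<beta> where \<beta>: "w (to_ac \<beta>) = w \<alpha>" using inertia_fixed_value by blast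
  have "\<beta> \<noteq> 0" using \<beta> \<open>\<alpha> \<noteq> 0\<close> w_eq_0 by (metis to_ac_0)
  then obtain m :: int where m: "w \<alpha> = 2 powr (of_int m)" using discrete \<beta> by metis
  have "w \<alpha> ^ (Q * (Q - 1)) = (\<Prod>y\<in>Orb. w y ^ (Q * (Q - 1)))"
    by (simp add: \<alpha>_def w_prod prod_power_distrib)
  also have "\<dots> = (\<Prod>y\<in>Orb. 1/2)" using sub W0_value by (intro prod.cong refl) auto
  also have "\<dots> = 2 powr (- real (card Orb))" by (simp add: powr_minus powr_realpow power_divide inverse_eq_divide)
  finally have "2 powr (of_int m * real (Q * (Q - 1))) = 2 powr (- real (card Orb))"
    unfolding m by (simp add: powr_powr flip: powr_realpow)
  then have "of_int m * real (Q * (Q - 1)) = - real (card Orb)" by (simp add: powr_inj)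
  then have "of_int (m * int (Q * (Q - 1))) = (of_int (- int (card Orb)) :: real)" by simp
  then have "m * int (Q * (Q - 1)) = - int (card Orb)" by (simp only: of_int_eq_iff)
  then have "int (Q * (Q - 1)) dvd int (card Orb)" by (metis dvd_minus_iff dvd_triv_right)
  then have "Q * (Q - 1) dvd card Orb" by (simp only: int_dvd_int_iff)
  moreover have "card Orb > 0" using fin inertia_id by (auto simp: card_gt_0_iff Orb_def)
  ultimately have "card W0 \<le> card Orb" using card_W0_le by (meson dvd_imp_le le_trans)
  then have "Orb = W0" using sub finite_W0 by (simp add: card_seteq)
  then have "x \<in> Orb" using x by simp
  then show ?thesis unfolding Orb_def by blast
qed

section \<open>Linear algebra of the a-torsion\<close>

lemma bezout_act:
  assumes "\<not> a dvd b" "x \<in> Z1"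
  shows "\<exists>s. x = act s (act b x)"
proof -
  obtain s t where st: "s * b + t * a = 1" using poly_bezout_irreducible[OF irr assms(1)] by blast
  have "x = act (s * b + t * a) x" by (simp add: st act_1)
  also have "\<dots> = act s (act b x)" using assms(2) by (simp add: act_add act_mult Z1_def act_0)
  finally show ?thesis by blast
qed

lemma act_eq_0:
  assumes "\<not> a dvd b" "x \<in> Z1" "act b x = 0" shows "x = 0"
  using bezout_act[OF assms(1,2)] assms(3) act_0 by auto

lemma act_dvd: "a dvd b \<Longrightarrow> x \<in> Z1 \<Longrightarrow> act b x = 0"
  by (auto simp: Z1_def act_mult act_commute[of a] act_0 elim!: dvdE)

end

text \<open>A basis of the a-torsion over A/(a), expressed with representatives in A so that no
  quotient ring appears in the local argument.\<close>

locale good_place_2 = good_place w r \<phi> q a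
  for w :: "'k::{field,finite} poly fract alg_closure \<Rightarrow> real" and r \<phi> q a +
  fixes e1 e2 :: "'k poly fract alg_closure"
  assumes e: "e1 \<in> Z1" "e2 \<in> Z1"
    and span: "x \<in> Z1 \<Longrightarrow> \<exists>b1 b2. x = act b1 e1 + act b2 e2"
    and indep: "act b1 e1 + act b2 e2 = 0 \<Longrightarrow> a dvd b1 \<and> a dvd b2"
begin

text \<open>If e1 = b1 y and e2 = b2 y, then b2 e1 - b1 e2 = 0 forces \<open>a\<close> to divide b1,
  and e1 would be 0.\<close>

lemma not_cyclic:
  assumes y: "y \<in> Z1"
  shows "\<exists>u\<in>Z1. \<forall>b. u \<noteq> act b y"
proof (rule ccontr)
  assume "\<not> ?thesis"
  then obtain b1 b2 where b: "e1 = act b1 y" "e2 = act b2 y" using e by blast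
  then have "act b2 e1 + act (- b1) e2 = 0"
    using act_add[of "- b1" b1 e2] by (simp add: act_0_left act_commute[of b2 b1] eq_neg_iff_add_eq_0 add.commute)
  then have "a dvd b1" using indep by fastforce
  then have "e1 = 0" using b y act_dvd by simp
  then have "act 1 e1 + act 0 e2 = 0" by (simp add: act_0 act_0_left)
  then have "a dvd 1" using indep by blast
  then show False using irr by (simp add: irreducible_def)
qed

text \<open>D is the determinant of (y, z) in the basis (e1, e2); Cramer's rule avoids inverting it
  modulo \<open>a\<close>. If \<open>a\<close> divided D, whichever of \<alpha> and \<beta> is prime
  to \<open>a\<close> would exhibit z as a multiple of y.\<close>

lemma cramer:
  assumes y: "y \<in> Z1" "y \<noteq> 0" and z: "z \<in> Z1" "\<forall>b. z \<noteq> act b y"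
  shows "\<exists>D. \<not> a dvd D \<and> (\<forall>x\<in>Z1. \<exists>b1 b2. act D x = act b1 y + act b2 z)"
proof -
  obtain \<alpha> \<beta> where y': "y = act \<alpha> e1 + act \<beta> e2" using span y by blast
  obtain \<gamma> \<delta> where z': "z = act \<gamma> e1 + act \<delta> e2" using span z by blast
  define D where "D = \<alpha> * \<delta> - \<beta> * \<gamma>"
  have 1: "act D e1 = act \<delta> y - act \<beta> z" unfolding y' z' D_def
    by (simp add: act_diff_left act_linear mult.commute flip: act_mult)
  have 2: "act D e2 = act \<alpha> z - act \<gamma> y" unfolding y' z' D_def
    by (simp add: act_diff_left act_linear mult.commute flip: act_mult)
  have "\<not> a dvd D"
  proof
    assume d: "a dvd D"
    then have eq: "act \<beta> z = act \<delta> y" "act \<alpha> z = act \<gamma> y" using 1 2 e act_dvd by auto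
    have "\<not> a dvd \<alpha> \<or> \<not> a dvd \<beta>" using y' y(2) e act_dvd by fastforce
    then obtain b b' where "\<not> a dvd b" "act b z = act b' y" using eq by blast
    moreover from this obtain s where "z = act s (act b z)" using bezout_act z by blast
    ultimately have "z = act (s * b') y" by (simp add: act_mult)
    then show False using z by blast
  qed
  moreover have "\<exists>b1 b2. act D x = act b1 y + act b2 z" if "x \<in> Z1" for x
  proof -
    obtain u v where x: "x = act u e1 + act v e2" using span[OF \<open>x \<in> Z1\<close>] by blast
    have "act D x = act u (act D e1) + act v (act D e2)"
      unfolding x by (simp add: act_linear mult.commute flip: act_mult)
    also have "\<dots> = act (u * \<delta> - v * \<gamma>) y + act (v * \<alpha> - u * \<beta>) z"
      unfolding 1 2 by (simp add: act_diff act_diff_left flip: act_mult)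
    finally show ?thesis by blast
  qed
  ultimately show ?thesis by blast
qed

lemma fixes_Z1:
  assumes s: "\<sigma> \<in> ac_auts" and y: "y \<in> Z1" "y \<noteq> 0" "\<sigma> y = y"
    and z: "z \<in> Z1" "\<forall>b. z \<noteq> act b y" "\<sigma> z = z" and x: "x \<in> Z1"
  shows "\<sigma> x = x"
proof -
  obtain D where D: "\<not> a dvd D" "\<forall>x\<in>Z1. \<exists>b1 b2. act D x = act b1 y + act b2 z"
    using cramer[OF y(1,2) z(1,2)] by blast
  then obtain b1 b2 where "act D x = act b1 y + act b2 z" using x by blast
  then have "\<sigma> (act D x) = act D x" using y z s by (simp add: ac_auts_hom act_auts)
  then have "act D (\<sigma> x - x) = 0" using s by (simp add: act_auts act_diff)
  moreover have "\<sigma> x \<in> Z1" using x s by (simp add: Z1_def act_auts[symmetric] ac_auts_hom)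
  ultimately show ?thesis using act_eq_0[OF D(1), of "\<sigma> x - x"] x Z1_cl by auto
qed

text \<open>The quotients \<open>x / y\<close> are units with pairwise distinct residues, so an element of inertia
  that fixes \<open>y\<close> fixes all of \<open>Z1\<close>. Hence it acts on \<open>Z2\<close> as \<open>x \<mapsto> x + act m (act a x)\<close>, but
  transitivity lets it translate \<open>x0\<close> by a point outside the line spanned by \<open>y\<close>.\<close>

lemma supersingular:
  assumes scal: "\<And>\<sigma>. \<sigma> \<in> ac_auts \<Longrightarrow> (\<forall>x\<in>Z1. \<sigma> x = x) \<Longrightarrow> \<exists>m. \<forall>x\<in>Z2. \<sigma> x = x + act m (act a x)"
    and ss: "V0 = Z1" and y: "y \<in> V0" "y \<noteq> 0"
  shows False
proof -
  have yZ: "y \<in> Z1" using y by (simp add: V0_def)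
  obtain u where u: "u \<in> Z1" "\<forall>b. u \<noteq> act b y" using not_cyclic[OF yZ] by blast
  obtain x0 where x0: "x0 \<in> W0" "act a x0 = y" using W0_lift y by blast
  \<comment> \<open>In the supersingular case u too lies in the kernel of reduction, so translation
    by it stays inside \<open>W0\<close>.\<close>
  have "act a u = 0" "w u < 1" using u ss by (auto simp: V0_def Z1_def)
  then have "x0 + u \<in> W0" using x0 by (auto simp: W0_def Z2_def act_linear w_add_less)
  then obtain \<sigma> where s: "\<sigma> \<in> inertia" "\<sigma> x0 = x0 + u" using inertia_transitive x0 by blast
  have ac: "\<sigma> \<in> ac_auts" using s inertia_ac by blast
  have sy: "\<sigma> y = y" using act_auts[OF ac, of a x0] s x0 \<open>act a u = 0\<close> by (simp add: act_linear)
  have "\<sigma> x = x" if x: "x \<in> Z1" for x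
  proof (cases "x = 0")
    case False
    have "x \<in> V0" using x ss by simp
    then have "w x ^ (Q - 1) = w y ^ (Q - 1)" using w_V0(1)[OF _ False] w_V0(1)[OF y] by (simp only:)
    then have "w x = w y" using w_nonneg Q_gt_1 by (metis power_eq_iff_eq_base zero_less_diff)
    then have "w (x / y) \<le> 1" using w_pos[OF y(2)] by (simp add: w_divide)
    moreover have "x / y \<in> M" using x yZ Z1_subset_Z2 Z_subset_M by (intro field_setD[OF field_set_M]) auto
    ultimately have "w (\<sigma> (x / y) - x / y) < 1" using s by (intro inertia_near)
    also have "\<sigma> (x / y) - x / y = (\<sigma> x - x) / y" using ac sy by (simp add: ac_auts_hom diff_divide_distrib)
    finally have less: "w (\<sigma> x - x) < w y" using w_pos[OF y(2)] by (simp add: w_divide)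
    have "\<sigma> x \<in> Z1" using x ac by (simp add: Z1_def act_auts[symmetric] ac_auts_hom)
    then have d: "\<sigma> x - x \<in> V0" using x ss by (simp add: Z1_cl)
    show ?thesis
    proof (rule ccontr)
      assume "\<sigma> x \<noteq> x"
      then have "w (\<sigma> x - x) ^ (Q - 1) = w y ^ (Q - 1)" using w_V0(1)[OF d] w_V0(1)[OF y] by simp
      then have "w (\<sigma> x - x) = w y" using w_nonneg Q_gt_1 by (metis power_eq_iff_eq_base zero_less_diff)
      then show False using less by simp
    qed
  qed (simp add: ac_auts_hom ac)
  then obtain m where "\<forall>x\<in>Z2. \<sigma> x = x + act m (act a x)" using scal[OF ac] by blast
  then have "x0 + u = x0 + act m y" using x0 s by (auto simp: W0_def)
  then show False using u by simp
qed

text \<open>Conjugation by an element of inertia which multiplies \<open>x0\<close> by a constant \<open>\<kappa>\<close> scales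
  \<open>\<sigma> z - z\<close> by \<open>\<kappa>\<close> but leaves \<open>\<sigma> x0 - x0\<close> unchanged. Comparing the conjugates for \<open>\<kappa>\<close> and
  \<open>\<kappa> - 1\<close> with \<open>\<sigma>\<close> itself gives an element that fixes \<open>Z1\<close> and moves \<open>x0\<close>.\<close>

lemma ordinary:
  assumes scal: "\<And>\<sigma>. \<sigma> \<in> ac_auts \<Longrightarrow> (\<forall>x\<in>Z1. \<sigma> x = x) \<Longrightarrow> \<exists>m. \<forall>x\<in>Z2. \<sigma> x = x + act m (act a x)"
    and z: "z \<in> Z1" "z \<notin> V0" and y: "y \<in> V0" "y \<noteq> 0" and q3: "q \<ge> 3"
  shows False
proof -
  have yZ: "y \<in> Z1" using y by (simp add: V0_def)
  have zy: "\<forall>b. z \<noteq> act b y" using z V0_cl(3)[OF y(1)] by metis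
  \<comment> \<open>\<open>V0\<close> is the line of y: a second independent point would make D z,
    and then z itself, an element of \<open>V0\<close>.\<close>
  have line: "\<exists>b. v = act b y" if v: "v \<in> V0" for v
  proof (rule ccontr)
    assume n: "\<not> ?thesis"
    have "v \<in> Z1" using v by (simp add: V0_def)
    then obtain D where D: "\<not> a dvd D" "\<forall>x\<in>Z1. \<exists>b1 b2. act D x = act b1 y + act b2 v"
      using cramer[OF yZ y(2)] n by blast
    then obtain b1 b2 where "act D z = act b1 y + act b2 v" using z by blast
    then have "act D z \<in> V0" using V0_cl y v by simp
    moreover obtain s where "z = act s (act D z)" using bezout_act[OF D(1) z(1)] by blast
    ultimately show False using z V0_cl(3) by metis
  qed
  obtain x0 where x0: "x0 \<in> W0" "act a x0 = y" using W0_lift y by blast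
  have x0Z: "x0 \<in> Z2" "w x0 < 1" using x0 by (auto simp: W0_def)
  have "x0 + y \<in> W0" using x0 y by (auto simp: W0_def Z2_def V0_def Z1_def act_linear w_add_less)
  then obtain \<sigma> where s: "\<sigma> \<in> inertia" "\<sigma> x0 = x0 + y" using inertia_transitive x0 by blast
  have sac: "\<sigma> \<in> ac_auts" using s inertia_ac by blast
  have sy: "\<sigma> y = y" using act_auts[OF sac, of a x0] s x0 yZ by (simp add: act_linear Z1_def)
  have sV: "\<sigma> v = v" if "v \<in> V0" for v using line[OF that] sy sac by (auto simp: act_auts)
  \<comment> \<open>Since z is integral, inertia moves it only inside the kernel of
    reduction.\<close>
  have moves: "\<tau> z - z \<in> V0" if t: "\<tau> \<in> inertia" for \<tau>
  proof -
    have "\<tau> z \<in> Z1" using z inertia_ac[OF t] by (simp add: Z1_def act_auts[symmetric] ac_auts_hom)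
    moreover have "w (\<tau> z - z) < 1"
      using t z Z1_subset_Z2 Z_subset_M Z1_integral by (intro inertia_near) auto
    ultimately show ?thesis using z by (simp add: V0_def Z1_cl)
  qed
  define b where "b = \<sigma> z - z"
  have b: "b \<in> V0" unfolding b_def using moves s by blast
  have conj: "\<exists>\<rho>\<in>inertia. \<rho> x0 = x0 + y \<and> \<rho> z = z + of_A [:\<kappa>:] * b \<and> (\<forall>v\<in>V0. \<rho> v = v)"
    if l: "\<kappa> \<noteq> 0" for \<kappa>
  proof -
    let ?l = "of_A [:\<kappa>:]"
    have l0: "?l \<noteq> 0" and wl: "w ?l \<le> 1" using l integral[of "[:\<kappa>:]" 0] drinfeld_moduleD(4)[OF dm] by auto
    have lx: "?l * x = act [:\<kappa>:] x" for x by (simp add: act_const)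
    \<comment> \<open>Multiplication by a nonzero constant is the action of an element of A and
      keeps \<open>x0\<close> in \<open>W0\<close>. Transitivity realises it at \<open>x0\<close>,
      hence at y and on the whole line \<open>V0\<close>.\<close>
    have "w (?l * x0) < 1" using wl x0Z by (intro w_mult_less)
    moreover have "?l * x0 \<in> Z2" using x0Z unfolding lx Z2_def by (simp add: act_commute[of a "[:\<kappa>:]"] act_0)
    moreover have "act a (?l * x0) = ?l * y" unfolding lx using x0(2) by (simp add: act_commute[of a])
    ultimately have "?l * x0 \<in> W0" using l0 y by (simp add: W0_def)
    then obtain \<tau> where t: "\<tau> \<in> inertia" "\<tau> x0 = ?l * x0" using inertia_transitive x0 by blast
    have tac: "\<tau> \<in> ac_auts" using t inertia_ac by blast
    have ty: "\<tau> y = ?l * y" using act_auts[OF tac, of a x0] t x0 \<open>act a (?l * x0) = ?l * y\<close> by simp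
    have tV: "\<tau> v = ?l * v" if "v \<in> V0" for v
      using line[OF that] ty tac by (auto simp: act_auts lx act_commute)
    define \<tau>' where "\<tau>' = inv_into UNIV \<tau>"
    have t': "\<tau>' \<in> inertia" "\<tau>' \<in> ac_auts" unfolding \<tau>'_def using t tac by (auto simp: inertia_inv ac_auts_inv)
    have tt: "\<tau> (\<tau>' x) = x" "\<tau>' (\<tau> x) = x" for x unfolding \<tau>'_def using tac by (auto simp: ac_auts_inv)
    have tl: "\<tau> ?l = ?l" "\<tau>' ?l = ?l" "\<sigma> ?l = ?l" using tac t' sac by (auto simp: ac_auts_hom)
    have "\<tau>' (?l * x0) = x0" using tt(2)[of x0] t by simp
    then have t'x0: "\<tau>' x0 = x0 / ?l" using t' tl l0 by (simp add: ac_auts_hom field_simps)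
    have t'V: "\<tau>' v \<in> V0" if v: "v \<in> V0" for v
    proof -
      have "v \<in> M" using v Z1_subset_Z2 Z_subset_M by (auto simp: V0_def)
      then have "w (\<tau>' v) = w v" using t' by (intro inertia_w)
      then show ?thesis using v t' by (simp add: V0_def Z1_def act_auts[symmetric] ac_auts_hom)
    qed
    let ?\<rho> = "\<lambda>x. \<tau> (\<sigma> (\<tau>' x))"
    have \<rho>: "?\<rho> \<in> inertia" by (rule inertia_comp[OF t(1) inertia_comp[OF s(1) t'(1)]])
    have "?\<rho> x0 = \<tau> ((x0 + y) / ?l)" using t'x0 s sac tl by (simp add: ac_auts_hom)
    also have "\<dots> = x0 + y" using tac tl t ty l0 by (simp add: ac_auts_hom field_simps)
    finally have 1: "?\<rho> x0 = x0 + y" .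
    define v where "v = \<tau>' z - z"
    have v: "v \<in> V0" unfolding v_def using moves t' by blast
    have "?\<rho> z = \<tau> (\<sigma> z + \<sigma> v)" using sac by (simp add: v_def ac_auts_hom)
    also have "\<sigma> z + \<sigma> v = \<tau>' z + b" using sV[OF v] by (simp add: b_def v_def)
    also have "\<tau> (\<tau>' z + b) = z + ?l * b" using tac tt tV[OF b] by (simp add: ac_auts_hom)
    finally have 2: "?\<rho> z = z + ?l * b" .
    have 3: "?\<rho> v = v" if "v \<in> V0" for v using sV[OF t'V[OF that]] tt by simp
    show ?thesis by (intro bexI[OF _ \<rho>]) (use 1 2 3 in auto)
  qed
  \<comment> \<open>The comparison takes conjugates for both \<kappa> and \<kappa> - 1, which have
    to be nonzero; this is where the size of the finite field enters.\<close>
  have "\<exists>\<kappa>::'k. \<kappa> \<noteq> 0 \<and> \<kappa> \<noteq> 1"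
  proof (rule ccontr)
    assume "\<not> ?thesis"
    then have "(UNIV :: 'k set) \<subseteq> {0, 1}" by auto
    then have "CARD('k) \<le> card {0, 1 :: 'k}" by (intro card_mono) auto
    then show False using q3 by (simp add: q_eq)
  qed
  then obtain \<kappa> :: 'k where l: "\<kappa> \<noteq> 0" "\<kappa> - 1 \<noteq> 0" by auto
  obtain A where A: "A \<in> inertia" "A x0 = x0 + y" "A z = z + of_A [:\<kappa> - 1:] * b" "\<forall>v\<in>V0. A v = v"
    using conj[OF l(2)] by blast
  obtain B where B: "B \<in> inertia" "B x0 = x0 + y" "B z = z + of_A [:\<kappa>:] * b" "\<forall>v\<in>V0. B v = v"
    using conj[OF l(1)] by blast
  define B' where "B' = inv_into UNIV B"
  have Aac: "A \<in> ac_auts" and Bac: "B \<in> ac_auts" using A B inertia_ac by auto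
  have B': "B' \<in> inertia" "B' \<in> ac_auts" "\<And>x. B' (B x) = x"
    unfolding B'_def using B Bac by (auto simp: inertia_inv ac_auts_inv)
  have B'V: "B' v = v" if "v \<in> V0" for v using B'(3)[of v] B that by simp
  \<comment> \<open>On z the shifts add up to (\<kappa> - 1) + 1 - \<kappa> = 0 times b, on x0 to 1
    + 1 - 1 = 1 times y.\<close>
  let ?\<rho> = "\<lambda>x. B' (A (\<sigma> x))"
  have \<rho>: "?\<rho> \<in> inertia" by (rule inertia_comp[OF B'(1) inertia_comp[OF A(1) s(1)]])
  have \<rho>ac: "?\<rho> \<in> ac_auts" using inertia_ac[OF \<rho>] .
  have "A (\<sigma> z) = A z + A b" using Aac by (simp add: b_def ac_auts_hom)
  also have "\<dots> = z + (of_A [:\<kappa> - 1:] + of_A [:1:]) * b" using A b by (simp add: pCons_one algebra_simps)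
  also have "of_A [:\<kappa> - 1:] + of_A [:1:] = (of_A [:\<kappa>:] :: 'k poly fract alg_closure)"
    by (simp flip: to_ac_add to_fract_add)
  finally have "A (\<sigma> z) = B z" using B by simp
  then have \<rho>z: "?\<rho> z = z" using B' by simp
  have \<rho>y: "?\<rho> y = y" using sV A B'V y by simp
  have "A (\<sigma> x0) = x0 + y + y" using s A Aac y by (simp add: ac_auts_hom)
  also have "\<dots> = B x0 + B y" using B y by simp
  finally have "?\<rho> x0 = x0 + y" using B' Bac by (simp add: ac_auts_hom B'V y)
  note \<rho>x0 = this
  have "\<forall>x\<in>Z1. ?\<rho> x = x" using fixes_Z1[OF \<rho>ac yZ y(2) \<rho>y z(1) zy \<rho>z] by blast
  then obtain m where m: "\<forall>x\<in>Z2. ?\<rho> x = x + act m (act a x)" using scal[OF \<rho>ac] by blast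
  then have "y = act m y" using \<rho>x0 x0 x0Z by auto
  then have nd: "\<not> a dvd m" using act_dvd yZ y(2) by metis
  \<comment> \<open>A point above z gives the contradiction: inertia moves it within the kernel of
    reduction, while the scalar form moves it by m z. As \<open>a\<close> does not divide m, z
    itself would be in the kernel.\<close>
  obtain x1 where x1: "act a x1 = z" using twisted_eval_surj[of "\<phi> a"] coeff_0_nz[OF a_nz] by fastforce
  have x1Z: "x1 \<in> Z2" using x1 z by (simp add: Z2_def Z1_def)
  then have "w (?\<rho> x1 - x1) < 1" using \<rho> Z_subset_M Z2_integral by (intro inertia_near) auto
  moreover have "?\<rho> x1 = x1 + act m z" using m x1Z x1 by simp
  ultimately have "w (act m z) < 1" by simp
  then have "act m z \<in> V0" using z by (simp add: V0_def Z1_cl)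
  moreover obtain t where "z = act t (act m z)" using bezout_act[OF nd z(1)] by blast
  ultimately show False using z V0_cl(3) by metis
qed

theorem nonscalar_automorphism:
  assumes q3: "q \<ge> 3"
  shows "\<exists>\<sigma>\<in>ac_auts. (\<forall>x\<in>Z1. \<sigma> x = x) \<and> \<not> (\<exists>m. \<forall>x\<in>Z2. \<sigma> x = x + act m (act a x))"
proof (rule ccontr)
  assume "\<not> ?thesis"
  then have scal: "\<And>\<sigma>. \<sigma> \<in> ac_auts \<Longrightarrow> (\<forall>x\<in>Z1. \<sigma> x = x) \<Longrightarrow> \<exists>m. \<forall>x\<in>Z2. \<sigma> x = x + act m (act a x)"
    by blast
  have "V0 \<noteq> {0}" using card_V0 Q_gt_1 by auto
  then obtain y where y: "y \<in> V0" "y \<noteq> 0" using V0_cl(4) by blast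
  show False
  proof (cases "V0 = Z1")
    case True
    then show False using supersingular scal y by blast
  next
    case False
    then obtain z where "z \<in> Z1" "z \<notin> V0" by (auto simp: V0_def)
    then show False using ordinary scal y q3 by blast
  qed
qed

end

section \<open>Coordinates in the torsion modules\<close>

lemma A_ring_simps:
  "carrier A_ring = UNIV" "x \<otimes>\<^bsub>A_ring\<^esub> y = x * y" "x \<oplus>\<^bsub>A_ring\<^esub> y = x + y"
  "\<one>\<^bsub>A_ring\<^esub> = 1" "\<zero>\<^bsub>A_ring\<^esub> = 0"
  by (simp_all add: ring_of_type_algebra_def)

text \<open>The coset m + (b), the shape in which \<open>A_ring Quot\<close> represents residue
  classes.\<close>

definition residue :: "'k::{field,finite} poly \<Rightarrow> 'k poly \<Rightarrow> 'k poly set" where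
  "residue b m = {y. b dvd y - m}"

lemma residue_eq_iff: "residue b m = residue b m' \<longleftrightarrow> b dvd m - m'"
proof
  assume "residue b m = residue b m'"
  moreover have "m \<in> residue b m" by (simp add: residue_def)
  ultimately show "b dvd m - m'" by (simp add: residue_def)
next
  assume d: "b dvd m - m'"
  have "b dvd y - m \<longleftrightarrow> b dvd y - m'" for y
    using dvd_add_left_iff[OF d, of "y - m"] by simp
  then show "residue b m = residue b m'" by (simp add: residue_def)
qed

lemma some_residue: "b dvd (SOME y. y \<in> residue b m) - m"
proof -
  have "m \<in> residue b m" by (simp add: residue_def)
  then have "(SOME y. y \<in> residue b m) \<in> residue b m" by (rule someI)
  then show ?thesis by (simp add: residue_def)
qed

lemma coset_multiples: "{x. b dvd x} +>\<^bsub>A_ring\<^esub> m = residue b m"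
proof -
  have "y \<in> {x. b dvd x} +>\<^bsub>A_ring\<^esub> m \<longleftrightarrow> y \<in> residue b m" for y
    by (auto simp: a_r_coset_def' A_ring_simps residue_def intro!: exI[of _ "y - m"])
  then show ?thesis by blast
qed

lemma Quot_multiples:
  "carrier (A_ring Quot {x. b dvd x}) = range (residue b)"
  "\<one>\<^bsub>A_ring Quot {x. b dvd x}\<^esub> = residue b 1"
  "\<zero>\<^bsub>A_ring Quot {x. b dvd x}\<^esub> = residue b 0"
  by (auto simp: FactRing_def A_RCOSETS_def' A_ring_simps coset_multiples residue_def)

lemma PIdl_eq: "PIdl\<^bsub>A_ring\<^esub> b = {x. b dvd x}"
  by (auto simp: cgenideal_def A_ring_simps dvd_def mult.commute)

lemma residue_reduce: "residue (a * b) m <+>\<^bsub>A_ring\<^esub> {x. a dvd x} = residue a m"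
proof -
  have "\<exists>h\<in>residue (a * b) m. \<exists>k. a dvd k \<and> y = h + k" if "a dvd y - m" for y
    using that by (intro bexI[of _ m] exI[of _ "y - m"]) (auto simp: residue_def)
  moreover have "a dvd h + k - m" if "a * b dvd h - m" "a dvd k" for h k
    using dvd_add[OF dvd_mult_left[OF that(1)] that(2)] by (simp add: algebra_simps)
  ultimately show ?thesis
    by (auto simp: set_add_def' A_ring_simps residue_def)
qed

lemma ideal_prod_multiples: "{x. a dvd x} \<cdot>\<^bsub>A_ring\<^esub> {x. a dvd x} = {x. a * a dvd x}"
proof (intro equalityI subsetI)
  fix x assume "x \<in> {x. a dvd x} \<cdot>\<^bsub>A_ring\<^esub> {x. a dvd x}"
  then show "x \<in> {x. a * a dvd x}"
    by induction (auto simp: A_ring_simps mult_dvd_mono)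
next
  fix x assume "x \<in> {x. a * a dvd x}"
  then obtain c where "x = a * a * c" by blast
  then have "x = a \<otimes>\<^bsub>A_ring\<^esub> (a * c)" by (simp add: A_ring_simps mult.assoc)
  then show "x \<in> {x. a dvd x} \<cdot>\<^bsub>A_ring\<^esub> {x. a dvd x}" by (auto intro!: ideal_prod.prod)
qed

lemma primeideal_A_ring:
  fixes I :: "'k::{field,finite} poly set"
  assumes "primeideal I A_ring" "I \<noteq> {0}"
  shows "\<exists>a. irreducible a \<and> I = {x. a dvd x}"
proof -
  interpret primeideal I A_ring by fact
  have mult: "x * y \<in> I" if "y \<in> I" for x y using I_l_closed[OF that, of x] by (simp add: A_ring_simps)
  have add: "x + y \<in> I" if "x \<in> I" "y \<in> I" for x y using additive_subgroup.a_closed[OF additive_subgroup_axioms that] by (simp add: A_ring_simps)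
  have diff: "x - y \<in> I" if "x \<in> I" "y \<in> I" for x y using add[OF that(1) mult[OF that(2), of "-1"]] by simp
  have "0 \<in> I" using additive_subgroup.zero_closed[OF additive_subgroup_axioms] by (simp add: A_ring_simps)
  then obtain b where b: "b \<in> I" "b \<noteq> 0" using assms(2) by blast
  define P where "P k \<longleftrightarrow> (\<exists>c\<in>I. c \<noteq> 0 \<and> degree c = k)" for k
  have "P (degree b)" using b by (auto simp: P_def)
  then have "P (Least P)" by (rule LeastI)
  then obtain a where a: "a \<in> I" "a \<noteq> 0" "degree a = Least P" by (auto simp: P_def)
  have "a dvd x" if x: "x \<in> I" for x
  proof (rule ccontr)
    assume "\<not> a dvd x"
    then have nz: "x mod a \<noteq> 0" by (simp add: dvd_eq_mod_eq_0)
    have "x mod a = x - x div a * a" by (simp add: minus_div_mult_eq_mod)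
    then have "x mod a \<in> I" using diff[OF x mult[OF a(1)]] by simp
    then have "P (degree (x mod a))" using nz by (auto simp: P_def)
    then have "Least P \<le> degree (x mod a)" by (rule Least_le)
    then show False using degree_mod_less[OF a(2), of x] nz a(3) by simp
  qed
  moreover have "x \<in> I" if "a dvd x" for x using that mult[OF a(1)] by (auto simp: mult.commute elim!: dvdE)
  ultimately have I: "I = {x. a dvd x}" by blast
  have "irreducible a"
  proof (rule Factorial_Ring.irreducibleI)
    show "\<not> a dvd 1"
    proof
      assume "a dvd 1"
      then have "I = UNIV" unfolding I by (auto intro: dvd_trans)
      then show False using I_notcarr by (simp add: A_ring_simps)
    qed
    fix b c assume bc: "a = b * c"
    then have "b \<in> I \<or> c \<in> I" using I_prime[of b c] a(1) by (simp add: A_ring_simps)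
    then have "b * c dvd b \<or> b * c dvd c" using bc I by auto
    then show "b dvd 1 \<or> c dvd 1"
      using a(2) bc dvd_mult_cancel_left[of b c 1] dvd_mult_cancel_right[of b c 1] by auto
  qed (rule a(2))
  with I show ?thesis by blast
qed

section \<open>Bases and matrices in terms of representatives\<close>

context drinfeld
begin

lemma act_multiple: "b dvd m \<Longrightarrow> act b x = 0 \<Longrightarrow> act m x = 0"
  by (auto simp: act_mult act_commute[of b] act_0 elim!: dvdE)

lemma act_cong: "b dvd m - m' \<Longrightarrow> act b x = 0 \<Longrightarrow> act m x = act m' x"
  using act_multiple[of b "m - m'" x] by (simp add: act_diff_left)

lemma act_sum: "act m (sum f S) = (\<Sum>i\<in>S. act m (f i))"
  by (induction S rule: infinite_finite_induct) (auto simp: act_0 act_linear)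

text \<open>The definition of \<open>torsion\<close> demands separability, which is automatic as the
  constant term b is nonzero, and allows any generator of the ideal, which changes nothing as
  generators divide each other.\<close>

lemma torsion_multiples:
  assumes b: "b \<noteq> 0"
  shows "torsion \<phi> {x. b dvd x} = {x. act b x = 0}"
proof (intro equalityI subsetI)
  fix x assume "x \<in> torsion \<phi> {x. b dvd x}"
  then obtain c where c: "{x. b dvd x} = {x. c dvd x}" "act c x = 0" unfolding torsion_def PIdl_eq by blast
  have "b \<in> {x. c dvd x}" unfolding c(1)[symmetric] by simp
  then have "c dvd b" by simp
  then show "x \<in> {x. act b x = 0}" using c(2) act_multiple by simp
next
  fix x assume x: "x \<in> {x. act b x = 0}"
  then have "separable_elem x" using twisted_roots_separable coeff_0_nz[OF b] by auto
  then show "x \<in> torsion \<phi> {x. b dvd x}" using x by (auto simp: torsion_def PIdl_eq sep_closure_def)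
qed

lemma lin_comb_residue:
  fixes e :: "'k poly fract alg_closure ^ 'r"
  assumes "\<And>i. act b (e $ i) = 0"
  shows "lin_comb \<phi> (\<chi> i. residue b (m i)) e = (\<Sum>i\<in>UNIV. act (m i) (e $ i))"
  using act_cong[OF some_residue assms] by (simp add: lin_comb_def residue_act_def)

lemma torsion_basisD:
  fixes e :: "'k poly fract alg_closure ^ 'r"
  assumes b: "b \<noteq> 0" and basis: "torsion_basis \<phi> {x. b dvd x} e"
  shows "act b (e $ i) = 0"
    "act b x = 0 \<Longrightarrow> \<exists>m. x = (\<Sum>i\<in>UNIV. act (m i) (e $ i))"
    "(\<Sum>i\<in>UNIV. act (m i) (e $ i)) = (\<Sum>i\<in>UNIV. act (m' i) (e $ i)) \<Longrightarrow> b dvd m i - m' i"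
proof -
  let ?C = "{c :: 'k poly set ^ 'r. \<forall>i. c $ i \<in> range (residue b)}"
  have bij: "bij_betw (\<lambda>c. lin_comb \<phi> c e) ?C {x. act b x = 0}"
    and t: "\<And>i. act b (e $ i) = 0"
    using basis by (auto simp: torsion_basis_def torsion_multiples[OF b] Quot_multiples)
  show "act b (e $ i) = 0" by (rule t)
  show "\<exists>m. x = (\<Sum>i\<in>UNIV. act (m i) (e $ i))" if "act b x = 0"
  proof -
    have "x \<in> (\<lambda>c. lin_comb \<phi> c e) ` ?C" using bij that by (simp add: bij_betw_def)
    then obtain c where c: "c \<in> ?C" "x = lin_comb \<phi> c e" by (rule imageE)
    then have "\<forall>i. \<exists>y. c $ i = residue b y" by blast
    then obtain m where "\<And>i. c $ i = residue b (m i)" by metis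
    then have "c = (\<chi> i. residue b (m i))" by (simp add: vec_eq_iff)
    then show ?thesis using c lin_comb_residue[OF t] by auto
  qed
  assume "(\<Sum>i\<in>UNIV. act (m i) (e $ i)) = (\<Sum>i\<in>UNIV. act (m' i) (e $ i))"
  then have "lin_comb \<phi> (\<chi> i. residue b (m i)) e = lin_comb \<phi> (\<chi> i. residue b (m' i)) e"
    by (simp add: lin_comb_residue[OF t])
  moreover have "(\<chi> i. residue b (m i)) \<in> ?C" "(\<chi> i. residue b (m' i)) \<in> ?C" by auto
  ultimately have "(\<chi> i. residue b (m i)) = (\<chi> i. residue b (m' i))"
    using inj_onD[OF bij_betw_imp_inj_on[OF bij]] by blast
  then show "b dvd m i - m' i" by (simp add: vec_eq_iff residue_eq_iff)
qed

text \<open>The description operator in \<open>mod_rep\<close> is resolved here: spanning gives a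
  matrix, independence modulo b makes it unique.\<close>

lemma mod_rep_residue:
  fixes e :: "'k poly fract alg_closure ^ 'r"
  assumes b: "b \<noteq> 0" and basis: "torsion_basis \<phi> {x. b dvd x} e"
    and \<sigma>: "\<And>j. act b (\<sigma> (e $ j)) = 0"
  shows "\<exists>m. mod_rep \<phi> {x. b dvd x} e \<sigma> = (\<chi> i j. residue b (m i j)) \<and>
     (\<forall>j. \<sigma> (e $ j) = (\<Sum>i\<in>UNIV. act (m i j) (e $ i)))"
proof -
  note B = torsion_basisD[OF b basis]
  have "\<exists>m. \<sigma> (e $ j) = (\<Sum>i\<in>UNIV. act (m i) (e $ i))" for j using B(2)[OF \<sigma>] .
  then obtain m' where "\<And>j. \<sigma> (e $ j) = (\<Sum>i\<in>UNIV. act (m' j i) (e $ i))" by metis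
  then obtain m where m: "\<And>j. \<sigma> (e $ j) = (\<Sum>i\<in>UNIV. act (m i j) (e $ i))"
    using that[of "\<lambda>i j. m' j i"] by blast
  have "mod_rep \<phi> {x. b dvd x} e \<sigma> = (\<chi> i j. residue b (m i j))"
    unfolding mod_rep_def Quot_multiples
  proof (rule the_equality)
    show "(\<forall>i j. (\<chi> i j. residue b (m i j)) $ i $ j \<in> range (residue b)) \<and>
      (\<forall>j. \<sigma> (e $ j) = lin_comb \<phi> (\<chi> i. (\<chi> i j. residue b (m i j)) $ i $ j) e)"
      using lin_comb_residue[OF B(1)] m by simp
    fix M assume M: "(\<forall>i j. M $ i $ j \<in> range (residue b)) \<and> (\<forall>j. \<sigma> (e $ j) = lin_comb \<phi> (\<chi> i. M $ i $ j) e)"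
    then have "\<forall>i j. \<exists>y. M $ i $ j = residue b y" by blast
    then obtain u where u: "\<And>i j. M $ i $ j = residue b (u i j)" by metis
    have "residue b (u i j) = residue b (m i j)" for i j
      unfolding residue_eq_iff
    proof (rule B(3)[of "\<lambda>i. u i j" "\<lambda>i. m i j"])
      show "(\<Sum>i\<in>UNIV. act (u i j) (e $ i)) = (\<Sum>i\<in>UNIV. act (m i j) (e $ i))"
        using M m[of j] lin_comb_residue[OF B(1), of "\<lambda>i. u i j"] by (simp add: u)
    qed
    then show "M = (\<chi> i j. residue b (m i j))" by (simp add: vec_eq_iff u)
  qed
  then show ?thesis using m by blast
qed

end

text \<open>Induction along \<open>pCons\<close>: c + T b is sent to \<open>\<phi> [:c:]\<close>
  plus the twisted product of the images of T and b, and twisted multiplication preserves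
  integrality.\<close>

lemma (in drinfeld) integral_coeffs:
  assumes w: "nonarch w" and A: "\<And>b. w (of_A b) \<le> 1"
    and T: "\<And>i. w (to_ac (coeff (\<phi> [:0, 1:]) i)) \<le> 1"
  shows "w (to_ac (coeff (\<phi> b) i)) \<le> 1"
proof -
  interpret nonarch w by fact
  have mult: "w (to_ac (coeff (twisted_mult f g) i)) \<le> 1"
    if f: "\<And>i. w (to_ac (coeff f i)) \<le> 1" and g: "\<And>i. w (to_ac (coeff g i)) \<le> 1"
    for f g :: "'k poly fract poly" and i
  proof -
    have "w (to_ac (coeff f m) * to_ac (coeff g l) ^ k) \<le> 1" for k l m
      using f[of m] g[of l] by (simp add: w_mult w_power mult_le_one power_le_one w_nonneg)
    then show ?thesis
      unfolding twisted_mult_def coeff_sum to_ac_sum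
      by (intro w_sum_le) (auto simp: coeff_monom w_0)
  qed
  show ?thesis
  proof (induction b arbitrary: i)
    case 0
    have "\<phi> 0 = 0" using drinfeld_moduleD(1)[OF dm, of 0 0] by (metis add_0 add_left_cancel add.right_neutral)
    then show ?case by (simp add: w_0)
  next
    case (pCons c b)
    have const: "w (to_ac (coeff (\<phi> [:c:]) i)) \<le> 1" for i
    proof (cases "i = 0")
      case False
      then have "coeff (\<phi> [:c:]) i = 0"
        using drinfeld_moduleD(3)[OF dm, of "[:c:]"] by (intro coeff_eq_0) simp
      then show ?thesis by (simp add: w_0)
    qed (simp add: drinfeld_moduleD(4)[OF dm] A)
    have eq: "\<phi> (pCons c b) = \<phi> [:c:] + twisted_mult (\<phi> [:0, 1:]) (\<phi> b)"
      by (simp flip: drinfeld_moduleD(1,2)[OF dm])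
    have "w (to_ac (coeff (\<phi> [:c:]) i) + to_ac (coeff (twisted_mult (\<phi> [:0, 1:]) (\<phi> b)) i)) \<le> max 1 1"
      using const mult[OF T pCons.IH] by (intro order_trans[OF w_add] max.mono) auto
    then show ?case by (simp add: eq)
  qed
qed

text \<open>The same recursion. As r > 0, the constant \<open>\<phi> [:c:]\<close> does not reach
  the top degree, where the leading coefficients multiply, the second one raised to a power of
  q.\<close>

lemma (in drinfeld) unit_lead_coeff:
  assumes w: "nonarch w" and const: "\<And>c. c \<noteq> 0 \<Longrightarrow> w (of_A [:c:]) = 1"
    and T: "w (to_ac (lead_coeff (\<phi> [:0, 1:]))) = 1" and r: "r > 0" and b: "b \<noteq> 0"
  shows "w (to_ac (lead_coeff (\<phi> b))) = 1"
  using b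
proof (induction b)
  case (pCons c b)
  interpret nonarch w by fact
  have dT: "degree (\<phi> [:0, 1:]) = r" using drinfeld_moduleD(3)[OF dm, of "[:0, 1:]"] by simp
  show ?case
  proof (cases "b = 0")
    case True
    then show ?thesis
      using pCons.prems const[of c] drinfeld_moduleD(3,4)[OF dm, of "[:c:]"] by simp
  next
    case False
    have d: "degree (\<phi> (pCons c b)) = r + r * degree b"
      using drinfeld_moduleD(3)[OF dm, of "pCons c b"] False by simp
    have eq: "\<phi> (pCons c b) = \<phi> [:c:] + twisted_mult (\<phi> [:0, 1:]) (\<phi> b)"
      by (simp flip: drinfeld_moduleD(1,2)[OF dm])
    have "coeff (\<phi> [:c:]) (r + r * degree b) = 0"
      using r drinfeld_moduleD(3)[OF dm, of "[:c:]"] by (intro coeff_eq_0) simp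
    then have "lead_coeff (\<phi> (pCons c b)) =
        lead_coeff (\<phi> [:0, 1:]) * lead_coeff (\<phi> b) ^ (CARD('k) ^ degree (\<phi> [:0, 1:]))"
      using lead_coeff_twisted_mult[of "\<phi> [:0, 1:]" "\<phi> b"] drinfeld_moduleD(3)[OF dm, of b]
      unfolding d dT by (simp add: eq dT)
    then show ?thesis using T pCons.IH[OF False] by (simp add: w_mult w_power)
  qed
qed simp

theorem theorem4p7:
  fixes \<ll> :: "'k :: {field, finite} poly set"
    and g\<^sub>1 g\<^sub>2 :: "'k poly"
    and \<phi> :: "'k poly \<Rightarrow> 'k poly fract poly"
    and e e' :: "'k poly fract alg_closure ^ 2"
  assumes "CARD('k) \<ge> 4"
    and "primeideal \<ll> A_ring" and "\<ll> \<noteq> {0}"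
    and "g\<^sub>2 \<noteq> 0"
    and "drinfeld_module 2 \<phi>"
    and "\<phi> [:0, 1:] = [:to_fract [:0, 1:], to_fract g\<^sub>1, to_fract g\<^sub>2:]"
    and "torsion_basis \<phi> \<ll> e"
    and "torsion_basis \<phi> (\<ll> \<cdot>\<^bsub>A_ring\<^esub> \<ll>) e'"
    and "SL2 (A_ring Quot \<ll>) \<subseteq> mod_rep_image \<phi> \<ll> e"
    and "g\<^sub>2 \<notin> \<ll>"
  shows "\<exists>M \<in> mod_rep_image \<phi> (\<ll> \<cdot>\<^bsub>A_ring\<^esub> \<ll>) e'.
           \<not> is_scalar (A_ring Quot (\<ll> \<cdot>\<^bsub>A_ring\<^esub> \<ll>)) M \<and>
           reduce_matrix \<ll> M = scalar_matrix (A_ring Quot \<ll>) \<one>\<^bsub>A_ring Quot \<ll>\<^esub>"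
proof -
  obtain a where irr: "irreducible a" and l: "\<ll> = {x. a dvd x}"
    using primeideal_A_ring[OF assms(2,3)] by blast
  have ll: "\<ll> \<cdot>\<^bsub>A_ring\<^esub> \<ll> = {x. a * a dvd x}" unfolding l by (rule ideal_prod_multiples)
  have a0: "a \<noteq> 0" "a * a \<noteq> 0" using irr by auto
  have nu: "\<not> a dvd 1" using irr by (simp add: irreducible_def)
  obtain w where w: "nonarch w" "w (of_A a) = 1/2" "\<And>b. w (of_A b) \<le> 1" "\<And>b. \<not> a dvd b \<Longrightarrow> w (of_A b) = 1"
    using adic_extension[OF irr] by blast
  interpret drinfeld 2 \<phi> by (unfold_locales) (rule assms(5))
  note E = torsion_basisD[OF a0(1) assms(7)[unfolded l]]
  note E' = torsion_basisD[OF a0(2) assms(8)[unfolded ll]]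
  have T: "w (to_ac (coeff (\<phi> [:0, 1:]) i)) \<le> 1" for i
    unfolding assms(6) using w(3) nonarch.w_0[OF w(1)] by (auto simp: coeff_pCons split: nat.splits)
  have const: "w (of_A [:c:]) = 1" if "c \<noteq> 0" for c
  proof (rule w(4))
    have "[:c:] dvd 1" using that by (simp add: is_unit_iff_degree)
    then show "\<not> a dvd [:c:]" using nu dvd_trans by blast
  qed
  \<comment> \<open>Good reduction: \<open>g\<^sub>2\<close> is prime to a, so the leading
    coefficient at T is a unit.\<close>
  have lead_T: "w (to_ac (lead_coeff (\<phi> [:0, 1:]))) = 1"
    unfolding assms(6) using w(4)[of g\<^sub>2] assms(4,10) by (simp add: l)
  interpret good_place w 2 \<phi> "CARD('k)" a
  proof (intro good_place.intro good_place_axioms.intro)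
    show "w (to_ac (coeff (\<phi> b) i)) \<le> 1" for b i by (rule integral_coeffs[OF w(1,3) T])
    show "w (to_ac (lead_coeff (\<phi> a))) = 1"
      by (rule unit_lead_coeff[OF w(1) const lead_T _ a0(1)]) simp_all
    show "\<exists>m::int. w (to_ac f) = 2 powr of_int m" if "f \<noteq> 0" for f
      using adic_value_group[OF irr w(1,2,4) that] .
  qed (use irr w drinfeld_axioms in auto)
  interpret good_place_2 w 2 \<phi> "CARD('k)" a "e $ 1" "e $ 2"
  proof
    show "e $ 1 \<in> Z1" "e $ 2 \<in> Z1" using E(1) by (auto simp: Z1_def)
    show "\<exists>b1 b2. x = act b1 (e $ 1) + act b2 (e $ 2)" if "x \<in> Z1" for x
      using E(2)[of x] that by (auto simp: Z1_def sum_2)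
    show "a dvd b1 \<and> a dvd b2" if sum0: "act b1 (e $ 1) + act b2 (e $ 2) = 0" for b1 b2
    proof -
      have "a dvd (if i = 1 then b1 else b2) - 0" for i :: 2
        by (rule E(3)[of "\<lambda>i. if i = 1 then b1 else b2" "\<lambda>i. 0"]) (simp add: sum_2 act_0_left sum0)
      from this[of 1] this[of 2] show ?thesis by simp
    qed
  qed
  obtain \<sigma> where s: "\<sigma> \<in> ac_auts" and fixes1: "\<forall>x\<in>Z1. \<sigma> x = x"
    and nonscalar: "\<not> (\<exists>m. \<forall>x\<in>Z2. \<sigma> x = x + act m (act a x))"
    using nonscalar_automorphism assms(1) by auto
  define \<sigma>' where "\<sigma>' = restrict \<sigma> (carrier sep_closure)"
  have gal: "\<sigma>' \<in> abs_galois" unfolding \<sigma>'_def by (rule ac_auts_restrict_abs_galois[OF s])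
  have e'Z: "e' $ j \<in> Z2" for j using E'(1) by (simp add: Z2_eq)
  then have \<sigma>'e: "\<sigma>' (e' $ j) = \<sigma> (e' $ j)" for j
    using separable_Z by (simp add: \<sigma>'_def sep_closure_def)
  have "act (a * a) (\<sigma>' (e' $ j)) = 0" for j
    using stable_Z[OF s e'Z] by (simp add: \<sigma>'e Z2_eq)
  from mod_rep_residue[where \<sigma> = \<sigma>', OF a0(2) assms(8)[unfolded ll] this] obtain m where
    M: "mod_rep \<phi> {x. a * a dvd x} e' \<sigma>' = (\<chi> i j. residue (a * a) (m i j))"
    and m: "\<And>j. \<sigma> (e' $ j) = (\<Sum>i\<in>UNIV. act (m i j) (e' $ i))"
    unfolding \<sigma>'e by blast
  let ?M = "\<chi> i j. residue (a * a) (m i j)"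
  have "?M \<in> mod_rep_image \<phi> {x. a * a dvd x} e'"
    unfolding mod_rep_image_def using gal M by (intro image_eqI[of _ _ \<sigma>']) auto
  moreover have "\<not> is_scalar (A_ring Quot {x. a * a dvd x}) ?M"
  proof
    assume "is_scalar (A_ring Quot {x. a * a dvd x}) ?M"
    then obtain u where u: "?M = scalar_matrix (A_ring Quot {x. a * a dvd x}) (residue (a * a) u)"
      by (auto simp: is_scalar_def Quot_multiples)
    have entry: "residue (a * a) (m i j) = residue (a * a) (if i = j then u else 0)" for i j
      using arg_cong[OF u, of "\<lambda>M. M $ i $ j"] by (simp add: scalar_matrix_def Quot_multiples)
    have "act (m i j) (e' $ i) = (if i = j then act u (e' $ i) else 0)" for i j
      using act_cong[OF entry[unfolded residue_eq_iff] E'(1), of i j i] by (simp add: act_0_left)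
    then have col: "\<sigma> (e' $ j) = act u (e' $ j)" for j unfolding m by simp
    have scal: "\<sigma> x = act u x" if xZ: "x \<in> Z2" for x
    proof -
      obtain b where x: "x = (\<Sum>i\<in>UNIV. act (b i) (e' $ i))" using E'(2)[of x] xZ by (auto simp: Z2_eq)
      show ?thesis unfolding x using s
        by (simp add: ac_auts_sum act_auts col act_sum act_commute[of u "b i" for i])
    qed
    \<comment> \<open>\<sigma> is multiplication by u and fixes the nonzero point
      \<open>e $ 1\<close> of the a-torsion, so u is 1 modulo a.\<close>
    have "a dvd u - 1"
    proof (rule ccontr)
      assume n: "\<not> a dvd u - 1"
      have "e $ 1 = 0"
      proof (rule act_eq_0[OF n])
        show z: "e $ 1 \<in> Z1" using E(1) by (simp add: Z1_def)
        then show "act (u - 1) (e $ 1) = 0"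
          using scal[of "e $ 1"] fixes1 Z1_subset_Z2 by (auto simp: act_diff_left act_1)
      qed
      then have "act 1 (e $ 1) + act 0 (e $ 2) = 0" by (simp add: act_0 act_0_left)
      then show False using indep nu by blast
    qed
    then obtain k where "u - 1 = a * k" by (rule dvdE)
    then have "u = 1 + k * a" by (simp add: algebra_simps)
    then have "\<forall>x\<in>Z2. \<sigma> x = x + act k (act a x)" using scal by (simp add: act_add act_1 act_mult)
    then show False using nonscalar by blast
  qed
  moreover have "reduce_matrix {x. a dvd x} ?M =
      scalar_matrix (A_ring Quot {x. a dvd x}) \<one>\<^bsub>A_ring Quot {x. a dvd x}\<^esub>"
  proof -
    \<comment> \<open>Applying a brings the basis vectors into the a-torsion, where \<sigma> is
      trivial; comparing coordinates modulo a^2 and cancelling one factor a gives the entries modulo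
      a.\<close>
    have dv: "a dvd m i j - (if i = j then 1 else 0)" for i j
    proof -
      have "act a (e' $ j) \<in> Z1" using e'Z by (rule Z1_cl)
      then have "act a (\<sigma> (e' $ j)) = act a (e' $ j)" using fixes1 s by (metis act_auts)
      then have "(\<Sum>i\<in>UNIV. act (a * m i j) (e' $ i)) = act a (e' $ j)"
        by (simp add: m act_sum act_mult)
      also have "\<dots> = (\<Sum>i\<in>UNIV. if i = j then act a (e' $ i) else 0)" by simp
      also have "\<dots> = (\<Sum>i\<in>UNIV. act (a * (if i = j then 1 else 0)) (e' $ i))"
        by (intro sum.cong) (auto simp: act_0_left)
      finally have "a * a dvd a * m i j - a * (if i = j then 1 else 0)" by (rule E'(3))
      then show ?thesis using a0 by (simp flip: right_diff_distrib)
    qed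
    have "residue a (m i j) = (if i = j then residue a 1 else residue a 0)" for i j
      using dv[of i j] by (cases "i = j") (simp_all add: residue_eq_iff)
    then show ?thesis
      by (simp add: vec_eq_iff reduce_matrix_def scalar_matrix_def residue_reduce Quot_multiples)
  qed
  ultimately show ?thesis unfolding ll unfolding l by blast
qed

end
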